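(* Assume $\mathcal E_0$ is composed of hyperbolic equilibria only. The family $\{\mathcal E_\varepsilon\}_{\varepsilon\in[0,\varepsilon_0]}$ is continuous at $\varepsilon=0$. Moreover, if $\mathcal E_0=\{u_*^{0,1},\dots,u_*^{0,k}\}$, then for $\varepsilon$ sufficiently small $\mathcal E_\varepsilon=\{u_*^{\varepsilon,1},\dots,u_*^{\varepsilon,k}\}$ and $$\|u_*^{\varepsilon,i}-u_*^{0,i}\|_{X_\varepsilon^{1/2}}\le C\big(\|p_\varepsilon-p_0\|_{L^\infty(\Omega_1)}+\varepsilon\big)^{1/2},\qquad i=1,\dots,k,$$ where $C$ is a positive constant independent of $\varepsilon$.
   Context: Setting. Fix $0<\varepsilon_0\le 1$, $\lambda>0$, $m_0>0$ and a partition $0=x_0<x_1<x_2<x_3=1$. Put $\Omega_0=(x_1,x_2)$ and $\Omega_1=[0,x_1]\cup[x_2,1]$. For $\varepsilon\in(0,\varepsilon_0]$ let $p_\varepsilon\in C^2([0,1])$, and let $p_0\in C^2(\Omega_1)$, be such that: $p_\varepsilon\to p_0$ uniformly in $\Omega_1$ as $\varepsilon\to0$; $p_\varepsilon(x)\ge 1/\varepsilon$ for $x\in[x_1+\varepsilon,x_2-\varepsilon]$; $p_\varepsilon\ge m_0$ in $(0,1)$ (hence $p_0\ge m_0$ in $\Omega_1$). Let $f\in C^2(\mathbb R)$ satisfy $\limsup_{|x|\to\infty}f(x)/x<\lambda$; without loss of generality $f$ is globally bounded with globally bounded derivatives up to second order. $f$ also denotes the associated Nemytskii operator $u\mapsto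 f\circ u$. Spaces. $L^2_{\Omega_0}(0,1)=\{u\in L^2(0,1): u \text{ is constant a.e. in }\Omega_0\}$ and $H^1_{\Omega_0}(0,1)=\{u\in H^1(0,1): u_x=0 \text{ in }\Omega_0\}$. For $\varepsilon\in(0,\varepsilon_0]$, $X_\varepsilon^{1/2}=H^1(0,1)$ with scalar product $\langle u,v\rangle_{X_\varepsilon^{1/2}}=\int_0^1p_\varepsilon u_xv_x\,dx+\int_0^1\lambda uv\,dx$; it contains $H^1_{\Omega_0}(0,1)$ as a closed subspace. Operators. For $\varepsilon\in(0,\varepsilon_0]$, $A_\varepsilon$ is the operator in $L^2(0,1)$ with domain $\{u\in H^2(0,1):u_x(0)=u_x(1)=0\}$ and $A_\varepsilon u=-(p_\varepsilon u_x)_x+\lambda u$. $A_0$ is the operator in $L^2_{\Omega_0}(0,1)$ with domain $\{u\in H^1_{\Omega_0}(0,1): -(p_0u_x)_x\in L^2(\Omega_1),\ u_x(0)=u_x(1)=0\}$ and $A_0u=\big[-(p_0u_x)_x+\lambda u\big]\chi_{\Omega_1}+\big[\lambda u_{\Omega_0}\big]\chi_{\Omega_0}$, where $u_{\Omega_0}$ is the constant value of $u$ in $\Omega_0$ and $\chi$ denotes the characteristic function. Equilibria. For $\varepsilon\in[0,\varepsilon_0]$, $\mathcal E_\varepsilon$ is the set of solutions $u$ of $A_\varepsilon u-f(u)=0$. An equilibrium $u_*^\varepsilon\in\mathcal E_\varepsilon$ is hyperbolic if $\sigma(A_\varepsilon-f'(u_*^\varepsilon))\cap\{\mu\in\mathbb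 C:\operatorname{Re}\mu=0\}=\varnothing$. Continuity. For $A,B\subset X_\varepsilon^{1/2}$ let $\mathrm{dist}_H(A,B)=\sup_{a\in A}\inf_{b\in B}\|a-b\|_{X_\varepsilon^{1/2}}$. A family $\{\mathcal E_\varepsilon\}$ is continuous at $\varepsilon=0$ if $\mathrm{dist}_H(\mathcal E_\varepsilon,\mathcal E_0)+\mathrm{dist}_H(\mathcal E_0,\mathcal E_\varepsilon)\to0$ as $\varepsilon\to0$.
   Formalization: A_0 is taken in weak form on H^1_{Ω_0}, so on Ω_0 it equals λu_{Ω_0} plus the flux jump (p_0u_x(x_1^-) - p_0u_x(x_2^+))/|Ω_0|, which the printed formula omits; with the printed A_0 the claim fails. *)

theory Defs
  imports "HOL-Analysis.Analysis" "HOL-Probability.Essential_Supremum"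
begin

text \<open>
  All operators are defined for functions with values in a Euclidean space. Equilibria are
  real-valued; spectra are computed for complex-valued functions, i.e. for the complexification
  of the real operator.
\<close>

section \<open>Function spaces\<close>

definition C2_on :: "real set \<Rightarrow> (real \<Rightarrow> real) \<Rightarrow> bool" where
  "C2_on S h \<longleftrightarrow> (\<exists>h' h''.
     (\<forall>x\<in>S. (h has_real_derivative h' x) (at x within S)) \<and>
     (\<forall>x\<in>S. (h' has_real_derivative h'' x) (at x within S)) \<and>
     continuous_on S h'')"

definition L2 :: "real set \<Rightarrow> (real \<Rightarrow> 'a::euclidean_space) set" where
  "L2 S = {u \<in> borel_measurable (lebesgue_on S). integrable (lebesgue_on S) (\<lambda>x. (norm (u x))\<^sup>2)}"

definition L2_norm :: "real set \<Rightarrow> (real \<Rightarrow> 'a::euclidean_space) \<Rightarrow> real" where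
  "L2_norm S u = sqrt (LINT x|lebesgue_on S. (norm (u x))\<^sup>2)"

definition Linf_norm :: "real set \<Rightarrow> (real \<Rightarrow> real) \<Rightarrow> real" where
  "Linf_norm S h = real_of_ereal (esssup (lebesgue_on S) (\<lambda>x. ereal \<bar>h x\<bar>))"

text \<open>Test functions are of class \<open>C\<^sup>1\<close> with compact support in the open set \<open>S\<close>; by
  mollification this gives the same weak derivatives as smooth test functions.\<close>

definition test_function :: "real set \<Rightarrow> (real \<Rightarrow> real) \<Rightarrow> (real \<Rightarrow> real) \<Rightarrow> bool" where
  "test_function S \<phi> \<phi>' \<longleftrightarrow>
     (\<forall>x. (\<phi> has_real_derivative \<phi>' x) (at x)) \<and> continuous_on UNIV \<phi>' \<and>
     (\<exists>K. compact K \<and> K \<subseteq> S \<and> (\<forall>x. x \<notin> K \<longrightarrow> \<phi> x = 0))"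

definition locally_integrable :: "real set \<Rightarrow> (real \<Rightarrow> 'a::euclidean_space) \<Rightarrow> bool" where
  "locally_integrable S u \<longleftrightarrow> (\<forall>K. compact K \<and> K \<subseteq> S \<longrightarrow> integrable (lebesgue_on K) u)"

definition has_weak_derivative ::
  "real set \<Rightarrow> (real \<Rightarrow> 'a::euclidean_space) \<Rightarrow> (real \<Rightarrow> 'a) \<Rightarrow> bool" where
  "has_weak_derivative S u v \<longleftrightarrow> locally_integrable S u \<and> locally_integrable S v \<and>
     (\<forall>\<phi> \<phi>'. test_function S \<phi> \<phi>' \<longrightarrow>
        (LINT x|lebesgue_on S. \<phi>' x *\<^sub>R u x) = - (LINT x|lebesgue_on S. \<phi> x *\<^sub>R v x))"

text \<open>A representative of the weak derivative, determined up to null sets.\<close>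

definition wderiv :: "real set \<Rightarrow> (real \<Rightarrow> 'a::euclidean_space) \<Rightarrow> real \<Rightarrow> 'a" where
  "wderiv S u = (SOME v. has_weak_derivative S u v)"

abbreviation I01 :: "real set" where "I01 \<equiv> {0<..<1}"

text \<open>A class in \<open>H\<^sup>1(0,1)\<close> is represented by its unique continuous representative on \<open>[0,1]\<close>,
  undefined elsewhere, so that equality of functions is equality in \<open>H\<^sup>1(0,1)\<close>.\<close>

definition H1 :: "(real \<Rightarrow> 'a::euclidean_space) set" where
  "H1 = {u \<in> extensional {0..1}. continuous_on {0..1} u \<and> (\<exists>v\<in>L2 I01. has_weak_derivative I01 u v)}"

definition H2 :: "(real \<Rightarrow> 'a::euclidean_space) set" where
  "H2 = {u \<in> H1. \<exists>w\<in>L2 I01. has_weak_derivative I01 (wderiv I01 u) w}"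

text \<open>\<open>u\<^sub>x(0) = u\<^sub>x(1) = 0\<close>. It is only imposed on functions whose weak derivative is continuous up
  to \<open>0\<close> and \<open>1\<close>, where its boundary values are the one-sided derivatives of \<open>u\<close>.\<close>

definition neumann :: "(real \<Rightarrow> 'a::euclidean_space) \<Rightarrow> bool" where
  "neumann u \<longleftrightarrow> (u has_vector_derivative 0) (at 0 within {0..1}) \<and>
                 (u has_vector_derivative 0) (at 1 within {0..1})"

abbreviation Om0 :: "real \<Rightarrow> real \<Rightarrow> real set" where "Om0 x1 x2 \<equiv> {x1<..<x2}"
abbreviation Om1 :: "real \<Rightarrow> real \<Rightarrow> real set" where "Om1 x1 x2 \<equiv> {0..x1} \<union> {x2..1}"
abbreviation int_Om1 :: "real \<Rightarrow> real \<Rightarrow> real set" where "int_Om1 x1 x2 \<equiv> {0<..<x1} \<union> {x2<..<1}"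

definition L2_Om0 :: "real \<Rightarrow> real \<Rightarrow> (real \<Rightarrow> 'a::euclidean_space) set" where
  "L2_Om0 x1 x2 = {u \<in> L2 I01. \<exists>c. AE x in lebesgue_on (Om0 x1 x2). u x = c}"

definition H1_Om0 :: "real \<Rightarrow> real \<Rightarrow> (real \<Rightarrow> 'a::euclidean_space) set" where
  "H1_Om0 x1 x2 = {u \<in> H1. AE x in lebesgue_on (Om0 x1 x2). wderiv I01 u x = 0}"

definition X_inner :: "(real \<Rightarrow> real) \<Rightarrow> real \<Rightarrow> (real \<Rightarrow> real) \<Rightarrow> (real \<Rightarrow> real) \<Rightarrow> real" where
  "X_inner q lam u v = (LINT x|lebesgue_on I01. q x * wderiv I01 u x * wderiv I01 v x)
                     + (LINT x|lebesgue_on I01. lam * u x * v x)"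

definition X_norm :: "(real \<Rightarrow> real) \<Rightarrow> real \<Rightarrow> (real \<Rightarrow> real) \<Rightarrow> real" where
  "X_norm q lam u = sqrt (X_inner q lam u u)"

section \<open>Operators\<close>

text \<open>Unbounded operators are given by their graphs: \<open>T u g\<close> means that \<open>u\<close> lies in the domain and
  that \<open>g\<close> is any representative of the class \<open>T u\<close>.\<close>

type_synonym 'a operator = "(real \<Rightarrow> 'a) \<Rightarrow> (real \<Rightarrow> 'a) \<Rightarrow> bool"

definition dom_A_eps :: "(real \<Rightarrow> 'a::euclidean_space) set" where
  "dom_A_eps = {u \<in> H2. neumann u}"

definition A_eps :: "(real \<Rightarrow> real) \<Rightarrow> real \<Rightarrow> 'a::euclidean_space operator" where
  "A_eps q lam u g \<longleftrightarrow> u \<in> dom_A_eps \<and> g \<in> L2 I01 \<and>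
     (AE x in lebesgue_on I01.
        - wderiv I01 (\<lambda>y. q y *\<^sub>R wderiv I01 u y) x + lam *\<^sub>R u x = g x)"

definition dom_A_0 :: "real \<Rightarrow> real \<Rightarrow> (real \<Rightarrow> real) \<Rightarrow> (real \<Rightarrow> 'a::euclidean_space) set" where
  "dom_A_0 x1 x2 p0 = {u \<in> H1_Om0 x1 x2.
     (\<exists>w\<in>L2 (int_Om1 x1 x2). has_weak_derivative (int_Om1 x1 x2) (\<lambda>x. p0 x *\<^sub>R wderiv I01 u x) w) \<and>
     neumann u}"

text \<open>
  The expression \<open>[-(p\<^sub>0 u\<^sub>x)\<^sub>x + \<lambda>u]\<chi>\<^bsub>\<Omega>\<^sub>1\<^esub> + [\<lambda>u\<^bsub>\<Omega>\<^sub>0\<^esub>]\<chi>\<^bsub>\<Omega>\<^sub>0\<^esub>\<close> is read in the duality with the form domain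
  \<open>H\<^sup>1\<^bsub>\<Omega>\<^sub>0\<^esub>(0,1)\<close>, so that \<open>-(p\<^sub>0 u\<^sub>x)\<^sub>x \<chi>\<^bsub>\<Omega>\<^sub>1\<^esub>\<close> includes the point masses of this distribution at the end
  points \<open>x\<^sub>1, x\<^sub>2\<close> of the closed set \<open>\<Omega>\<^sub>1\<close>. A test function has a single value on \<open>\<Omega>\<^sub>0\<close> and its end points,
  hence in \<open>L\<^sup>2\<^bsub>\<Omega>\<^sub>0\<^esub>(0,1)\<close> these masses amount to the constant
  \<open>(p\<^sub>0(x\<^sub>1) u\<^sub>x(x\<^sub>1-) - p\<^sub>0(x\<^sub>2) u\<^sub>x(x\<^sub>2+)) / (x\<^sub>2 - x\<^sub>1)\<close> on \<open>\<Omega>\<^sub>0\<close>. This is the self-adjoint operator of the limit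
  form. Taken pointwise almost everywhere, without the point masses, the same expression is a
  different operator, which is not self-adjoint and is not the limit of the operators \<open>A\<^sub>\<epsilon>\<close>.
\<close>

definition A_0 :: "real \<Rightarrow> real \<Rightarrow> (real \<Rightarrow> real) \<Rightarrow> real \<Rightarrow> 'a::euclidean_space operator" where
  "A_0 x1 x2 p0 lam u g \<longleftrightarrow> u \<in> dom_A_0 x1 x2 p0 \<and> g \<in> L2_Om0 x1 x2 \<and>
     (\<forall>\<phi>\<in>H1_Om0 x1 x2.
        (LINT x|lebesgue_on (Om1 x1 x2).
            (p0 x * wderiv I01 \<phi> x) *\<^sub>R wderiv I01 u x + (lam * \<phi> x) *\<^sub>R u x)
        + (LINT x|lebesgue_on (Om0 x1 x2). (lam * \<phi> x) *\<^sub>R u x)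
        = (LINT x|lebesgue_on I01. \<phi> x *\<^sub>R g x))"

text \<open>\<open>\<mu>\<close> is in the resolvent set of \<open>T\<close> on the closed subspace \<open>X\<close> of \<open>L\<^sup>2(0,1)\<close> if \<open>T - \<mu>\<close> is a bijection from
  the domain of \<open>T\<close> onto \<open>X\<close> with bounded inverse. Note that \<open>(T - \<mu>) u = g\<close> reads \<open>T u = g + \<mu> u\<close>.\<close>

definition resolvent_set :: "(real \<Rightarrow> complex) set \<Rightarrow> complex operator \<Rightarrow> complex set" where
  "resolvent_set X T = {\<mu>.
     (\<forall>g\<in>X. \<exists>!u. T u (\<lambda>x. g x + \<mu> * u x)) \<and>
     (\<exists>C. \<forall>g\<in>X. \<forall>u. T u (\<lambda>x. g x + \<mu> * u x) \<longrightarrow> L2_norm I01 u \<le> C * L2_norm I01 g)}"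

definition spectrum :: "(real \<Rightarrow> complex) set \<Rightarrow> complex operator \<Rightarrow> complex set" where
  "spectrum X T = - resolvent_set X T"

definition minus_mult :: "complex operator \<Rightarrow> (real \<Rightarrow> real) \<Rightarrow> complex operator" where
  "minus_mult T V u g \<longleftrightarrow> T u (\<lambda>x. g x + complex_of_real (V x) * u x)"

section \<open>Equilibria\<close>

definition equilibria :: "real operator \<Rightarrow> (real \<Rightarrow> real) \<Rightarrow> (real \<Rightarrow> real) set" where
  "equilibria T f = {u. T u (\<lambda>x. f (u x))}"

definition hyperbolic ::
  "(real \<Rightarrow> complex) set \<Rightarrow> complex operator \<Rightarrow> (real \<Rightarrow> real) \<Rightarrow> (real \<Rightarrow> real) \<Rightarrow> bool" where
  "hyperbolic X T f u \<longleftrightarrow> spectrum X (minus_mult T (\<lambda>x. deriv f (u x))) \<inter> {\<mu>. Re \<mu> = 0} = {}"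

definition dist_H :: "(real \<Rightarrow> real) \<Rightarrow> real \<Rightarrow> (real \<Rightarrow> real) set \<Rightarrow> (real \<Rightarrow> real) set \<Rightarrow> ennreal" where
  "dist_H q lam A B = (SUP a\<in>A. INF b\<in>B. ennreal (X_norm q lam (\<lambda>x. a x - b x)))"

definition continuous_at_0 ::
  "(real \<Rightarrow> real \<Rightarrow> real) \<Rightarrow> real \<Rightarrow> (real \<Rightarrow> (real \<Rightarrow> real) set) \<Rightarrow> (real \<Rightarrow> real) set \<Rightarrow> bool" where
  "continuous_at_0 p lam E E0 \<longleftrightarrow>
     ((\<lambda>\<epsilon>. dist_H (p \<epsilon>) lam (E \<epsilon>) E0 + dist_H (p \<epsilon>) lam E0 (E \<epsilon>)) \<longlongrightarrow> 0) (at_right 0)"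

end

theory Submission
  imports Defs
begin

text \<open>Put \<open>h s = lam s - f s\<close>. An equilibrium \<open>u\<close> of \<open>A\<^sub>\<epsilon>\<close> and its flux \<open>w = p\<^sub>\<epsilon> u\<^sub>x\<close> solve the first-order system
\<open>u\<^sub>x = q w\<close>, \<open>w\<^sub>x = h(u)\<close> with \<open>w(0) = w(1) = 0\<close> and \<open>q = 1 / p\<^sub>\<epsilon>\<close>. This form is insensitive to the blow-up
of \<open>p\<^sub>\<epsilon>\<close>: as \<open>\<epsilon> \<rightarrow> 0\<close>, the coefficients \<open>1 / p\<^sub>\<epsilon>\<close> stay below \<open>1 / m\<^sub>0\<close> and converge in \<open>L\<^sup>1(0,1)\<close> to the function
\<open>q\<^sub>0\<close> that is \<open>1 / p\<^sub>0\<close> on \<open>\<Omega>\<^sub>1\<close> and \<open>0\<close> on \<open>\<Omega>\<^sub>0\<close>, with an error of order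
\<open>\<tau> = \<parallel>p\<^sub>\<epsilon> - p\<^sub>0\<parallel>\<^sub>\<infinity> + \<epsilon>\<close> (\<open>coefficient_L1_distance\<close>). The same system with \<open>q\<^sub>0\<close> describes the equilibria of
\<open>A\<^sub>0\<close>: on \<open>\<Omega>\<^sub>0\<close> it makes \<open>u\<close> constant and lets \<open>w\<close> grow by \<open>(x\<^sub>2 - x\<^sub>1) h(u)\<close>, which is the balance of the point masses
in the weak form of \<open>A\<^sub>0\<close> (\<open>A_0_imp_flux_system\<close>, \<open>flux_system_imp_A_0\<close>).

Hence, for every \<open>\<epsilon> \<ge> 0\<close>, the equilibria are parametrised by the zeros of one real function of one real
variable, the shooting function \<open>F\<^sub>\<epsilon>(a) = w(1)\<close>, where \<open>(u, w)\<close> is the solution with \<open>u(0) = a\<close> and \<open>w(0) = 0\<close>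
(\<open>equilibria_eq_shooting_zeros\<close>). Solutions could blow up before \<open>x = 1\<close>, but by the sign of \<open>h\<close> at infinity those
with \<open>w(1) = 0\<close> stay in a fixed interval (\<open>flux_bounded_by_sign\<close>), outside of which \<open>h\<close> may be replaced by a
function with bounded derivative (\<open>truncated_nonlinearity\<close>).

Gronwall's inequality gives all that is needed about \<open>F\<^sub>\<epsilon>\<close>: it differs from \<open>F\<^sub>0\<close> by at most a multiple of
\<open>\<parallel>q\<^sub>\<epsilon> - q\<^sub>0\<parallel>\<^sub>1\<close> (\<open>flux_difference\<close>), and near a zero of \<open>F\<^sub>0\<close> its difference quotients are close to \<open>\<psi>(1)\<close>, uniformly
in \<open>\<epsilon>\<close>, where \<open>(\<phi>, \<psi>)\<close> solves the linearised limit system with \<open>\<phi>(0) = 1\<close>, \<open>\<psi>(0) = 0\<close> (\<open>flux_linearisation\<close>).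
If \<open>\<psi>(1)\<close> vanished, \<open>\<phi>\<close> would be an eigenfunction of \<open>A\<^sub>0 - f'(u)\<close> for the eigenvalue \<open>0\<close>, contrary to
hyperbolicity (\<open>hyperbolic_imp_transversal\<close>). So the zeros of \<open>F\<^sub>0\<close> are simple and lie in a compact interval. There
are finitely many of them, each continues to exactly one zero of \<open>F\<^sub>\<epsilon>\<close> at distance at most
\<open>C \<parallel>q\<^sub>\<epsilon> - q\<^sub>0\<parallel>\<^sub>1\<close>, and no others appear (\<open>perturbed_simple_zeros\<close>).

It remains to compare the functions belonging to nearby zeros (\<open>X_norm_flux_difference\<close>). All contributions to
the squared norm are of order \<open>\<tau>\<^sup>2\<close> except one: on \<open>\<Omega>\<^sub>0\<close>, where the limit has zero derivative, the energy density
\<open>p\<^sub>\<epsilon> u\<^sub>x\<^sup>2\<close> equals \<open>q\<^sub>\<epsilon> w\<^sup>2\<close>, whose integral is only of order \<open>\<parallel>q\<^sub>\<epsilon>\<parallel>\<^sub>1\<close>. This is the origin of the exponent \<open>1/2\<close>.\<close>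

section \<open>Lebesgue integrals on the unit interval\<close>

lemma AE_lebesgue_on_iff_negligible:
  fixes S :: "'a::euclidean_space set"
  assumes "S \<in> sets lebesgue"
  shows "(AE x in lebesgue_on S. P x) \<longleftrightarrow> negligible {x\<in>S. \<not> P x}"
proof -
  have "(AE x in lebesgue_on S. P x) \<longleftrightarrow> (AE x in lebesgue. x \<in> S \<longrightarrow> P x)"
    using assms by (simp add: AE_restrict_space_iff)
  also have "\<dots> \<longleftrightarrow> negligible {x\<in>S. \<not> P x}"
    by (simp add: completion.AE_iff_null_sets negligible_iff_null_sets)
  finally show ?thesis .
qed

lemma integrable_lebesgue_on_iff:
  fixes f :: "real \<Rightarrow> 'b::euclidean_space"
  assumes "S \<in> sets lebesgue"
  shows "integrable (lebesgue_on S) f \<longleftrightarrow> f absolutely_integrable_on S"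
  using assms by (simp add: set_integrable_def integrable_restrict_space)

text \<open>By completeness of Lebesgue measure, integrability (and not only the value of the integral) passes between
functions that agree almost everywhere. This is what makes the arbitrary choice of a representative in
\<open>wderiv\<close> harmless.\<close>

lemma integrable_lebesgue_on_cong_AE:
  fixes f g :: "real \<Rightarrow> 'b::euclidean_space"
  assumes "S \<in> sets lebesgue" "AE x in lebesgue_on S. f x = g x" "integrable (lebesgue_on S) f"
  shows "integrable (lebesgue_on S) g"
    and "integral\<^sup>L (lebesgue_on S) f = integral\<^sup>L (lebesgue_on S) g"
proof -
  have N: "negligible {x\<in>S. f x \<noteq> g x}" using assms by (simp add: AE_lebesgue_on_iff_negligible)
  show 1: "integrable (lebesgue_on S) g"
    unfolding integrable_lebesgue_on_iff[OF assms(1)]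
    by (rule absolutely_integrable_spike[OF _ N, where f=f])
      (use assms integrable_lebesgue_on_iff[OF assms(1), of f] in auto)
  show "integral\<^sup>L (lebesgue_on S) f = integral\<^sup>L (lebesgue_on S) g"
    unfolding lebesgue_integral_eq_integral[OF assms(3,1)] lebesgue_integral_eq_integral[OF 1 assms(1)]
    by (rule integral_spike[OF N]) auto
qed

lemma LINT_I01_eq:
  fixes f :: "real \<Rightarrow> 'b::euclidean_space"
  assumes "f absolutely_integrable_on {0..1}"
  shows "integrable (lebesgue_on I01) f" "(LINT x|lebesgue_on I01. f x) = integral {0..1} f"
proof -
  have "f absolutely_integrable_on I01"
    using assms by (rule set_integrable_subset) auto
  then show "integrable (lebesgue_on I01) f" by (simp add: integrable_lebesgue_on_iff)
  then show "(LINT x|lebesgue_on I01. f x) = integral {0..1} f"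
    by (simp add: lebesgue_integral_eq_integral integral_open_interval_real)
qed

lemma absolutely_integrable_scaleR_bounded:
  fixes f :: "real \<Rightarrow> 'b::euclidean_space" and g :: "real \<Rightarrow> real"
  assumes "f absolutely_integrable_on S" "S \<in> sets lebesgue"
    and "g \<in> borel_measurable (lebesgue_on S)" "\<And>x. x \<in> S \<Longrightarrow> \<bar>g x\<bar> \<le> B"
  shows "(\<lambda>x. g x *\<^sub>R f x) absolutely_integrable_on S"
proof -
  have i: "integrable (lebesgue_on S) f" using assms by (simp add: integrable_lebesgue_on_iff)
  have "integrable (lebesgue_on S) (\<lambda>x. g x *\<^sub>R f x)"
  proof (rule Bochner_Integration.integrable_bound[of _ "\<lambda>x. B *\<^sub>R f x"])
    show "AE x in lebesgue_on S. norm (g x *\<^sub>R f x) \<le> norm (B *\<^sub>R f x)"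
    proof (rule AE_I2)
      fix x assume "x \<in> space (lebesgue_on S)"
      then have "\<bar>g x\<bar> \<le> \<bar>B\<bar>" using assms(4)[of x] by auto
      then show "norm (g x *\<^sub>R f x) \<le> norm (B *\<^sub>R f x)" by (simp add: mult_right_mono)
    qed
  qed (use i assms in auto)
  then show ?thesis using assms by (simp add: integrable_lebesgue_on_iff)
qed

lemma absolutely_integrable_scaleR_continuous:
  fixes f :: "real \<Rightarrow> 'b::euclidean_space" and g :: "real \<Rightarrow> real"
  assumes "f absolutely_integrable_on {a..b}" "continuous_on {a..b} g"
  shows "(\<lambda>x. g x *\<^sub>R f x) absolutely_integrable_on {a..b}"
proof -
  have "bounded (g ` {a..b})" using assms compact_continuous_image compact_imp_bounded by blast
  then obtain B where "\<forall>x\<in>{a..b}. \<bar>g x\<bar> \<le> B" by (auto simp: bounded_iff)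
  with assms show ?thesis
    by (intro absolutely_integrable_scaleR_bounded[where B=B]) 
      (auto intro: continuous_imp_measurable_on_sets_lebesgue)
qed

lemmas absolutely_integrable_mult_bounded =
  absolutely_integrable_scaleR_bounded[where 'b=real, unfolded real_scaleR_def]
lemmas absolutely_integrable_mult_continuous =
  absolutely_integrable_scaleR_continuous[where 'b=real, unfolded real_scaleR_def]

lemma continuous_on_indefinite_integral:
  fixes f :: "real \<Rightarrow> real"
  assumes "f absolutely_integrable_on {0..1}"
  shows "continuous_on {0..1} (\<lambda>x. integral {0..x} f)"
  using assms by (intro indefinite_integral_continuous_1) (auto simp: absolutely_integrable_on_def)

text \<open>Integration by parts for two absolutely continuous functions that vanish at \<open>0\<close>. By Fubini, the two integrals
on the left are those of \<open>g x * f y\<close> over the two triangles \<open>y \<le> x\<close> and \<open>x < y\<close> of the unit square.\<close>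

lemma integral_by_parts_indefinite:
  fixes f g :: "real \<Rightarrow> real"
  assumes f: "f absolutely_integrable_on {0..1}" and g: "g absolutely_integrable_on {0..1}"
  shows "integral {0..1} (\<lambda>x. integral {0..x} f * g x) + integral {0..1} (\<lambda>x. f x * integral {0..x} g)
    = integral {0..1} f * integral {0..1} g"
proof -
  define M where "M = lebesgue_on {0..1::real}"
  interpret M: finite_measure M unfolding M_def by (rule finite_measure_lebesgue_on) auto
  interpret P: pair_sigma_finite M M by standard
  have fM: "integrable M f" and gM: "integrable M g" using f g by (auto simp: M_def integrable_lebesgue_on_iff)
  have [measurable]: "f \<in> borel_measurable M" "g \<in> borel_measurable M" using fM gM by auto
  have idM[measurable]: "(\<lambda>x. x) \<in> borel_measurable M" unfolding M_def
    using id_borel_measurable_lebesgue_on by (simp add: id_def)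
  \<comment> \<open>The integrand on the lower and on the upper triangle, arranged so that the inner integrals are indefinite integrals.\<close>
  define k where "k = (\<lambda>x y. g x * (f y * (if y \<le> x then 1 else 0)) :: real)"
  define k' where "k' = (\<lambda>x y. f y * (g x * (if y \<le> x then 0 else 1)) :: real)"
  have sp: "space M = {0..1}" by (simp add: M_def)
  have prod: "integrable (M \<Otimes>\<^sub>M M) (\<lambda>(x,y). g x * f y)"
  proof (rule P.Fubini_integrable)
    show "integrable M (\<lambda>x. LINT y|M. norm (case (x, y) of (x, y) \<Rightarrow> g x * f y))"
      using gM fM by (simp add: abs_mult)
  qed (use fM gM in auto)
  have meas: "(\<lambda>z. snd z \<le> fst z) \<in> measurable (M \<Otimes>\<^sub>M M) (count_space UNIV)"
    by measurable
  have ik: "integrable (M \<Otimes>\<^sub>M M) (\<lambda>(x,y). k x y)"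
    by (rule Bochner_Integration.integrable_bound[OF prod]) (auto simp: k_def)
  have ik': "integrable (M \<Otimes>\<^sub>M M) (\<lambda>(x,y). k' x y)"
    by (rule Bochner_Integration.integrable_bound[OF prod]) (auto intro!: AE_I2 simp: k'_def abs_mult)
  have conv: "(LINT x|M. h x) = integral {0..1} h" if "integrable M h" for h :: "real \<Rightarrow> real"
    using that unfolding M_def by (simp add: lebesgue_integral_eq_integral)
  have inner: "(LINT y|M. h y * (if y \<le> x then 1 else 0)) = integral {0..x} h"
    "(LINT y|M. h y * (if x \<le> y then 0 else 1)) = integral {0..x} h"
    if h: "integrable M h" and x: "x \<in> {0..1}" for h :: "real \<Rightarrow> real" and x
  proof -
    have m: "h \<in> borel_measurable M" using h by auto
    have "integrable M (\<lambda>y. h y * (if y \<le> x then 1 else 0))"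
      by (rule Bochner_Integration.integrable_bound[OF h]) (use m in auto)
    then have "(LINT y|M. h y * (if y \<le> x then 1 else 0)) = integral {0..1} (\<lambda>y. h y * (if y \<le> x then 1 else 0))"
      by (rule conv)
    also have "\<dots> = integral {0..1} (\<lambda>y. if y \<in> {0..x} then h y else 0)"
      by (rule integral_cong) auto
    also have "\<dots> = integral {0..x} h" using x by (subst integral_restrict_Int) (auto simp: Int_absorb1)
    finally show "(LINT y|M. h y * (if y \<le> x then 1 else 0)) = integral {0..x} h" .
    have "integrable M (\<lambda>y. h y * (if x \<le> y then 0 else 1))"
      by (rule Bochner_Integration.integrable_bound[OF h]) (use m in auto)
    then have "(LINT y|M. h y * (if x \<le> y then 0 else 1)) = integral {0..1} (\<lambda>y. h y * (if x \<le> y then 0 else 1))"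
      by (rule conv)
    also have "\<dots> = integral {0..1} (\<lambda>y. if y \<in> {0..x} then h y else 0)"
      by (rule integral_spike[of "{x}"]) auto
    also have "\<dots> = integral {0..x} h" using x by (subst integral_restrict_Int) (auto simp: Int_absorb1)
    finally show "(LINT y|M. h y * (if x \<le> y then 0 else 1)) = integral {0..x} h" .
  qed
  have "(LINT x|M. LINT y|M. k x y) = (LINT x|M. integral {0..x} f * g x)"
    using inner(1)[OF fM] by (intro Bochner_Integration.integral_cong) (auto simp: k_def sp)
  also have "\<dots> = integral {0..1} (\<lambda>x. integral {0..x} f * g x)"
    using absolutely_integrable_mult_continuous[OF g continuous_on_indefinite_integral[OF f]]
    by (intro conv) (simp add: M_def integrable_lebesgue_on_iff)
  finally have 1: "(LINT z|(M \<Otimes>\<^sub>M M). (case z of (x,y) \<Rightarrow> k x y)) = integral {0..1} (\<lambda>x. integral {0..x} f * g x)"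
    using P.integral_fst'[OF ik] by simp
  have "(LINT y|M. LINT x|M. k' x y) = (LINT x|M. f x * integral {0..x} g)"
  proof (intro Bochner_Integration.integral_cong refl)
    fix y assume "y \<in> space M"
    then show "(LINT x|M. k' x y) = f y * integral {0..y} g"
      using inner(2)[OF gM, of y] by (simp add: k'_def sp)
  qed
  also have "\<dots> = integral {0..1} (\<lambda>x. f x * integral {0..x} g)"
    using absolutely_integrable_mult_continuous[OF f continuous_on_indefinite_integral[OF g]]
    by (intro conv) (simp add: M_def integrable_lebesgue_on_iff mult.commute)
  finally have 2: "(LINT z|(M \<Otimes>\<^sub>M M). (case z of (x,y) \<Rightarrow> k' x y)) = integral {0..1} (\<lambda>x. f x * integral {0..x} g)"
    using P.integral_snd[OF ik'] by simp
  have "(LINT z|(M \<Otimes>\<^sub>M M). (case z of (x,y) \<Rightarrow> k x y)) + (LINT z|(M \<Otimes>\<^sub>M M). (case z of (x,y) \<Rightarrow> k' x y))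
      = (LINT z|(M \<Otimes>\<^sub>M M). (case z of (x,y) \<Rightarrow> g x * f y))"
    unfolding Bochner_Integration.integral_add[OF ik ik', symmetric]
    by (rule Bochner_Integration.integral_cong) (auto simp: k_def k'_def)
  also have "\<dots> = (LINT x|M. LINT y|M. g x * f y)"
    using P.integral_fst'[OF prod] by simp
  also have "\<dots> = integral {0..1} f * integral {0..1} g"
    using conv[OF fM] conv[OF gM] by simp
  finally show ?thesis using 1 2 by simp
qed

section \<open>Weak derivatives in one dimension\<close>

lemma test_function_support:
  assumes "test_function I01 \<phi> \<phi>'"
  obtains c d where "0 < c" "c < d" "d < 1" "\<And>x. x \<notin> {c..d} \<Longrightarrow> \<phi> x = 0 \<and> \<phi>' x = 0"
    "continuous_on UNIV \<phi>" "continuous_on UNIV \<phi>'"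
    "\<And>x. (\<phi> has_real_derivative \<phi>' x) (at x)"
proof -
  have D: "\<And>x. (\<phi> has_real_derivative \<phi>' x) (at x)" and c': "continuous_on UNIV \<phi>'"
    using assms by (auto simp: test_function_def)
  then have c: "continuous_on UNIV \<phi>" by (meson DERIV_isCont continuous_at_imp_continuous_on)
  obtain K where K: "compact K" "K \<subseteq> I01" "\<And>x. x \<notin> K \<Longrightarrow> \<phi> x = 0"
    using assms by (auto simp: test_function_def)
  have "\<exists>c d. 0 < c \<and> c < d \<and> d < 1 \<and> K \<subseteq> {c..d}"
  proof (cases "K = {}")
    case True then show ?thesis by (intro exI[of _ "1/4"] exI[of _ "1/2"]) auto
  next
    case False
    obtain a where a: "a \<in> K" "\<And>x. x \<in> K \<Longrightarrow> a \<le> x" using compact_attains_inf[OF K(1) False] by auto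
    obtain b where b: "b \<in> K" "\<And>x. x \<in> K \<Longrightarrow> x \<le> b" using compact_attains_sup[OF K(1) False] by auto
    have "0 < a" "a \<le> b" "b < 1" using a b K by auto
    then show ?thesis using a b by (intro exI[of _ "a"] exI[of _ "(b+1)/2"]) (force simp: field_simps)
  qed
  then obtain c d where cd: "0 < c" "c < d" "d < 1" "K \<subseteq> {c..d}" by blast
  have "\<phi> x = 0 \<and> \<phi>' x = 0" if "x \<notin> {c..d}" for x
  proof -
    have "open (-{c..d})" "x \<in> -{c..d}" using that by (auto simp: open_Compl)
    moreover have "\<And>y. y \<in> - {c..d} \<Longrightarrow> 0 = \<phi> y" using cd(4) K(3) by (metis Compl_iff subsetD)
    ultimately have "(\<phi> has_real_derivative 0) (at x)"
      using has_field_derivative_transform_within_open[OF DERIV_const[of 0]] by metis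
    then show ?thesis using D[of x] DERIV_unique cd K that by blast
  qed
  with cd D c c' show thesis by (intro that) auto
qed

text \<open>Products with a test function live on a compact subinterval of \<open>(0,1)\<close>, where a locally integrable function is
integrable. Weak derivatives can therefore be handled with gauge integrals over \<open>[0,1]\<close>.\<close>

lemma test_integral:
  fixes v :: "real \<Rightarrow> 'a::euclidean_space" and \<psi> :: "real \<Rightarrow> real"
  assumes "locally_integrable I01 v" "continuous_on UNIV \<psi>" "0 < c" "c < d" "d < 1"
    "\<And>x. x \<notin> {c..d} \<Longrightarrow> \<psi> x = 0"
  shows "(\<lambda>x. \<psi> x *\<^sub>R v x) absolutely_integrable_on {0..1}"
    and "(LINT x|lebesgue_on I01. \<psi> x *\<^sub>R v x) = integral {0..1} (\<lambda>x. \<psi> x *\<^sub>R v x)"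
    and "integral {0..1} (\<lambda>x. \<psi> x *\<^sub>R v x) = integral {c..d} (\<lambda>x. \<psi> x *\<^sub>R v x)"
proof -
  have "{c..d} \<subseteq> I01" "compact {c..d}" using assms by auto
  then have "integrable (lebesgue_on {c..d}) v" using assms(1) unfolding locally_integrable_def by blast
  then have "v absolutely_integrable_on {c..d}" by (simp add: integrable_lebesgue_on_iff)
  then have a: "(\<lambda>x. \<psi> x *\<^sub>R v x) absolutely_integrable_on {c..d}"
    using assms(2) by (intro absolutely_integrable_scaleR_continuous) (auto intro: continuous_on_subset)
  have eq: "(\<lambda>x. indicator {0..1} x *\<^sub>R (\<psi> x *\<^sub>R v x)) = (\<lambda>x. indicator {c..d} x *\<^sub>R (\<psi> x *\<^sub>R v x))"
    using assms(3-6) by (force simp: indicator_def)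
  then show 1: "(\<lambda>x. \<psi> x *\<^sub>R v x) absolutely_integrable_on {0..1}"
    using a unfolding set_integrable_def by simp
  show "(LINT x|lebesgue_on I01. \<psi> x *\<^sub>R v x) = integral {0..1} (\<lambda>x. \<psi> x *\<^sub>R v x)"
    by (rule LINT_I01_eq(2)[OF 1])
  have "integral {0..1} (\<lambda>x. \<psi> x *\<^sub>R v x) = integral {0..1} (\<lambda>x. if x \<in> {c..d} then \<psi> x *\<^sub>R v x else 0)"
    using assms(6) by (intro integral_cong) auto
  also have "\<dots> = integral ({0..1} \<inter> {c..d}) (\<lambda>x. \<psi> x *\<^sub>R v x)" by (simp only: integral_restrict_Int Int_commute)
  also have "{0..1} \<inter> {c..d} = {c..d}" using assms by auto
  finally show "integral {0..1} (\<lambda>x. \<psi> x *\<^sub>R v x) = integral {c..d} (\<lambda>x. \<psi> x *\<^sub>R v x)" .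
qed

lemma has_weak_derivative_I01_iff:
  fixes u v :: "real \<Rightarrow> 'a::euclidean_space"
  shows "has_weak_derivative I01 u v \<longleftrightarrow> locally_integrable I01 u \<and> locally_integrable I01 v \<and>
    (\<forall>\<phi> \<phi>'. test_function I01 \<phi> \<phi>' \<longrightarrow>
       integral {0..1} (\<lambda>x. \<phi>' x *\<^sub>R u x) = - integral {0..1} (\<lambda>x. \<phi> x *\<^sub>R v x))"
proof -
  have "(LINT x|lebesgue_on I01. \<phi>' x *\<^sub>R u x) = integral {0..1} (\<lambda>x. \<phi>' x *\<^sub>R u x) \<and>
    (LINT x|lebesgue_on I01. \<phi> x *\<^sub>R v x) = integral {0..1} (\<lambda>x. \<phi> x *\<^sub>R v x)"
    if "test_function I01 \<phi> \<phi>'" "locally_integrable I01 u" "locally_integrable I01 v" for \<phi> \<phi>'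
    using that(1) by (rule test_function_support) (use that in \<open>auto intro!: test_integral\<close>)
  note * = this
  show ?thesis unfolding has_weak_derivative_def using * by (smt (verit, best))
qed

lemma locally_integrable_cong_AE:
  fixes u u' :: "real \<Rightarrow> 'a::euclidean_space"
  assumes "locally_integrable S u" "S \<in> sets lebesgue" "AE x in lebesgue_on S. u x = u' x"
  shows "locally_integrable S u'"
  unfolding locally_integrable_def
proof (intro allI impI)
  fix K assume K: "compact K \<and> K \<subseteq> S"
  then have Ks: "K \<in> sets lebesgue" by (simp add: compact_imp_closed)
  have "negligible {x\<in>S. u x \<noteq> u' x}" using assms by (simp add: AE_lebesgue_on_iff_negligible)
  then have "negligible {x\<in>K. u x \<noteq> u' x}" by (rule negligible_subset) (use K in auto)
  then have "AE x in lebesgue_on K. u x = u' x" using Ks by (simp add: AE_lebesgue_on_iff_negligible)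
  then show "integrable (lebesgue_on K) u'"
    using assms(1) K integrable_lebesgue_on_cong_AE(1)[OF Ks] unfolding locally_integrable_def by blast
qed

lemma LINT_cong_AE:
  fixes f g :: "real \<Rightarrow> 'b::euclidean_space"
  assumes "S \<in> sets lebesgue" "AE x in lebesgue_on S. f x = g x"
  shows "(LINT x|lebesgue_on S. f x) = (LINT x|lebesgue_on S. g x)"
proof (cases "integrable (lebesgue_on S) f")
  case True then show ?thesis using integrable_lebesgue_on_cong_AE(2)[OF assms] by blast
next
  case False
  have "\<not> integrable (lebesgue_on S) g"
    using False integrable_lebesgue_on_cong_AE(1)[OF assms(1), of g f] assms(2) by (auto simp: eq_commute)
  with False show ?thesis by (simp add: not_integrable_integral_eq)
qed

lemma has_weak_derivative_cong_AE:
  fixes u u' v v' :: "real \<Rightarrow> 'a::euclidean_space"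
  assumes "has_weak_derivative S u v" "S \<in> sets lebesgue"
    and "AE x in lebesgue_on S. u x = u' x" "AE x in lebesgue_on S. v x = v' x"
  shows "has_weak_derivative S u' v'"
proof -
  have "(LINT x|lebesgue_on S. \<phi> x *\<^sub>R u x) = (LINT x|lebesgue_on S. \<phi> x *\<^sub>R u' x)" 
    "(LINT x|lebesgue_on S. \<phi> x *\<^sub>R v x) = (LINT x|lebesgue_on S. \<phi> x *\<^sub>R v' x)" for \<phi> :: "real \<Rightarrow> real"
    using assms by (auto intro!: LINT_cong_AE[OF assms(2)] elim: AE_mp)
  then show ?thesis using assms locally_integrable_cong_AE unfolding has_weak_derivative_def by metis
qed

lemma has_weak_derivative_subset:
  fixes u v :: "real \<Rightarrow> 'a::euclidean_space"
  assumes "has_weak_derivative S u v" "T \<subseteq> S" "S \<in> sets lebesgue" "T \<in> sets lebesgue"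
  shows "has_weak_derivative T u v"
  unfolding has_weak_derivative_def
proof (intro conjI allI impI)
  show "locally_integrable T u" "locally_integrable T v"
    using assms unfolding has_weak_derivative_def locally_integrable_def by blast+
  fix \<phi> \<phi>' assume t: "test_function T \<phi> \<phi>'"
  then have tS: "test_function S \<phi> \<phi>'" using assms(2) unfolding test_function_def by blast
  obtain K where K: "compact K" "K \<subseteq> T" "\<And>x. x \<notin> K \<Longrightarrow> \<phi> x = 0" using t unfolding test_function_def by blast
  have D: "\<And>x. (\<phi> has_real_derivative \<phi>' x) (at x)" using t unfolding test_function_def by blast
  have K': "\<phi>' x = 0" if "x \<notin> K" for x
  proof -
    have "open (-K)" "x \<in> -K" using that K by (auto simp: compact_imp_closed open_Compl)
    moreover have "\<And>y. y \<in> - K \<Longrightarrow> 0 = \<phi> y" using K by auto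
    ultimately have "(\<phi> has_real_derivative 0) (at x)"
      using has_field_derivative_transform_within_open[OF DERIV_const[of 0]] by metis
    then show ?thesis using D[of x] DERIV_unique by blast
  qed
  have *: "(LINT x|lebesgue_on T. \<psi> x *\<^sub>R w x) = (LINT x|lebesgue_on S. \<psi> x *\<^sub>R w x)"
    if "\<And>x. x \<notin> K \<Longrightarrow> \<psi> x = 0" for \<psi> :: "real \<Rightarrow> real" and w :: "real \<Rightarrow> 'a"
  proof -
    have "indicator T x *\<^sub>R (\<psi> x *\<^sub>R w x) = indicator S x *\<^sub>R (\<psi> x *\<^sub>R w x)" for x
      using that[of x] K(2) assms(2) by (auto simp: indicator_def)
    then have "(LINT x|lebesgue. indicator T x *\<^sub>R (\<psi> x *\<^sub>R w x)) = (LINT x|lebesgue. indicator S x *\<^sub>R (\<psi> x *\<^sub>R w x))"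
      by (simp only:)
    then show ?thesis using assms(3,4) by (simp add: integral_restrict_space del: scaleR_scaleR)
  qed
  show "(LINT x|lebesgue_on T. \<phi>' x *\<^sub>R u x) = - (LINT x|lebesgue_on T. \<phi> x *\<^sub>R v x)"
    using assms(1) tS * K K' unfolding has_weak_derivative_def by simp
qed

lemma locally_integrable_I01_I:
  fixes v :: "real \<Rightarrow> 'a::euclidean_space"
  assumes "v absolutely_integrable_on {0..1}"
  shows "locally_integrable I01 v"
  unfolding locally_integrable_def
proof (intro allI impI)
  fix K assume K: "compact K \<and> K \<subseteq> I01"
  then have s: "K \<in> sets lebesgue" by (simp add: compact_imp_closed)
  have "K \<subseteq> {0..1}" using K by (auto simp: subset_iff less_imp_le)
  then have "v absolutely_integrable_on K" using assms s by (intro set_integrable_subset[OF assms]) auto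
  then show "integrable (lebesgue_on K) v" using s by (simp add: integrable_lebesgue_on_iff)
qed

text \<open>A test function is the indefinite integral of its derivative and vanishes at \<open>1\<close>, so that integration by parts
leaves no boundary term. The fixed vector \<open>e\<close> serves to obtain real functions (\<open>e = 1\<close> in the reals) and
complex eigenfunctions with a real profile at the same time.\<close>

lemma has_weak_derivative_indefinite_integral:
  fixes v :: "real \<Rightarrow> real" and e :: "'a::euclidean_space"
  assumes v: "v absolutely_integrable_on {0..1}"
  shows "has_weak_derivative I01 (\<lambda>x. (a + integral {0..x} v) *\<^sub>R e) (\<lambda>x. v x *\<^sub>R e)"
  unfolding has_weak_derivative_I01_iff
proof (intro conjI allI impI)
  let ?u = "\<lambda>x. a + integral {0..x} v"
  have cu: "continuous_on {0..1} ?u" using continuous_on_indefinite_integral[OF v] by (intro continuous_intros)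
  have au: "?u absolutely_integrable_on {0..1}" by (rule absolutely_integrable_continuous_real[OF cu])
  show "locally_integrable I01 (\<lambda>x. ?u x *\<^sub>R e)"
    by (intro locally_integrable_I01_I set_integrable_scaleR_left impI au)
  show "locally_integrable I01 (\<lambda>x. v x *\<^sub>R e)"
    by (intro locally_integrable_I01_I set_integrable_scaleR_left impI v)
  fix \<phi> \<phi>' assume "test_function I01 \<phi> \<phi>'"
  then obtain c d where cd: "0 < c" "c < d" "d < 1" "\<And>x. x \<notin> {c..d} \<Longrightarrow> \<phi> x = 0 \<and> \<phi>' x = 0"
    "continuous_on UNIV \<phi>" "continuous_on UNIV \<phi>'" "\<And>x. (\<phi> has_real_derivative \<phi>' x) (at x)"
    by (rule test_function_support) blast
  have i\<phi>: "(\<phi>' has_integral (\<phi> x - \<phi> 0)) {0..x}" if "0 \<le> x" for x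
    using that cd(7) by (intro fundamental_theorem_of_calculus)
      (auto simp flip: has_real_derivative_iff_has_vector_derivative intro: has_field_derivative_at_within)
  have "\<phi> 0 = 0" "\<phi> 1 = 0" using cd(1-4) by auto
  with i\<phi> have i: "integral {0..x} \<phi>' = \<phi> x" if "0 \<le> x" for x using that by (metis diff_zero integral_unique)
  have c01: "continuous_on {0..1} \<phi>" "continuous_on {0..1} \<phi>'" using cd continuous_on_subset by blast+
  have a': "\<phi>' absolutely_integrable_on {0..1}" by (rule absolutely_integrable_continuous_real[OF c01(2)])
  have "integral {0..1} (\<lambda>x. integral {0..x} v * \<phi>' x) + integral {0..1} (\<lambda>x. v x * integral {0..x} \<phi>') = 0"
    using integral_by_parts_indefinite[OF v a'] i[of 1] \<open>\<phi> 1 = 0\<close> by simp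
  moreover have "integral {0..1} (\<lambda>x. v x * integral {0..x} \<phi>') = integral {0..1} (\<lambda>x. \<phi> x * v x)"
    using i by (intro integral_cong) (auto simp: mult.commute)
  moreover have "integral {0..1} (\<lambda>x. \<phi>' x * ?u x) = integral {0..1} (\<lambda>x. a * \<phi>' x + integral {0..x} v * \<phi>' x)"
    by (intro integral_cong) (auto simp: algebra_simps)
  moreover have "\<dots> = integral {0..1} (\<lambda>x. a * \<phi>' x) + integral {0..1} (\<lambda>x. integral {0..x} v * \<phi>' x)"
    using absolutely_integrable_mult_continuous[OF a' continuous_on_indefinite_integral[OF v]] a'
    by (intro Henstock_Kurzweil_Integration.integral_add)
       (auto simp: absolutely_integrable_on_def intro: integrable_on_mult_right)
  moreover have "integral {0..1} (\<lambda>x. a * \<phi>' x) = 0" using i[of 1] \<open>\<phi> 1 = 0\<close> by simp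
  ultimately have eq: "integral {0..1} (\<lambda>x. \<phi>' x * ?u x) = - integral {0..1} (\<lambda>x. \<phi> x * v x)" by linarith
  have 1: "integral {0..1} (\<lambda>x. g x *\<^sub>R (h x *\<^sub>R e)) = integral {0..1} (\<lambda>x. g x * h x) *\<^sub>R e"
    if "(\<lambda>x. g x * h x) absolutely_integrable_on {0..1}" for g h :: "real \<Rightarrow> real"
  proof -
    have "((\<lambda>x. g x * h x) has_integral integral {0..1} (\<lambda>x. g x * h x)) {0..1}"
      using that by (auto simp: absolutely_integrable_on_def intro: integrable_integral)
    from has_integral_scaleR_left[OF this, of e] show ?thesis by (simp add: integral_unique)
  qed
  show "integral {0..1} (\<lambda>x. \<phi>' x *\<^sub>R ?u x *\<^sub>R e) = - integral {0..1} (\<lambda>x. \<phi> x *\<^sub>R v x *\<^sub>R e)"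
    using eq absolutely_integrable_mult_continuous[OF au c01(2)] absolutely_integrable_mult_continuous[OF v c01(1)]
    by (simp add: 1 del: scaleR_scaleR)
qed

text \<open>The square of the positive part is continuously differentiable, so a product of two of them is the simplest
nonnegative test function that is positive exactly on \<open>(c,d)\<close>.\<close>

lemma test_function_max_square:
  assumes "0 < c" "c < d" "d < 1"
  defines "\<theta> \<equiv> \<lambda>x. (max 0 (x - c))\<^sup>2 * (max 0 (d - x))\<^sup>2"
    and "\<theta>' \<equiv> \<lambda>x. 2 * max 0 (x - c) * (max 0 (d - x))\<^sup>2 - (max 0 (x - c))\<^sup>2 * (2 * max 0 (d - x))"
  shows "(\<theta> has_real_derivative \<theta>' x) (at x)" "continuous_on UNIV \<theta>'"
    "\<theta> x \<ge> 0" "x \<notin> {c<..<d} \<Longrightarrow> \<theta> x = 0" "x \<in> {c<..<d} \<Longrightarrow> \<theta> x > 0"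
proof -
  have sq: "((\<lambda>t. (max 0 t)\<^sup>2) has_real_derivative 2 * max 0 t) (at t)" for t :: real
  proof -
    consider "t < 0" | "t > 0" | "t = 0" by linarith
    then show ?thesis
    proof cases
      case 1
      have "((\<lambda>t::real. 0::real) has_real_derivative 0) (at t)" by simp
      then have "((\<lambda>t. (max 0 t)\<^sup>2) has_real_derivative 0) (at t)"
        by (rule has_field_derivative_transform_within_open[where S="{..<0}"]) (use 1 in auto)
      then show ?thesis using 1 by simp
    next
      case 2
      have "((\<lambda>t::real. t\<^sup>2) has_real_derivative 2 * t) (at t)" by (auto intro!: derivative_eq_intros)
      then have "((\<lambda>t. (max 0 t)\<^sup>2) has_real_derivative 2 * t) (at t)"
        by (rule has_field_derivative_transform_within_open[where S="{0<..}"]) (use 2 in auto)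
      then show ?thesis using 2 by simp
    next
      case 3
      have "((\<lambda>h::real. (max 0 h)\<^sup>2 / h) \<longlongrightarrow> 0) (at 0)"
      proof (rule tendsto_0_le[where K=1 and f="\<lambda>h. h"])
        show "\<forall>\<^sub>F h in at 0. norm ((max 0 (h::real))\<^sup>2 / h) \<le> norm h * 1"
          by (rule eventually_at_filter[THEN iffD2], rule always_eventually)
             (auto simp: max_def power2_eq_square abs_mult)
      qed (rule tendsto_ident_at)
      then show ?thesis using 3 by (simp add: has_field_derivative_iff)
    qed
  qed
  have "((\<lambda>x. (max 0 (x - c))\<^sup>2) has_real_derivative 2 * max 0 (x - c) * 1) (at x)"
    by (rule DERIV_chain2[where f="\<lambda>t. (max 0 t)\<^sup>2" and g="\<lambda>x. x - c", OF sq]) (auto intro!: derivative_eq_intros)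
  then have D1: "((\<lambda>x. (max 0 (x - c))\<^sup>2) has_real_derivative 2 * max 0 (x - c)) (at x)" by simp
  have "((\<lambda>x. (max 0 (d - x))\<^sup>2) has_real_derivative 2 * max 0 (d - x) * (-1)) (at x)"
    by (rule DERIV_chain2[where f="\<lambda>t. (max 0 t)\<^sup>2" and g="\<lambda>x. d - x", OF sq]) (auto intro!: derivative_eq_intros)
  then have D2: "((\<lambda>x. (max 0 (d - x))\<^sup>2) has_real_derivative - (2 * max 0 (d - x))) (at x)" by simp
  show "(\<theta> has_real_derivative \<theta>' x) (at x)"
    unfolding \<theta>_def \<theta>'_def by (rule DERIV_cong[OF DERIV_mult[OF D1 D2]]) (simp add: algebra_simps)
  show "continuous_on UNIV \<theta>'" unfolding \<theta>'_def by (intro continuous_intros)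
  show "\<theta> x \<ge> 0" "x \<notin> {c<..<d} \<Longrightarrow> \<theta> x = 0" "x \<in> {c<..<d} \<Longrightarrow> \<theta> x > 0"
    by (auto simp: \<theta>_def)
qed

lemma exists_test_function_bump:
  assumes "0 < c" "c < d" "d < 1"
  obtains \<theta> \<theta>' :: "real \<Rightarrow> real" where "\<And>x. (\<theta> has_real_derivative \<theta>' x) (at x)" "continuous_on UNIV \<theta>'"
    "\<And>x. \<theta> x \<ge> 0" "\<And>x. x \<notin> {c<..<d} \<Longrightarrow> \<theta> x = 0" "\<And>x. x \<in> {c<..<d} \<Longrightarrow> \<theta> x > 0"
  by (rule that; (rule test_function_max_square[OF assms]; assumption?))

text \<open>If \<open>\<theta>\<close> is a bump on \<open>(c,d)\<close>, then the test functions \<open>n \<theta> / (1 + n \<theta>)\<close> increase to the indicator function of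
\<open>(c,d)\<close>; dominated convergence turns testing against them into integration over the interval.\<close>

lemma integral_zero_if_tests_zero:
  fixes r :: "real \<Rightarrow> real"
  assumes r: "locally_integrable I01 r"
    and t: "\<And>\<phi> \<phi>'. test_function I01 \<phi> \<phi>' \<Longrightarrow> integral {0..1} (\<lambda>x. \<phi> x * r x) = 0"
    and cd: "0 < c" "c < d" "d < 1"
  shows "integral {c..d} r = 0"
proof -
  obtain \<theta> \<theta>' :: "real \<Rightarrow> real" where th: "\<And>x. (\<theta> has_real_derivative \<theta>' x) (at x)" "continuous_on UNIV \<theta>'"
    "\<And>x. \<theta> x \<ge> 0" "\<And>x. x \<notin> {c<..<d} \<Longrightarrow> \<theta> x = 0" "\<And>x. x \<in> {c<..<d} \<Longrightarrow> \<theta> x > 0"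
    using exists_test_function_bump[OF cd] by blast
  have cth: "continuous_on UNIV \<theta>" using th(1) by (meson DERIV_isCont continuous_at_imp_continuous_on)
  \<comment> \<open>This is \<open>n \<theta> / (1 + n \<theta>)\<close>.\<close>
  define \<phi> where "\<phi> = (\<lambda>n x. 1 - 1 / (1 + real n * \<theta> x))"
  define \<phi>' where "\<phi>' = (\<lambda>n x. real n * \<theta>' x / (1 + real n * \<theta> x)\<^sup>2)"
  have pos: "1 + real n * \<theta> x > 0" for n x using th(3)[of x] by (simp add: add_pos_nonneg)
  have c\<phi>: "continuous_on UNIV (\<phi> n)" for n
    unfolding \<phi>_def using pos by (intro continuous_intros cth) (metis less_irrefl)
  have test: "test_function I01 (\<phi> n) (\<phi>' n)" for n
    unfolding test_function_def
  proof (intro conjI allI exI[of _ "{c..d}"] impI)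
    show "(\<phi> n has_real_derivative \<phi>' n x) (at x)" for x
      unfolding \<phi>_def \<phi>'_def using pos[of n x]
      by (auto intro!: derivative_eq_intros th(1) simp: power2_eq_square)
    show "continuous_on UNIV (\<phi>' n)"
      unfolding \<phi>'_def using pos by (intro continuous_intros cth th(2)) (metis less_irrefl zero_eq_power2)
    show "\<And>x. x \<notin> {c..d} \<Longrightarrow> \<phi> n x = 0" using th(4) by (auto simp: \<phi>_def)
  qed (use cd in auto)
  have s0: "\<And>x. x \<notin> {c..d} \<Longrightarrow> \<phi> n x = 0" for n using th(4) by (auto simp: \<phi>_def)
  have z: "integral {c..d} (\<lambda>x. \<phi> n x * r x) = 0" for n
    using t[OF test[of n]] test_integral(3)[OF r c\<phi> cd s0] by simp
  have "{c..d} \<subseteq> I01" "compact {c..d}" using cd by auto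
  then have "integrable (lebesgue_on {c..d}) r" using r unfolding locally_integrable_def by blast
  then have ra: "r absolutely_integrable_on {c..d}" by (simp add: integrable_lebesgue_on_iff)
  have "(\<lambda>n. integral {c..d} (\<lambda>x. \<phi> n x * r x)) \<longlonglongrightarrow> integral {c..d} (\<lambda>x. if x \<in> {c<..<d} then r x else 0)"
  proof (rule dominated_convergence(2)[where h="\<lambda>x. \<bar>r x\<bar>"])
    show "(\<lambda>x. \<phi> n x * r x) integrable_on {c..d}" for n
      using absolutely_integrable_mult_continuous[OF ra continuous_on_subset[OF c\<phi>[of n]]]
      by (auto simp: absolutely_integrable_on_def)
    show "(\<lambda>x. \<bar>r x\<bar>) integrable_on {c..d}" using ra by (auto simp: absolutely_integrable_on_def)
    show "norm (\<phi> n x * r x) \<le> \<bar>r x\<bar>" for n x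
    proof -
      have "\<bar>\<phi> n x\<bar> \<le> 1" using th(3)[of x] pos[of n x] by (auto simp: \<phi>_def field_simps)
      then show ?thesis by (simp add: abs_mult mult_left_le_one_le)
    qed
    show "(\<lambda>n. \<phi> n x * r x) \<longlonglongrightarrow> (if x \<in> {c<..<d} then r x else 0)" for x
    proof (cases "x \<in> {c<..<d}")
      case True
      have "filterlim (\<lambda>n. real n * \<theta> x) at_top sequentially"
        using filterlim_at_top_mult_tendsto_pos[OF tendsto_const th(5)[OF True] filterlim_real_sequentially] by simp
      then have "filterlim (\<lambda>n. 1 + real n * \<theta> x) at_top sequentially"
        using filterlim_tendsto_add_at_top[OF tendsto_const] by blast
      then have "(\<lambda>n. 1 / (1 + real n * \<theta> x)) \<longlonglongrightarrow> 0"
        by (intro real_tendsto_divide_at_top[OF tendsto_const])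
      then have "(\<lambda>n. (1 - 1 / (1 + real n * \<theta> x)) * r x) \<longlonglongrightarrow> (1 - 0) * r x"
        by (intro tendsto_intros)
      then show ?thesis using True by (simp add: \<phi>_def)
    next
      case False
      then show ?thesis using th(4)[of x] by (auto simp: \<phi>_def)
    qed
  qed
  then have "integral {c..d} (\<lambda>x. if x \<in> {c<..<d} then r x else 0) = 0"
    unfolding z by (simp add: LIMSEQ_const_iff)
  moreover have "integral {c..d} r = integral {c..d} (\<lambda>x. if x \<in> {c<..<d} then r x else 0)"
    by (rule integral_spike[of "{c,d}"]) auto
  ultimately show ?thesis by simp
qed

text \<open>By Lebesgue differentiation, a function is almost everywhere the limit of its averages over small intervals.
That theorem needs an integrable function on the whole line, hence the cut-off to \<open>[\<eta>, 1-\<eta>]\<close> and the union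
over \<open>\<eta> = 1/(n+1)\<close>.\<close>

lemma AE_zero_if_integrals_zero:
  fixes r :: "real \<Rightarrow> real"
  assumes r: "locally_integrable I01 r"
    and z: "\<And>c d. 0 < c \<Longrightarrow> c < d \<Longrightarrow> d < 1 \<Longrightarrow> integral {c..d} r = 0"
  shows "AE x in lebesgue_on I01. r x = 0"
proof -
  have "\<exists>N. negligible N \<and> (\<forall>x\<in>{\<eta><..<1-\<eta>}. x \<notin> N \<longrightarrow> r x = 0)" if \<eta>: "0 < \<eta>" for \<eta> :: real
  proof -
    define f where "f = (\<lambda>x. if x \<in> {\<eta>..1-\<eta>} then r x else 0)"
    have "{\<eta>..1-\<eta>} \<subseteq> I01" "compact {\<eta>..1-\<eta>}" using \<eta> by auto
    then have "integrable (lebesgue_on {\<eta>..1-\<eta>}) r" using r unfolding locally_integrable_def by blast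
    then have ra: "r absolutely_integrable_on {\<eta>..1-\<eta>}" by (simp add: integrable_lebesgue_on_iff)
    have "f absolutely_integrable_on UNIV" unfolding f_def
      using ra by (simp only: absolutely_integrable_restrict_UNIV)
    then have "f absolutely_integrable_on cbox a b" for a b
      by (rule set_integrable_subset) auto
    then have "f integrable_on cbox a b" for a b by (auto simp: absolutely_integrable_on_def)
    then obtain N where N: "negligible N"
       "\<And>x e. \<lbrakk>x \<notin> N; 0 < e\<rbrakk> \<Longrightarrow> \<exists>d>0. \<forall>h. 0 < h \<and> h < d \<longrightarrow>
           norm(integral (cbox x (x + h *\<^sub>R One)) f /\<^sub>R h ^ DIM(real) - f x) < e"
      by (rule integrable_ccontinuous_explicit) (rule that)
    have "r x = 0" if x: "x \<in> {\<eta><..<1-\<eta>}" "x \<notin> N" for x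
    proof (rule ccontr)
      assume "r x \<noteq> 0"
      then obtain d where d: "d > 0" and *: "\<And>h. 0 < h \<and> h < d \<Longrightarrow>
           norm(integral (cbox x (x + h *\<^sub>R One)) f /\<^sub>R h ^ DIM(real) - f x) < \<bar>r x\<bar>"
        using N(2)[OF x(2), of "\<bar>r x\<bar>"] by auto
      define h where "h = min (d/2) (1 - \<eta> - x)"
      have h: "0 < h" "h < d" "x + h \<le> 1 - \<eta>" using d x by (auto simp: h_def)
      have "integral (cbox x (x + h *\<^sub>R One)) f = integral {x..x+h} f" by simp
      also have "\<dots> = integral {x..x+h} r"
        unfolding f_def using h x by (intro integral_cong) auto
      also have "\<dots> = 0" using h x \<eta> by (intro z) auto
      finally have "norm (f x) < \<bar>r x\<bar>" using *[of h] h by simp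
      then show False using x by (simp add: f_def)
    qed
    then show ?thesis using N(1) by blast
  qed
  then obtain N where N: "\<And>\<eta>. 0 < \<eta> \<Longrightarrow> negligible (N \<eta>)" "\<And>\<eta> x. 0 < \<eta> \<Longrightarrow> x \<in> {\<eta><..<1-\<eta>} \<Longrightarrow> x \<notin> N \<eta> \<Longrightarrow> r x = 0"
    by metis
  have "{x\<in>I01. r x \<noteq> 0} \<subseteq> (\<Union>n. N (inverse (real (Suc n))))"
  proof
    fix x assume x: "x \<in> {x\<in>I01. r x \<noteq> 0}"
    then have "0 < min x (1-x)" by auto
    then obtain n where "inverse (real (Suc n)) < min x (1-x)" using reals_Archimedean by blast
    then have "x \<in> {inverse (real (Suc n))<..<1 - inverse (real (Suc n))}" by auto
    then have "x \<in> N (inverse (real (Suc n)))" using N(2)[of "inverse (real (Suc n))" x] x by auto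
    then show "x \<in> (\<Union>n. N (inverse (real (Suc n))))" by blast
  qed
  moreover have "negligible (\<Union>n. N (inverse (real (Suc n))))"
    by (intro negligible_countable_Union) (auto intro: N(1))
  ultimately have "negligible {x\<in>I01. r x \<noteq> 0}" by (rule negligible_subset[rotated])
  then show ?thesis by (simp add: AE_lebesgue_on_iff_negligible)
qed

lemma AE_zero_if_tests_zero:
  fixes r :: "real \<Rightarrow> real"
  assumes "locally_integrable I01 r"
    and "\<And>\<phi> \<phi>'. test_function I01 \<phi> \<phi>' \<Longrightarrow> integral {0..1} (\<lambda>x. \<phi> x * r x) = 0"
  shows "AE x in lebesgue_on I01. r x = 0"
  using AE_zero_if_integrals_zero integral_zero_if_tests_zero assms by blast

lemma locally_integrable_diff:
  fixes u v :: "real \<Rightarrow> 'a::euclidean_space"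
  shows "locally_integrable S u \<Longrightarrow> locally_integrable S v \<Longrightarrow> locally_integrable S (\<lambda>x. u x - v x)"
  by (auto simp: locally_integrable_def)

lemma locally_integrable_add:
  fixes u v :: "real \<Rightarrow> 'a::euclidean_space"
  shows "locally_integrable S u \<Longrightarrow> locally_integrable S v \<Longrightarrow> locally_integrable S (\<lambda>x. u x + v x)"
  by (auto simp: locally_integrable_def)

lemma weak_derivative_unique:
  fixes u v v' :: "real \<Rightarrow> 'a::euclidean_space"
  assumes "has_weak_derivative I01 u v" "has_weak_derivative I01 u v'"
  shows "AE x in lebesgue_on I01. v x = v' x"
proof -
  have l: "locally_integrable I01 v" "locally_integrable I01 v'"
    using assms by (auto simp: has_weak_derivative_def)
  have "AE x in lebesgue_on I01. (v x - v' x) \<bullet> b = 0" if "b \<in> Basis" for b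
  proof (rule AE_zero_if_tests_zero)
    show "locally_integrable I01 (\<lambda>x. (v x - v' x) \<bullet> b)"
      using locally_integrable_diff[OF l] by (auto simp: locally_integrable_def)
    fix \<phi> \<phi>' assume t: "test_function I01 \<phi> \<phi>'"
    then obtain c d where cd: "0 < c" "c < d" "d < 1" "\<And>x. x \<notin> {c..d} \<Longrightarrow> \<phi> x = 0 \<and> \<phi>' x = 0"
      "continuous_on UNIV \<phi>" "continuous_on UNIV \<phi>'" "\<And>x. (\<phi> has_real_derivative \<phi>' x) (at x)"
      by (rule test_function_support) blast
    have z: "\<And>x. x \<notin> {c..d} \<Longrightarrow> \<phi> x = 0" using cd(4) by blast
    have i: "(\<lambda>x. \<phi> x *\<^sub>R v x) integrable_on {0..1}" "(\<lambda>x. \<phi> x *\<^sub>R v' x) integrable_on {0..1}"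
      using test_integral(1)[OF l(1) cd(5,1-3) z] test_integral(1)[OF l(2) cd(5,1-3) z]
      by (auto simp: absolutely_integrable_on_def)
    have "integral {0..1} (\<lambda>x. \<phi> x *\<^sub>R v x) = integral {0..1} (\<lambda>x. \<phi> x *\<^sub>R v' x)"
    proof -
      have "integral {0..1} (\<lambda>x. \<phi>' x *\<^sub>R u x) = - integral {0..1} (\<lambda>x. \<phi> x *\<^sub>R v x)"
        using assms(1) t unfolding has_weak_derivative_I01_iff by blast
      moreover have "integral {0..1} (\<lambda>x. \<phi>' x *\<^sub>R u x) = - integral {0..1} (\<lambda>x. \<phi> x *\<^sub>R v' x)"
        using assms(2) t unfolding has_weak_derivative_I01_iff by blast
      ultimately show ?thesis by simp
    qed
    then have "((\<lambda>x. \<phi> x *\<^sub>R v x - \<phi> x *\<^sub>R v' x) has_integral 0) {0..1}"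
      using has_integral_diff[OF integrable_integral[OF i(1)] integrable_integral[OF i(2)]] by simp
    from has_integral_linear[OF this bounded_linear_inner_left[of b]]
    have "((\<lambda>x. \<phi> x * ((v x - v' x) \<bullet> b)) has_integral 0) {0..1}"
      by (simp add: o_def inner_diff_left algebra_simps)
    then show "integral {0..1} (\<lambda>x. \<phi> x * ((v x - v' x) \<bullet> b)) = 0" by (rule integral_unique)
  qed
  then have "AE x in lebesgue_on I01. \<forall>b\<in>Basis. (v x - v' x) \<bullet> b = 0"
    by (simp add: AE_finite_all)
  moreover have "v x = v' x" if "\<forall>b\<in>Basis. (v x - v' x) \<bullet> b = 0" for x
    using that by (simp add: euclidean_eq_iff[of "v x"] inner_diff_left)
  ultimately show ?thesis by (rule eventually_mono)
qed

lemma wderiv_AE_eq: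
  fixes u v :: "real \<Rightarrow> 'a::euclidean_space"
  assumes "has_weak_derivative I01 u v"
  shows "AE x in lebesgue_on I01. wderiv I01 u x = v x" "has_weak_derivative I01 u (wderiv I01 u)"
proof -
  show 1: "has_weak_derivative I01 u (wderiv I01 u)"
    unfolding wderiv_def by (rule someI[where P="has_weak_derivative I01 u", OF assms])
  show "AE x in lebesgue_on I01. wderiv I01 u x = v x"
    by (rule weak_derivative_unique[OF 1 assms])
qed

text \<open>The integral starts at \<open>-1\<close>, to the left of the support, so that one formula gives a function that is
differentiable on the whole line.\<close>

lemma test_function_antiderivative:
  assumes "continuous_on UNIV \<psi>" "0 < c" "c < d" "d < 1" "\<And>x. x \<notin> {c..d} \<Longrightarrow> \<psi> x = 0"
    and "integral {0..1} \<psi> = 0"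
  shows "test_function I01 (\<lambda>x. integral {-1..x} \<psi>) \<psi>"
  unfolding test_function_def
proof (intro conjI allI exI[of _ "{c..d}"] impI)
  have co: "continuous_on S \<psi>" for S using assms(1) continuous_on_subset by blast
  show "((\<lambda>x. integral {-1..x} \<psi>) has_real_derivative \<psi> x) (at x)" for x
  proof (cases "x > -1")
    case True
    have "((\<lambda>x. integral {-1..x} \<psi>) has_real_derivative \<psi> x) (at x within {-1..x+1})"
      using True by (intro integral_has_real_derivative co) auto
    then show ?thesis using True by (subst (asm) at_within_Icc_at) auto
  next
    case False
    have "((\<lambda>x::real. 0::real) has_real_derivative 0) (at x)" by simp
    then have "((\<lambda>x. integral {-1..x} \<psi>) has_real_derivative 0) (at x)"
    proof (rule has_field_derivative_transform_within_open[where S="{..<0}"])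
      fix y :: real assume "y \<in> {..<0}"
      then have "integral {-1..y} \<psi> = integral {-1..y} (\<lambda>x. 0)"
        using assms by (intro integral_cong) auto
      then show "0 = integral {-1..y} \<psi>" by simp
    qed (use False in auto)
    moreover have "\<psi> x = 0" using False assms by auto
    ultimately show ?thesis by simp
  qed
  show "integral {-1..x} \<psi> = 0" if "x \<notin> {c..d}" for x
  proof (cases "x < c")
    case True
    then have "integral {-1..x} \<psi> = integral {-1..x} (\<lambda>x. 0)"
      using assms by (intro integral_cong) auto
    then show ?thesis by simp
  next
    case False
    then have x: "x > d" using that by auto
    have int: "\<psi> integrable_on {a..b}" for a b by (rule integrable_continuous_real[OF co])
    have "integral {-1..max x 1} \<psi> = integral {-1..0} \<psi> + integral {0..max x 1} \<psi>"
      by (rule Henstock_Kurzweil_Integration.integral_combine[symmetric]) (auto simp: int)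
    moreover have "integral {0..max x 1} \<psi> = integral {0..1} \<psi> + integral {1..max x 1} \<psi>"
      by (rule Henstock_Kurzweil_Integration.integral_combine[symmetric]) (auto simp: int)
    moreover have "integral {-1..max x 1} \<psi> = integral {-1..x} \<psi> + integral {x..max x 1} \<psi>"
      using x assms by (intro Henstock_Kurzweil_Integration.integral_combine[symmetric]) (auto simp: int)
    moreover have z: "integral {a..b} \<psi> = 0" if "\<And>y. y \<in> {a..b} \<Longrightarrow> y \<notin> {c..d}" for a b
    proof -
      have "integral {a..b} \<psi> = integral {a..b} (\<lambda>x. 0)"
        by (rule integral_cong) (use that assms(5) in auto)
      then show ?thesis by simp
    qed
    moreover have "integral {-1..0} \<psi> = 0" "integral {1..max x 1} \<psi> = 0" "integral {x..max x 1} \<psi> = 0"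
      by (rule z; use assms(2-4) x in auto)+
    ultimately show ?thesis using assms(6) by simp
  qed
qed (use assms in auto)

text \<open>The lemma of du Bois-Reymond. Fix a bump \<open>\<theta>\<close> with integral \<open>m\<close>. For a test function \<open>\<phi>\<close>, the function
\<open>\<phi> - (\<integral> \<phi> / m) \<theta>\<close> has mean zero and is thus the derivative of a test function; it integrates to zero
against \<open>r\<close>. This says that \<open>r - \<kappa>\<close> is orthogonal to every \<open>\<phi>\<close>, where \<open>\<kappa> = \<integral> \<theta> r / m\<close>.\<close>

lemma weak_derivative_zero_imp_const:
  fixes r :: "real \<Rightarrow> real"
  assumes w: "has_weak_derivative I01 r (\<lambda>x. 0)"
  shows "\<exists>\<kappa>. AE x in lebesgue_on I01. r x = \<kappa>"
proof -
  have lr: "locally_integrable I01 r" using w by (simp add: has_weak_derivative_def)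
  have bb: "0 < (1/4::real)" "1/4 < (1/2::real)" "1/2 < (1::real)" by auto
  obtain \<theta> \<theta>' :: "real \<Rightarrow> real" where th: "\<And>x. (\<theta> has_real_derivative \<theta>' x) (at x)" "continuous_on UNIV \<theta>'"
    "\<And>x. \<theta> x \<ge> 0" "\<And>x. x \<notin> {1/4<..<1/2} \<Longrightarrow> \<theta> x = 0" "\<And>x. x \<in> {1/4<..<1/2} \<Longrightarrow> \<theta> x > 0"
    using exists_test_function_bump[OF bb] by blast
  have cth: "continuous_on S \<theta>" for S using th(1) by (meson DERIV_isCont continuous_at_imp_continuous_on)
  have ith: "\<theta> integrable_on {a..b}" for a b by (rule integrable_continuous_real[OF cth])
  define m where "m = integral {0..1} \<theta>"
  have "m \<noteq> 0"
  proof
    assume "m = 0"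
    then have "(\<theta> has_integral 0) (cbox 0 1)" using integrable_integral[OF ith[of 0 1]] by (simp add: m_def)
    then have "\<theta> (1/3) = 0" using th(3) cth by (intro has_integral_0_cbox_imp_0) auto
    then show False using th(5)[of "1/3"] by auto
  qed
  define \<kappa> where "\<kappa> = integral {0..1} (\<lambda>x. \<theta> x * r x) / m"
  have "AE x in lebesgue_on I01. r x - \<kappa> = 0"
  proof (rule AE_zero_if_tests_zero)
    have lk: "locally_integrable I01 (\<lambda>x. \<kappa>)" by (rule locally_integrable_I01_I) auto
    show "locally_integrable I01 (\<lambda>x. r x - \<kappa>)" by (rule locally_integrable_diff[OF lr lk])
    fix \<phi> \<phi>' assume t: "test_function I01 \<phi> \<phi>'"
    then obtain c d where cd: "0 < c" "c < d" "d < 1" "\<And>x. x \<notin> {c..d} \<Longrightarrow> \<phi> x = 0 \<and> \<phi>' x = 0"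
      "continuous_on UNIV \<phi>" "continuous_on UNIV \<phi>'" "\<And>x. (\<phi> has_real_derivative \<phi>' x) (at x)"
      by (rule test_function_support) blast
    have c\<phi>: "continuous_on S \<phi>" for S using cd(5) continuous_on_subset by blast
    have i\<phi>: "\<phi> integrable_on {a..b}" for a b by (rule integrable_continuous_real[OF c\<phi>])
    define M where "M = integral {0..1} \<phi> / m"
    define \<psi> where "\<psi> = (\<lambda>x. \<phi> x - M * \<theta> x)"
    define a b where "a = min c (1/4)" and "b = max d (1/2)"
    have ab: "0 < a" "a < b" "b < 1" using cd by (auto simp: a_def b_def)
    have z: "\<phi> x = 0" "\<theta> x = 0" if "x \<notin> {a..b}" for x
    proof -
      have "x \<notin> {c..d}" "x \<notin> {1/4<..<1/2}" using that by (auto simp: a_def b_def)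
      then show "\<phi> x = 0" "\<theta> x = 0" using cd(4) th(4) by auto
    qed
    then have z\<psi>: "\<And>x. x \<notin> {a..b} \<Longrightarrow> \<psi> x = 0" by (simp add: \<psi>_def)
    have c\<psi>: "continuous_on UNIV \<psi>" unfolding \<psi>_def by (intro continuous_intros cth c\<phi>)
    have "integral {0..1} \<psi> = integral {0..1} \<phi> - M * m"
      unfolding \<psi>_def m_def using i\<phi> ith
      by (subst Henstock_Kurzweil_Integration.integral_diff) (auto intro: integrable_on_mult_right)
    then have i0: "integral {0..1} \<psi> = 0" using \<open>m \<noteq> 0\<close> by (simp add: M_def)
    have z0: "integral {0..1} (\<lambda>x. \<psi> x * r x) = 0"
      using w test_function_antiderivative[OF c\<psi> ab z\<psi> i0] unfolding has_weak_derivative_I01_iff by fastforce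
    have i1: "(\<lambda>x. \<phi> x * r x) integrable_on {0..1}" "(\<lambda>x. \<theta> x * r x) integrable_on {0..1}"
      using test_integral(1)[OF lr c\<phi> ab z(1)] test_integral(1)[OF lr cth ab z(2)]
      by (auto simp: absolutely_integrable_on_def)
    have "integral {0..1} (\<lambda>x. \<psi> x * r x) = integral {0..1} (\<lambda>x. \<phi> x * r x - M * (\<theta> x * r x))"
      by (simp add: \<psi>_def algebra_simps)
    also have "\<dots> = integral {0..1} (\<lambda>x. \<phi> x * r x) - M * integral {0..1} (\<lambda>x. \<theta> x * r x)"
      using i1 by (subst Henstock_Kurzweil_Integration.integral_diff) (auto intro: integrable_on_mult_right)
    finally have 1: "integral {0..1} (\<lambda>x. \<phi> x * r x) = M * (\<kappa> * m)"
      using z0 \<open>m \<noteq> 0\<close> by (simp add: \<kappa>_def)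
    have "integral {0..1} (\<lambda>x. \<phi> x * (r x - \<kappa>)) = integral {0..1} (\<lambda>x. \<phi> x * r x - \<phi> x * \<kappa>)"
      by (simp add: algebra_simps)
    also have "\<dots> = integral {0..1} (\<lambda>x. \<phi> x * r x) - integral {0..1} \<phi> * \<kappa>"
      using i1 i\<phi> by (subst Henstock_Kurzweil_Integration.integral_diff) (auto intro: integrable_on_mult_left)
    also have "\<dots> = 0" using 1 \<open>m \<noteq> 0\<close> by (simp add: M_def)
    finally show "integral {0..1} (\<lambda>x. \<phi> x * (r x - \<kappa>)) = 0" .
  qed
  then show ?thesis by auto
qed

lemma has_weak_derivative_diff:
  fixes u v u' v' :: "real \<Rightarrow> real"
  assumes "has_weak_derivative I01 u v" "has_weak_derivative I01 u' v'"
  shows "has_weak_derivative I01 (\<lambda>x. u x - u' x) (\<lambda>x. v x - v' x)"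
  unfolding has_weak_derivative_I01_iff
proof (intro conjI allI impI)
  have l: "locally_integrable I01 v" "locally_integrable I01 v'" "locally_integrable I01 u" "locally_integrable I01 u'"
    using assms by (auto simp: has_weak_derivative_def)
  then show "locally_integrable I01 (\<lambda>x. u x - u' x)" "locally_integrable I01 (\<lambda>x. v x - v' x)"
    by (auto intro: locally_integrable_diff)
  fix \<phi> \<phi>' assume t: "test_function I01 \<phi> \<phi>'"
  then obtain c d where cd: "0 < c" "c < d" "d < 1" "\<And>x. x \<notin> {c..d} \<Longrightarrow> \<phi> x = 0 \<and> \<phi>' x = 0"
    "continuous_on UNIV \<phi>" "continuous_on UNIV \<phi>'" "\<And>x. (\<phi> has_real_derivative \<phi>' x) (at x)"
    by (rule test_function_support) blast
  have d: "integral {0..1} (\<lambda>x. \<psi> x * (w x - w' x)) = integral {0..1} (\<lambda>x. \<psi> x * w x) - integral {0..1} (\<lambda>x. \<psi> x * w' x)"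
    if "locally_integrable I01 w" "locally_integrable I01 w'" "continuous_on UNIV \<psi>" "\<And>x. x \<notin> {c..d} \<Longrightarrow> \<psi> x = 0"
    for w w' \<psi> :: "real \<Rightarrow> real"
    using test_integral(1)[OF that(1,3) cd(1-3) that(4)] test_integral(1)[OF that(2,3) cd(1-3) that(4)]
    by (subst Henstock_Kurzweil_Integration.integral_diff[symmetric]) (auto simp: absolutely_integrable_on_def algebra_simps)
  have e: "integral {0..1} (\<lambda>x. \<phi>' x * u x) = - integral {0..1} (\<lambda>x. \<phi> x * v x)"
     "integral {0..1} (\<lambda>x. \<phi>' x * u' x) = - integral {0..1} (\<lambda>x. \<phi> x * v' x)"
    using assms t by (auto simp: has_weak_derivative_I01_iff)
  show "integral {0..1} (\<lambda>x. \<phi>' x *\<^sub>R (u x - u' x)) = - integral {0..1} (\<lambda>x. \<phi> x *\<^sub>R (v x - v' x))"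
    using d[OF l(3,4) cd(6)] d[OF l(1,2) cd(5)] cd(4) e by simp
qed

lemma weak_derivative_imp_integral:
  fixes u v :: "real \<Rightarrow> real"
  assumes w: "has_weak_derivative I01 u v" and v: "v absolutely_integrable_on {0..1}"
  shows "\<exists>c. AE x in lebesgue_on I01. u x = c + integral {0..x} v"
proof -
  have "has_weak_derivative I01 (\<lambda>x. u x - (0 + integral {0..x} v) *\<^sub>R 1) (\<lambda>x. v x - v x *\<^sub>R 1)"
    by (rule has_weak_derivative_diff[OF w has_weak_derivative_indefinite_integral[OF v]])
  then obtain \<kappa> where "AE x in lebesgue_on I01. u x - integral {0..x} v = \<kappa>"
    using weak_derivative_zero_imp_const[of "\<lambda>x. u x - integral {0..x} v"] by auto
  then have "AE x in lebesgue_on I01. u x = \<kappa> + integral {0..x} v" by (rule AE_mp) (auto intro!: AE_I2)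
  then show ?thesis by blast
qed

lemma continuous_AE_eq_imp_eq:
  fixes u v :: "real \<Rightarrow> real"
  assumes "continuous_on {0..1} u" "continuous_on {0..1} v" "AE x in lebesgue_on I01. u x = v x" "x \<in> {0..1}"
  shows "u x = v x"
proof -
  have c: "continuous_on {0..1} (\<lambda>x. \<bar>u x - v x\<bar>)" using assms by (intro continuous_intros)
  have n: "negligible ({x\<in>I01. u x \<noteq> v x} \<union> {0,1})"
    using assms(3) by (auto simp: AE_lebesgue_on_iff_negligible)
  have "((\<lambda>x. \<bar>u x - v x\<bar>) has_integral 0) {0..1}"
    by (rule has_integral_spike[OF n _ has_integral_0]) auto
  then have "\<bar>u x - v x\<bar> = 0" using c assms(4)
    by (intro has_integral_0_cbox_imp_0[where a=0 and b=1 and f="\<lambda>x. \<bar>u x - v x\<bar>"]) auto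
  then show ?thesis by simp
qed

lemma locally_integrable_mult_continuous:
  fixes v g :: "real \<Rightarrow> real"
  assumes "locally_integrable I01 v" "continuous_on {0..1} g"
  shows "locally_integrable I01 (\<lambda>x. g x * v x)"
  unfolding locally_integrable_def
proof (intro allI impI)
  fix K assume K: "compact K \<and> K \<subseteq> I01"
  then have s: "K \<in> sets lebesgue" by (simp add: compact_imp_closed)
  have K01: "K \<subseteq> {0..1}" using K by (auto simp: subset_iff less_imp_le)
  have "integrable (lebesgue_on K) v" using assms K by (simp add: locally_integrable_def)
  then have vK: "v absolutely_integrable_on K" using s by (simp add: integrable_lebesgue_on_iff)
  have cK: "continuous_on K g" using assms K01 continuous_on_subset by blast
  then have "bounded (g ` K)" using K compact_continuous_image compact_imp_bounded by blast
  then obtain B where "\<forall>x\<in>K. \<bar>g x\<bar> \<le> B" by (auto simp: bounded_iff)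
  then have "(\<lambda>x. g x * v x) absolutely_integrable_on K"
    using vK s cK by (intro absolutely_integrable_mult_bounded[where B=B])
      (auto intro: continuous_imp_measurable_on_sets_lebesgue)
  then show "integrable (lebesgue_on K) (\<lambda>x. g x * v x)" using s by (simp add: integrable_lebesgue_on_iff)
qed

text \<open>The product rule, by moving the factor \<open>\<rho>\<close> to the test function: \<open>\<phi> \<rho>\<close> is again a test function, since \<open>\<phi>\<close>
vanishes near \<open>0\<close> and \<open>1\<close>, beyond which \<open>\<rho>\<close> is arbitrary.\<close>

lemma has_weak_derivative_mult_C1:
  fixes v z \<rho> \<rho>' :: "real \<Rightarrow> real"
  assumes w: "has_weak_derivative I01 v z"
    and \<rho>: "\<And>x. x \<in> {0..1} \<Longrightarrow> (\<rho> has_real_derivative \<rho>' x) (at x within {0..1})" "continuous_on {0..1} \<rho>'"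
  shows "has_weak_derivative I01 (\<lambda>x. \<rho> x * v x) (\<lambda>x. \<rho>' x * v x + \<rho> x * z x)"
  unfolding has_weak_derivative_I01_iff
proof (intro conjI allI impI)
  have c\<rho>: "continuous_on {0..1} \<rho>" using \<rho>(1) by (rule DERIV_continuous_on)
  have l: "locally_integrable I01 v" "locally_integrable I01 z" using w by (auto simp: has_weak_derivative_def)
  show "locally_integrable I01 (\<lambda>x. \<rho> x * v x)" by (rule locally_integrable_mult_continuous[OF l(1) c\<rho>])
  show "locally_integrable I01 (\<lambda>x. \<rho>' x * v x + \<rho> x * z x)"
    by (intro locally_integrable_add locally_integrable_mult_continuous l c\<rho> \<rho>)
  fix \<phi> \<phi>' assume t: "test_function I01 \<phi> \<phi>'"
  then obtain c d where cd: "0 < c" "c < d" "d < 1" "\<And>x. x \<notin> {c..d} \<Longrightarrow> \<phi> x = 0 \<and> \<phi>' x = 0"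
    "continuous_on UNIV \<phi>" "continuous_on UNIV \<phi>'" "\<And>x. (\<phi> has_real_derivative \<phi>' x) (at x)"
    by (rule test_function_support) blast
  have glue: "continuous_on UNIV (\<lambda>x. \<psi> x * g x)"
    if "continuous_on UNIV \<psi>" "continuous_on {0..1} g" "\<And>x. x \<notin> {c..d} \<Longrightarrow> \<psi> x = 0" for \<psi> g :: "real \<Rightarrow> real"
  proof -
    have "continuous_on {0<..<1} (\<lambda>x. \<psi> x * g x)"
      by (intro continuous_intros continuous_on_subset[OF that(1)] continuous_on_subset[OF that(2)]) auto
    moreover have "continuous_on (-{c..d}) (\<lambda>x. \<psi> x * g x) \<longleftrightarrow> continuous_on (-{c..d}) (\<lambda>x::real. 0::real)"
      using that(3) by (intro continuous_on_cong) auto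
    ultimately have "continuous_on ({0<..<1} \<union> -{c..d}) (\<lambda>x. \<psi> x * g x)"
      by (intro continuous_on_open_Un) (auto simp: open_Compl)
    moreover have "{0<..<1} \<union> -{c..d} = (UNIV :: real set)" using cd by auto
    ultimately show ?thesis by simp
  qed
  let ?\<chi> = "\<lambda>x. \<phi> x * \<rho> x" and ?\<chi>' = "\<lambda>x. \<phi>' x * \<rho> x + \<phi> x * \<rho>' x"
  have z: "\<And>x. x \<notin> {c..d} \<Longrightarrow> \<phi> x = 0" "\<And>x. x \<notin> {c..d} \<Longrightarrow> \<phi>' x = 0" using cd(4) by auto
  have cc: "continuous_on UNIV ?\<chi>" "continuous_on UNIV (\<lambda>x. \<phi>' x * \<rho> x)" "continuous_on UNIV (\<lambda>x. \<phi> x * \<rho>' x)"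
    using glue[OF cd(5) c\<rho> z(1)] glue[OF cd(6) c\<rho> z(2)] glue[OF cd(5) \<rho>(2) z(1)] by auto
  have "test_function I01 ?\<chi> ?\<chi>'"
    unfolding test_function_def
  proof (intro conjI allI exI[of _ "{c..d}"] impI)
    show "(?\<chi> has_real_derivative ?\<chi>' x) (at x)" for x
    proof (cases "x \<in> {c..d}")
      case True
      then have "(\<rho> has_real_derivative \<rho>' x) (at x)"
        using \<rho>(1)[of x] cd at_within_Icc_at[of 0 x 1] by auto
      from DERIV_mult[OF cd(7) this] show ?thesis by (simp add: algebra_simps)
    next
      case False
      have "((\<lambda>x::real. 0::real) has_real_derivative 0) (at x)" by simp
      then have "(?\<chi> has_real_derivative 0) (at x)"
        by (rule has_field_derivative_transform_within_open[where S="-{c..d}"])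
          (use False z in \<open>auto simp: open_Compl\<close>)
      then show ?thesis using z False by simp
    qed
    show "continuous_on UNIV ?\<chi>'" by (intro continuous_intros cc)
  qed (use cd z in auto)
  then have e: "integral {0..1} (\<lambda>x. ?\<chi>' x * v x) = - integral {0..1} (\<lambda>x. ?\<chi> x * z x)"
    using w unfolding has_weak_derivative_I01_iff by force
  have i: "(\<lambda>x. \<phi>' x * \<rho> x * v x) integrable_on {0..1}" "(\<lambda>x. \<phi> x * \<rho>' x * v x) integrable_on {0..1}"
    "(\<lambda>x. \<phi> x * \<rho> x * z x) integrable_on {0..1}"
    using test_integral(1)[OF l(1) cc(2) cd(1-3)] test_integral(1)[OF l(1) cc(3) cd(1-3)]
      test_integral(1)[OF l(2) cc(1) cd(1-3)] z by (auto simp: absolutely_integrable_on_def)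
  have "integral {0..1} (\<lambda>x. ?\<chi>' x * v x) = integral {0..1} (\<lambda>x. \<phi>' x * \<rho> x * v x) + integral {0..1} (\<lambda>x. \<phi> x * \<rho>' x * v x)"
    by (subst Henstock_Kurzweil_Integration.integral_add[OF i(1,2), symmetric]) (simp add: algebra_simps)
  moreover have "integral {0..1} (\<lambda>x. \<phi> x * (\<rho>' x * v x + \<rho> x * z x)) =
     integral {0..1} (\<lambda>x. \<phi> x * \<rho>' x * v x) + integral {0..1} (\<lambda>x. \<phi> x * \<rho> x * z x)"
    by (subst Henstock_Kurzweil_Integration.integral_add[OF i(2,3), symmetric]) (simp add: algebra_simps)
  moreover have "integral {0..1} (\<lambda>x. \<phi>' x * (\<rho> x * v x)) = integral {0..1} (\<lambda>x. \<phi>' x * \<rho> x * v x)"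
    by (simp add: mult.assoc)
  ultimately have "integral {0..1} (\<lambda>x. \<phi>' x * (\<rho> x * v x)) = - integral {0..1} (\<lambda>x. \<phi> x * (\<rho>' x * v x + \<rho> x * z x))"
    using e by linarith
  then show "integral {0..1} (\<lambda>x. \<phi>' x *\<^sub>R (\<rho> x * v x)) = - integral {0..1} (\<lambda>x. \<phi> x *\<^sub>R (\<rho>' x * v x + \<rho> x * z x))"
    by simp
qed

section \<open>Square integrable functions and Sobolev functions\<close>

lemma L2_imp_integrable:
  fixes v :: "real \<Rightarrow> 'a::euclidean_space"
  assumes "v \<in> L2 I01"
  shows "integrable (lebesgue_on I01) v"
proof (rule Bochner_Integration.integrable_bound)
  have "integrable (lebesgue_on I01) (\<lambda>x. 1::real)"
    using LINT_I01_eq(1)[OF absolutely_integrable_continuous_real[of 0 1 "\<lambda>x. 1::real"]] by simp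
  then show "integrable (lebesgue_on I01) (\<lambda>x. 1 + (norm (v x))\<^sup>2)"
    using assms by (auto simp: L2_def)
  have "norm (v x) \<le> 1 + (norm (v x))\<^sup>2" for x
  proof -
    have "0 \<le> (norm (v x) - 1)\<^sup>2" "0 \<le> norm (v x)" by auto
    then have "2 * norm (v x) \<le> (norm (v x))\<^sup>2 + 1" by (simp add: power2_diff)
    then show ?thesis using norm_ge_zero[of "v x"] by linarith
  qed
  then show "AE x in lebesgue_on I01. norm (v x) \<le> norm (1 + (norm (v x))\<^sup>2)"
    by (intro AE_I2) (simp add: order_trans[OF _ abs_ge_self])
qed (use assms in \<open>auto simp: L2_def\<close>)

lemma absolutely_integrable_Icc_iff_I01:
  fixes v :: "real \<Rightarrow> 'a::euclidean_space"
  shows "v absolutely_integrable_on {0..1} \<longleftrightarrow> integrable (lebesgue_on I01) v"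
proof -
  have "v absolutely_integrable_on {0..1} \<longleftrightarrow> v absolutely_integrable_on I01"
    by (rule absolutely_integrable_spike_set_eq; rule negligible_subset[of "{0,1}"]; auto)
  then show ?thesis by (simp add: integrable_lebesgue_on_iff)
qed

lemma L2_mult_integrable:
  fixes u v :: "real \<Rightarrow> real"
  assumes "u \<in> L2 I01" "v \<in> L2 I01"
  shows "(\<lambda>x. u x * v x) absolutely_integrable_on {0..1}"
  unfolding absolutely_integrable_Icc_iff_I01
proof (rule Bochner_Integration.integrable_bound)
  show "integrable (lebesgue_on I01) (\<lambda>x. (norm (u x))\<^sup>2 + (norm (v x))\<^sup>2)"
    using assms by (auto simp: L2_def)
  have "\<bar>a * b\<bar> \<le> a\<^sup>2 + b\<^sup>2" for a b :: real
  proof -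
    have "0 \<le> (\<bar>a\<bar> - \<bar>b\<bar>)\<^sup>2" "0 \<le> a\<^sup>2 + b\<^sup>2" by auto
    then have "2 * (\<bar>a\<bar> * \<bar>b\<bar>) \<le> a\<^sup>2 + b\<^sup>2" by (simp add: power2_diff)
    moreover have "0 \<le> \<bar>a\<bar> * \<bar>b\<bar>" by simp
    ultimately show ?thesis unfolding abs_mult by linarith
  qed
  then show "AE x in lebesgue_on I01. norm (u x * v x) \<le> norm ((norm (u x))\<^sup>2 + (norm (v x))\<^sup>2)"
    by (intro AE_I2) simp
qed (use assms in \<open>auto simp: L2_def\<close>)

lemma L2_bounded_scaleR:
  fixes g :: "real \<Rightarrow> real" and e :: "'a::euclidean_space"
  assumes g: "g \<in> borel_measurable (lebesgue_on {0..1})" "\<And>x. x \<in> {0..1} \<Longrightarrow> \<bar>g x\<bar> \<le> B"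
    and S: "S \<subseteq> {0..1}" "S \<in> sets lebesgue"
  shows "(\<lambda>x. g x *\<^sub>R e) \<in> L2 S"
proof -
  have m: "g \<in> borel_measurable (lebesgue_on S)"
    by (rule measurable_restrict_mono[OF g(1) S(1)])
  have c: "(\<lambda>x. (norm e)\<^sup>2) absolutely_integrable_on {0..1::real}"
    by (intro absolutely_integrable_continuous_real continuous_intros)
  have "(\<lambda>x. (norm e)\<^sup>2) absolutely_integrable_on S" by (rule set_integrable_subset[OF c S(2,1)])
  moreover have "\<bar>(g x)\<^sup>2\<bar> \<le> B\<^sup>2" if "x \<in> S" for x
    using power_mono[of "\<bar>g x\<bar>" B 2] g(2)[of x] S that by auto
  moreover have "(\<lambda>x. (g x)\<^sup>2) \<in> borel_measurable (lebesgue_on S)" using m by simp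
  ultimately have "(\<lambda>x. (g x)\<^sup>2 * (norm e)\<^sup>2) absolutely_integrable_on S"
    using S by (intro absolutely_integrable_mult_bounded[where B="B\<^sup>2"]) auto
  then have "integrable (lebesgue_on S) (\<lambda>x. (norm (g x *\<^sub>R e))\<^sup>2)"
    unfolding integrable_lebesgue_on_iff[OF S(2)] by (simp only: norm_scaleR power_mult_distrib real_norm_def power2_abs)
  then show ?thesis using m by (auto simp: L2_def)
qed

lemma L2_cong_AE:
  fixes u v :: "real \<Rightarrow> 'a::euclidean_space"
  assumes "v \<in> L2 I01" "AE x in lebesgue_on I01. v x = u x"
  shows "u \<in> L2 I01"
proof -
  have "integrable (lebesgue_on I01) u"
    by (rule integrable_lebesgue_on_cong_AE(1)[OF _ assms(2) L2_imp_integrable[OF assms(1)]]) auto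
  moreover have "integrable (lebesgue_on I01) (\<lambda>x. (norm (u x))\<^sup>2)"
  proof (rule integrable_lebesgue_on_cong_AE(1))
    show "AE x in lebesgue_on I01. (norm (v x))\<^sup>2 = (norm (u x))\<^sup>2" using assms(2) by (rule AE_mp) (auto intro!: AE_I2)
  qed (use assms in \<open>auto simp: L2_def\<close>)
  ultimately show ?thesis by (auto simp: L2_def)
qed

lemma H1_wderiv:
  fixes u :: "real \<Rightarrow> real"
  assumes "u \<in> H1"
  shows "wderiv I01 u \<in> L2 I01" "wderiv I01 u absolutely_integrable_on {0..1}"
    "has_weak_derivative I01 u (wderiv I01 u)"
    "\<And>x. x \<in> {0..1} \<Longrightarrow> u x = u 0 + integral {0..x} (wderiv I01 u)"
proof -
  obtain v where v: "v \<in> L2 I01" "has_weak_derivative I01 u v" using assms by (auto simp: H1_def)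
  note w = wderiv_AE_eq[OF v(2)]
  show "has_weak_derivative I01 u (wderiv I01 u)" by (rule w(2))
  show 1: "wderiv I01 u \<in> L2 I01"
    using w(1) by (intro L2_cong_AE[OF v(1)]) (auto simp: eq_commute)
  show 2: "wderiv I01 u absolutely_integrable_on {0..1}"
    unfolding absolutely_integrable_Icc_iff_I01 by (rule L2_imp_integrable[OF 1])
  obtain c where c: "AE x in lebesgue_on I01. u x = c + integral {0..x} (wderiv I01 u)"
    using weak_derivative_imp_integral[OF w(2) 2] by blast
  have eq: "u x = c + integral {0..x} (wderiv I01 u)" if "x \<in> {0..1}" for x
  proof (rule continuous_AE_eq_imp_eq[OF _ _ c that])
    show "continuous_on {0..1} u" using assms by (simp add: H1_def)
    show "continuous_on {0..1} (\<lambda>x. c + integral {0..x} (wderiv I01 u))"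
      by (intro continuous_intros continuous_on_indefinite_integral 2)
  qed
  from eq[of 0] have "u 0 = c" by simp
  then show "\<And>x. x \<in> {0..1} \<Longrightarrow> u x = u 0 + integral {0..x} (wderiv I01 u)" using eq by simp
qed

lemma H1_I:
  fixes v :: "real \<Rightarrow> real" and e :: "'a::euclidean_space"
  assumes v: "v absolutely_integrable_on {0..1}" "(\<lambda>x. v x *\<^sub>R e) \<in> L2 I01"
    and u: "u \<in> extensional {0..1}" "\<And>x. x \<in> {0..1} \<Longrightarrow> u x = (a + integral {0..x} v) *\<^sub>R e"
  shows "u \<in> H1" "AE x in lebesgue_on I01. wderiv I01 u x = v x *\<^sub>R e" "has_weak_derivative I01 u (\<lambda>x. v x *\<^sub>R e)"
proof -
  show w: "has_weak_derivative I01 u (\<lambda>x. v x *\<^sub>R e)"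
    by (rule has_weak_derivative_cong_AE[OF has_weak_derivative_indefinite_integral[OF v(1), of a e]])
      (use u(2) in \<open>auto intro!: AE_I2\<close>)
  then show "AE x in lebesgue_on I01. wderiv I01 u x = v x *\<^sub>R e" by (rule wderiv_AE_eq)
  have "continuous_on {0..1} (\<lambda>x. (a + integral {0..x} v) *\<^sub>R e)"
    by (intro continuous_intros continuous_on_indefinite_integral v)
  then have "continuous_on {0..1} u" by (subst continuous_on_cong[OF refl u(2)])
  then show "u \<in> H1" using u v w by (auto simp: H1_def)
qed

section \<open>The flux system\<close>

text \<open>The reciprocal of a diffusion coefficient; the value \<open>0\<close> stands for infinite diffusion. Measurability is the
right regularity, since the limit coefficient jumps at \<open>x\<^sub>1\<close> and \<open>x\<^sub>2\<close>.\<close>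

definition coefficient :: "real \<Rightarrow> (real \<Rightarrow> real) \<Rightarrow> bool" where
  "coefficient B q \<longleftrightarrow> q \<in> borel_measurable (lebesgue_on {0..1}) \<and> (\<forall>x\<in>{0..1}. 0 \<le> q x \<and> q x \<le> B)"

text \<open>The initial value problem \<open>u' = q w\<close>, \<open>w' = k(x, u)\<close>, \<open>u(0) = a\<close>, \<open>w(0) = 0\<close> in integrated form, which is
meaningful for discontinuous \<open>q\<close>. The function \<open>w\<close> is the flux \<open>u' / q\<close>.\<close>

definition flux_system ::
  "(real \<Rightarrow> real) \<Rightarrow> (real \<Rightarrow> real \<Rightarrow> real) \<Rightarrow> real \<Rightarrow> (real \<Rightarrow> real) \<Rightarrow> (real \<Rightarrow> real) \<Rightarrow> bool" where
  "flux_system q k a u w \<longleftrightarrow> continuous_on {0..1} u \<and> continuous_on {0..1} w \<and>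
     (\<forall>x\<in>{0..1}. u x = a + integral {0..x} (\<lambda>y. q y * w y) \<and> w x = integral {0..x} (\<lambda>y. k y (u y)))"

lemma coefficient_mult_integrable:
  assumes "coefficient B q" "continuous_on {0..1} w"
  shows "(\<lambda>y. q y * w y) absolutely_integrable_on {0..1}"
  using assms absolutely_integrable_continuous_real[OF assms(2)]
  by (intro absolutely_integrable_mult_bounded[where B=B]) (auto simp: coefficient_def)

lemma coefficient_mult_L2:
  fixes e :: "'a::euclidean_space"
  assumes q: "coefficient B q" and w: "continuous_on {0..1} w"
  shows "(\<lambda>x. (q x * w x) *\<^sub>R e) \<in> L2 I01"
proof -
  have "bounded (w ` {0..1})" using w compact_continuous_image compact_imp_bounded by blast
  then obtain M where M: "\<forall>x\<in>{0..1}. \<bar>w x\<bar> \<le> M" by (auto simp: bounded_iff)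
  show ?thesis
  proof (rule L2_bounded_scaleR[where B="B * M"])
    show "(\<lambda>x. q x * w x) \<in> borel_measurable (lebesgue_on {0..1})"
      using q continuous_imp_measurable_on_sets_lebesgue[OF w] by (auto simp: coefficient_def)
    show "\<bar>q x * w x\<bar> \<le> B * M" if "x \<in> {0..1}" for x
      using that q M unfolding abs_mult coefficient_def by (intro mult_mono) auto
  qed auto
qed

lemma continuous_L2:
  fixes e :: "'a::euclidean_space"
  assumes w: "continuous_on {0..1} w" and S: "S \<subseteq> {0..1}" "S \<in> sets lebesgue"
  shows "(\<lambda>x. w x *\<^sub>R e) \<in> L2 S"
proof -
  have "bounded (w ` {0..1})" using w compact_continuous_image compact_imp_bounded by blast
  then obtain M where M: "\<forall>x\<in>{0..1}. \<bar>w x\<bar> \<le> M" by (auto simp: bounded_iff)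
  show ?thesis
    by (rule L2_bounded_scaleR[where B=M, OF _ _ S]) (use M w in \<open>auto intro: continuous_imp_measurable_on_sets_lebesgue\<close>)
qed

lemma flux_system_H1:
  fixes e :: "'a::euclidean_space"
  assumes f: "flux_system q k a u w" and q: "coefficient B q"
  defines "U \<equiv> restrict (\<lambda>x. u x *\<^sub>R e) {0..1}"
  shows "U \<in> H1" "AE x in lebesgue_on I01. wderiv I01 U x = (q x * w x) *\<^sub>R e"
    "has_weak_derivative I01 U (\<lambda>x. (q x * w x) *\<^sub>R e)"
proof -
  have w: "continuous_on {0..1} w" using f by (simp add: flux_system_def)
  have u: "U x = (a + integral {0..x} (\<lambda>x. q x * w x)) *\<^sub>R e" if "x \<in> {0..1}" for x
    using f that by (simp add: U_def flux_system_def)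
  have ext: "U \<in> extensional {0..1}" unfolding U_def by (rule restrict_extensional)
  note * = H1_I[OF coefficient_mult_integrable[OF q w] coefficient_mult_L2[OF q w, of e] ext u]
  show "U \<in> H1" using * by blast
  show "AE x in lebesgue_on I01. wderiv I01 U x = (q x * w x) *\<^sub>R e" using *(2) by simp
  show "has_weak_derivative I01 U (\<lambda>x. (q x * w x) *\<^sub>R e)" using *(3) by simp
qed

lemma flux_system_increment:
  assumes f: "flux_system q k a u w" and q: "coefficient B q" and xy: "0 \<le> x" "x \<le> y" "y \<le> 1"
  shows "u y - u x = integral {x..y} (\<lambda>t. q t * w t)"
    and "continuous_on {0..1} (\<lambda>t. k t (u t)) \<Longrightarrow> w y - w x = integral {x..y} (\<lambda>t. k t (u t))"
proof -
  have w: "continuous_on {0..1} w" using f by (simp add: flux_system_def)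
  have i: "(\<lambda>t. q t * w t) integrable_on {0..y}"
    using absolutely_integrable_on_subinterval[OF coefficient_mult_integrable[OF q w], of 0 y] xy
    by (auto simp: absolutely_integrable_on_def)
  show "u y - u x = integral {x..y} (\<lambda>t. q t * w t)"
    using f xy Henstock_Kurzweil_Integration.integral_combine[OF xy(1,2) i] by (auto simp: flux_system_def)
  assume c: "continuous_on {0..1} (\<lambda>t. k t (u t))"
  have i: "(\<lambda>t. k t (u t)) integrable_on {0..y}"
    using xy by (intro integrable_continuous_real continuous_on_subset[OF c]) auto
  show "w y - w x = integral {x..y} (\<lambda>t. k t (u t))"
    using f xy Henstock_Kurzweil_Integration.integral_combine[OF xy(1,2) i] by (auto simp: flux_system_def)
qed

text \<open>The integrand \<open>q w\<close> may be discontinuous, so the fundamental theorem of calculus is applied to the indefinite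
integral of \<open>\<bar>w\<bar>\<close>, whose increments dominate those of \<open>u\<close> up to the factor \<open>B\<close>.\<close>

lemma flux_zero_imp_deriv_zero:
  fixes e :: "'a::euclidean_space"
  assumes f: "flux_system q k a u w" and q: "coefficient B q" and c: "c \<in> {0..1}" "w c = 0"
  shows "(restrict (\<lambda>x. u x *\<^sub>R e) {0..1} has_vector_derivative 0) (at c within {0..1})"
proof -
  have w: "continuous_on {0..1} w" using f by (simp add: flux_system_def)
  define W where "W = (\<lambda>x. integral {0..x} (\<lambda>t. \<bar>w t\<bar>))"
  have aw: "continuous_on {0..1} (\<lambda>t. \<bar>w t\<bar>)" using w by (intro continuous_intros)
  have iw: "(\<lambda>t. \<bar>w t\<bar>) integrable_on {x..y}" if "0 \<le> x" "y \<le> 1" for x y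
    using that by (intro integrable_continuous_real continuous_on_subset[OF aw]) auto
  have le: "\<bar>u y - u x\<bar> \<le> B * (W y - W x) \<and> W x \<le> W y" if xy: "0 \<le> x" "x \<le> y" "y \<le> 1" for x y
  proof -
    have Wd: "W y - W x = integral {x..y} (\<lambda>t. \<bar>w t\<bar>)"
      using Henstock_Kurzweil_Integration.integral_combine[OF xy(1,2) iw] xy by (simp add: W_def)
    have "(\<lambda>t. q t * w t) absolutely_integrable_on {x..y}"
      using xy by (intro absolutely_integrable_on_subinterval[OF coefficient_mult_integrable[OF q w]]) auto
    then have "norm (integral {x..y} (\<lambda>t. q t * w t)) \<le> integral {x..y} (\<lambda>t. B * \<bar>w t\<bar>)"
    proof (intro Henstock_Kurzweil_Integration.integral_norm_bound_integral)
      show "norm (q t * w t) \<le> B * \<bar>w t\<bar>" if "t \<in> {x..y}" for t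
        using q that xy by (auto simp: coefficient_def abs_mult intro!: mult_right_mono)
    qed (use iw[of x y] xy in \<open>auto simp: absolutely_integrable_on_def intro: integrable_on_mult_right\<close>)
    moreover have "0 \<le> integral {x..y} (\<lambda>t. \<bar>w t\<bar>)" using xy by (intro integral_nonneg iw) auto
    ultimately show ?thesis using flux_system_increment(1)[OF f q xy] Wd by simp
  qed
  have bound: "\<bar>u y - u c\<bar> \<le> \<bar>W y - W c\<bar> * B" if "y \<in> {0..1}" for y
  proof (cases "y \<le> c")
    case True
    then have "\<bar>u c - u y\<bar> \<le> B * (W c - W y)" "\<bar>W y - W c\<bar> = W c - W y" using le[of y c] that c by auto
    then show ?thesis by (simp add: abs_minus_commute mult.commute)
  next
    case False
    then have "\<bar>u y - u c\<bar> \<le> B * (W y - W c)" "\<bar>W y - W c\<bar> = W y - W c" using le[of c y] that c by auto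
    then show ?thesis by (simp add: mult.commute)
  qed
  have "(W has_real_derivative \<bar>w c\<bar>) (at c within {0..1})"
    unfolding W_def by (rule integral_has_real_derivative[OF aw c(1)])
  then have "((\<lambda>y. (W y - W c) / (y - c)) \<longlongrightarrow> 0) (at c within {0..1})"
    using c(2) by (simp add: has_field_derivative_iff)
  then have "((\<lambda>y. (u y - u c) / (y - c)) \<longlongrightarrow> 0) (at c within {0..1})"
  proof (rule tendsto_0_le[where K=B])
    show "\<forall>\<^sub>F y in at c within {0..1}. norm ((u y - u c) / (y - c)) \<le> norm ((W y - W c) / (y - c)) * B"
      unfolding eventually_at_filter
      by (rule always_eventually) (use bound in \<open>auto simp: abs_divide field_simps intro!: divide_right_mono\<close>)
  qed
  then have "(u has_vector_derivative 0) (at c within {0..1})"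
    by (simp add: has_field_derivative_iff flip: has_real_derivative_iff_has_vector_derivative)
  then have "((\<lambda>x. u x *\<^sub>R e) has_vector_derivative 0) (at c within {0..1})"
    using bounded_linear.has_vector_derivative[OF bounded_linear_scaleR_left[of e]] by fastforce
  then show ?thesis
    by (rule has_vector_derivative_transform_within[where d=1]) (use c in auto)
qed

lemma flux_zero_imp_neumann:
  fixes e :: "'a::euclidean_space"
  assumes "flux_system q k a u w" "coefficient B q" "w 1 = 0"
  shows "neumann (restrict (\<lambda>x. u x *\<^sub>R e) {0..1})"
proof -
  have "w 0 = 0" using assms(1) by (simp add: flux_system_def)
  then show ?thesis unfolding neumann_def using assms(3)
      flux_zero_imp_deriv_zero[OF assms(1,2), of 0 e] flux_zero_imp_deriv_zero[OF assms(1,2), of 1 e] by auto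
qed

lemma zero_derivative_imp_zero_integrand:
  assumes f: "\<And>x. x \<in> {0..1} \<Longrightarrow> u x = a + integral {0..x} g" and g: "continuous_on {0..1} g"
    and d: "(u has_vector_derivative 0) (at c within {0..1})" "c \<in> {0..1::real}"
  shows "g c = (0::real)"
proof -
  have "((\<lambda>x. a + integral {0..x} g) has_real_derivative g c) (at c within {0..1})"
    using integral_has_real_derivative[OF g d(2)] by (auto intro!: derivative_eq_intros)
  then have "(u has_real_derivative g c) (at c within {0..1})"
    by (rule has_field_derivative_transform_within[where d=1]) (use f d in auto)
  moreover have "(u has_real_derivative 0) (at c within {0..1})"
    using d by (simp add: has_real_derivative_iff_has_vector_derivative)
  moreover have "at c within {0..1} \<noteq> bot" using d(2) by (auto simp: trivial_limit_within islimpt_Icc)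
  ultimately show ?thesis by (metis has_field_derivative_unique)
qed

section \<open>Equilibria for positive \<open>\<epsilon>\<close>\<close>

lemma coefficient_inverse:
  assumes "continuous_on {0..1} p" "\<And>x. x \<in> {0..1} \<Longrightarrow> m \<le> p x" "0 < m"
  shows "coefficient (1/m) (\<lambda>x. 1 / p x)"
proof -
  have "p x \<noteq> 0" if "x \<in> {0..1}" for x using assms(2)[OF that] assms(3) by auto
  then have "continuous_on {0..1} (\<lambda>x. 1 / p x)" using assms(1) by (intro continuous_intros) auto
  moreover have "0 \<le> 1 / p x \<and> 1 / p x \<le> 1 / m" if "x \<in> {0..1}" for x
    using assms(2)[OF that] assms(3) by (auto intro!: divide_left_mono)
  ultimately show ?thesis unfolding coefficient_def by (auto intro: continuous_imp_measurable_on_sets_lebesgue)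
qed

text \<open>The choice operator in \<open>wderiv\<close> yields a weak derivative of \<open>p u\<^sub>x\<close> only if one exists; the product rule and
\<open>u \<in> H\<^sup>2\<close> provide it. The equation then says that this weak derivative is the continuous function
\<open>lam u - f(u)\<close>, so that \<open>p u\<^sub>x\<close> has a \<open>C\<^sup>1\<close> representative \<open>w\<close>, and the boundary conditions force
\<open>w(0) = w(1) = 0\<close>.\<close>

lemma A_eps_imp_flux_system:
  fixes u f :: "real \<Rightarrow> real"
  assumes A: "A_eps p lam u (\<lambda>x. f (u x))" and f: "continuous_on UNIV f"
    and p: "\<And>x. x \<in> {0..1} \<Longrightarrow> (p has_real_derivative p' x) (at x within {0..1})" "continuous_on {0..1} p'"
    and pos: "\<And>x. x \<in> {0..1} \<Longrightarrow> m \<le> p x" "0 < m"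
  shows "\<exists>w. flux_system (\<lambda>x. 1 / p x) (\<lambda>_ s. lam * s - f s) (u 0) u w \<and> w 1 = 0"
proof -
  let ?v = "wderiv I01 u" and ?z = "wderiv I01 (\<lambda>y. p y * wderiv I01 u y)"
  define k where "k = (\<lambda>x. lam * u x - f (u x))"
  have cp: "continuous_on {0..1} p" using p(1) by (rule DERIV_continuous_on)
  have u: "u \<in> H1" "u \<in> H2" "neumann u" and ae: "AE x in lebesgue_on I01. - ?z x + lam * u x = f (u x)"
    using A by (auto simp: A_eps_def dom_A_eps_def H2_def)
  have cu: "continuous_on {0..1} u" using u by (simp add: H1_def)
  have ck: "continuous_on {0..1} k" unfolding k_def
    by (intro continuous_intros cu continuous_on_compose2[OF f cu]) auto
  obtain w2 where w2: "has_weak_derivative I01 ?v w2" using u by (auto simp: H2_def)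
  have "has_weak_derivative I01 (\<lambda>y. p y * ?v y) ?z"
    by (rule wderiv_AE_eq(2)[OF has_weak_derivative_mult_C1[OF w2 p]])
  then have wk: "has_weak_derivative I01 (\<lambda>y. p y * ?v y) k"
    by (rule has_weak_derivative_cong_AE) (use ae in \<open>auto simp: k_def elim!: eventually_mono\<close>)
  obtain c where c: "AE x in lebesgue_on I01. p x * ?v x = c + integral {0..x} k"
    using weak_derivative_imp_integral[OF wk absolutely_integrable_continuous_real[OF ck]] by blast
  define w where "w = (\<lambda>x. c + integral {0..x} k)"
  have cw: "continuous_on {0..1} w" unfolding w_def
    by (intro continuous_intros continuous_on_indefinite_integral absolutely_integrable_continuous_real ck)
  have p0: "p x > 0" if "x \<in> {0..1}" for x using pos(1)[OF that] pos(2) by simp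
  have "AE x in lebesgue_on I01. ?v x = 1 / p x * w x"
    using c
  proof (rule AE_mp, intro AE_I2 impI)
    fix x assume "x \<in> space (lebesgue_on I01)" and e: "p x * ?v x = c + integral {0..x} k"
    then have "p x > 0" using p0[of x] by simp
    then show "?v x = 1 / p x * w x" using e by (simp add: w_def field_simps)
  qed
  then have n: "negligible ({x\<in>I01. ?v x \<noteq> 1 / p x * w x} \<union> {0,1})"
    by (auto simp: AE_lebesgue_on_iff_negligible)
  have eq: "u x = u 0 + integral {0..x} (\<lambda>y. 1 / p y * w y)" if "x \<in> {0..1}" for x
  proof -
    have "integral {0..x} ?v = integral {0..x} (\<lambda>y. 1 / p y * w y)"
      by (rule integral_spike[OF n]) (use that in auto)
    then show ?thesis using H1_wderiv(4)[OF u(1) that] by simp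
  qed
  have cg: "continuous_on {0..1} (\<lambda>y. 1 / p y * w y)"
    using p0 by (intro continuous_intros cp cw) (metis less_irrefl)
  have "1 / p 0 * w 0 = 0" "1 / p 1 * w 1 = 0"
    using u(3) zero_derivative_imp_zero_integrand[OF eq cg, of 0] zero_derivative_imp_zero_integrand[OF eq cg, of 1] by (simp_all add: neumann_def)
  then have w0: "w 0 = 0" "w 1 = 0" using p0[of 0] p0[of 1] by auto
  then have "c = 0" by (simp add: w_def)
  then have "flux_system (\<lambda>x. 1 / p x) (\<lambda>_ s. lam * s - f s) (u 0) u w"
    unfolding flux_system_def
  proof (intro conjI ballI cu cw)
    fix x :: real assume "x \<in> {0..1}"
    then show "u x = u 0 + integral {0..x} (\<lambda>y. 1 / p y * w y)" by (rule eq)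
    show "w x = integral {0..x} (\<lambda>y. lam * u y - f (u y))" using \<open>c = 0\<close> by (simp add: w_def k_def)
  qed
  then show ?thesis using w0 by blast
qed

text \<open>Since \<open>q = 1 / p\<close> is continuously differentiable, the product rule shows that the weak derivative \<open>q w\<close> of \<open>u\<close> is
weakly differentiable, that is, \<open>u \<in> H\<^sup>2\<close>; and \<open>p (q w) = w\<close> has the derivative prescribed by the equation.\<close>

lemma flux_system_imp_A_eps:
  fixes u f :: "real \<Rightarrow> real"
  assumes F: "flux_system (\<lambda>x. 1 / p x) (\<lambda>_ s. lam * s - f s) a u w" "w 1 = 0" and f: "continuous_on UNIV f"
    and p: "\<And>x. x \<in> {0..1} \<Longrightarrow> (p has_real_derivative p' x) (at x within {0..1})" "continuous_on {0..1} p'"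
    and pos: "\<And>x. x \<in> {0..1} \<Longrightarrow> m \<le> p x" "0 < m"
  shows "A_eps p lam (restrict u {0..1}) (\<lambda>x. f (restrict u {0..1} x))"
proof -
  have I01s: "I01 \<subseteq> {0..1}" by auto
  let ?U = "restrict u {0..1}" and ?q = "\<lambda>x. 1 / p x"
  have cp: "continuous_on {0..1} p" using p(1) by (rule DERIV_continuous_on)
  have q: "coefficient (1/m) ?q" by (rule coefficient_inverse[OF cp pos])
  have p0: "p x > 0" if "x \<in> {0..1}" for x using pos(1)[OF that] pos(2) by simp
  define k where "k = (\<lambda>x. lam * u x - f (u x))"
  have cu: "continuous_on {0..1} u" and cw: "continuous_on {0..1} w" using F by (auto simp: flux_system_def)
  have ck: "continuous_on {0..1} k" unfolding k_def
    by (intro continuous_intros cu continuous_on_compose2[OF f cu]) auto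
  have ak: "k absolutely_integrable_on {0..1}" by (rule absolutely_integrable_continuous_real[OF ck])
  have wk: "w x = integral {0..x} k" if "x \<in> {0..1}" for x using F that by (simp add: flux_system_def k_def)
  note U = flux_system_H1[OF F(1) q, of "1::real", simplified]
  have ww: "has_weak_derivative I01 w k"
    by (rule has_weak_derivative_cong_AE[OF has_weak_derivative_indefinite_integral[OF ak, of 0 "1::real"]])
      (auto intro!: AE_I2 simp: wk)
  have dq: "(?q has_real_derivative - (p' x / (p x)\<^sup>2)) (at x within {0..1})" if "x \<in> {0..1}" for x
    using p(1)[OF that] p0[OF that] by (auto intro!: derivative_eq_intros simp: power2_eq_square)
  have cq': "continuous_on {0..1} (\<lambda>x. - (p' x / (p x)\<^sup>2))"
    using p0 by (intro continuous_intros p cp) (metis less_irrefl zero_eq_power2)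
  define z where "z = (\<lambda>x. - (p' x / (p x)\<^sup>2) * w x + ?q x * k x)"
  have cq: "continuous_on {0..1} ?q" using p0 by (intro continuous_intros cp) (metis less_irrefl)
  have cz: "continuous_on {0..1} z" unfolding z_def by (intro continuous_intros cq' cw cq ck)
  have wz: "has_weak_derivative I01 (\<lambda>x. ?q x * w x) z"
    unfolding z_def by (rule has_weak_derivative_mult_C1[OF ww dq cq'])
  have "has_weak_derivative I01 (wderiv I01 ?U) z"
    by (rule has_weak_derivative_cong_AE[OF wz]) (use U(2) in \<open>auto elim!: eventually_mono\<close>)
  moreover have "z \<in> L2 I01" using continuous_L2[OF cz I01s, of "1::real"] by simp
  ultimately have H2: "?U \<in> H2" using U(1) by (auto simp: H2_def)
  have "AE x in lebesgue_on I01. w x = p x * wderiv I01 ?U x"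
    using U(2)
  proof (rule AE_mp, intro AE_I2 impI)
    fix x assume "x \<in> space (lebesgue_on I01)" and e: "wderiv I01 ?U x = w x / p x"
    then have "p x > 0" using p0[of x] by simp
    then show "w x = p x * wderiv I01 ?U x" using e by simp
  qed
  then have "has_weak_derivative I01 (\<lambda>y. p y * wderiv I01 ?U y) k"
    by (intro has_weak_derivative_cong_AE[OF ww]) auto
  then have "AE x in lebesgue_on I01. wderiv I01 (\<lambda>y. p y * wderiv I01 ?U y) x = k x"
    by (rule wderiv_AE_eq)
  then have ae: "AE x in lebesgue_on I01. - wderiv I01 (\<lambda>y. p y *\<^sub>R wderiv I01 ?U y) x + lam *\<^sub>R ?U x = f (?U x)"
    by (rule AE_mp) (auto intro!: AE_I2 simp: k_def)
  have cf: "continuous_on {0..1} (\<lambda>x. f (?U x))"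
    by (rule continuous_on_compose2[OF f]) (use U(1) in \<open>auto simp: H1_def\<close>)
  have "(\<lambda>x. f (?U x)) \<in> L2 I01" using continuous_L2[OF cf I01s, of "1::real"] by simp
  moreover have "neumann ?U" using flux_zero_imp_neumann[OF F(1) q F(2), of "1::real"] by simp
  ultimately show ?thesis using H2 ae by (simp add: A_eps_def dom_A_eps_def)
qed

section \<open>Equilibria of the limit operator\<close>

lemma integral_by_parts_H1:
  fixes k \<psi> \<phi> :: "real \<Rightarrow> real"
  assumes k: "k absolutely_integrable_on {0..1}" and \<psi>: "\<psi> absolutely_integrable_on {0..1}"
    and \<phi>: "\<And>x. x \<in> {0..1} \<Longrightarrow> \<phi> x = b + integral {0..x} \<psi>"
  shows "integral {0..1} (\<lambda>x. k x * \<phi> x) = \<phi> 1 * integral {0..1} k - integral {0..1} (\<lambda>x. integral {0..x} k * \<psi> x)"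
proof -
  have i: "(\<lambda>x. k x * integral {0..x} \<psi>) integrable_on {0..1}"
    using absolutely_integrable_mult_continuous[OF k continuous_on_indefinite_integral[OF \<psi>]]
    by (simp add: absolutely_integrable_on_def mult.commute)
  have ik: "(\<lambda>x. k x * b) integrable_on {0..1}"
    using k by (intro integrable_on_mult_left) (simp add: absolutely_integrable_on_def)
  have "integral {0..1} (\<lambda>x. k x * \<phi> x) = integral {0..1} (\<lambda>x. k x * b + k x * integral {0..x} \<psi>)"
    by (intro integral_cong) (simp add: \<phi> algebra_simps)
  also have "\<dots> = integral {0..1} (\<lambda>x. k x * b) + integral {0..1} (\<lambda>x. k x * integral {0..x} \<psi>)"
    by (rule Henstock_Kurzweil_Integration.integral_add[OF ik i])
  also have "integral {0..1} (\<lambda>x. k x * b) = b * integral {0..1} k" by simp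
  also have "integral {0..1} (\<lambda>x. k x * integral {0..x} \<psi>) =
      integral {0..1} k * integral {0..1} \<psi> - integral {0..1} (\<lambda>x. integral {0..x} k * \<psi> x)"
    using integral_by_parts_indefinite[OF k \<psi>] by simp
  finally show ?thesis using \<phi>[of 1] by (simp add: algebra_simps)
qed

lemma zero_extension_measurable:
  fixes g :: "real \<Rightarrow> real"
  assumes g: "continuous_on S g" and S: "compact S" "S \<subseteq> {0..1}"
  shows "(\<lambda>x. if x \<in> S then g x else 0) \<in> borel_measurable (lebesgue_on {0..1})"
proof -
  have s: "S \<in> sets lebesgue" using S(1) by (simp add: compact_imp_closed)
  have "g \<in> borel_measurable (lebesgue_on S)" by (rule continuous_imp_measurable_on_sets_lebesgue[OF g s])
  then have "(\<lambda>x. if x \<in> S then g x else 0) \<in> borel_measurable lebesgue"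
    using s by (rule borel_measurable_if_I)
  then show ?thesis by (rule measurable_restrict_space1)
qed

text \<open>The almost everywhere limit of \<open>1 / p\<^sub>\<epsilon>\<close>.\<close>

definition limit_coefficient :: "real \<Rightarrow> real \<Rightarrow> (real \<Rightarrow> real) \<Rightarrow> real \<Rightarrow> real" where
  "limit_coefficient x1 x2 p0 = (\<lambda>x. if x \<in> Om1 x1 x2 then 1 / p0 x else 0)"

lemma limit_coefficient:
  assumes "0 < x1" "x1 < x2" "x2 < 1" "continuous_on (Om1 x1 x2) p0"
    and "\<And>x. x \<in> Om1 x1 x2 \<Longrightarrow> m \<le> p0 x" "0 < m"
  shows "coefficient (1/m) (limit_coefficient x1 x2 p0)"
proof -
  have p: "p0 x > 0" if "x \<in> Om1 x1 x2" for x using assms(5)[OF that] assms(6) by simp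
  have "continuous_on (Om1 x1 x2) (\<lambda>x. 1 / p0 x)"
    using p by (intro continuous_intros assms(4)) (metis less_irrefl)
  then have "limit_coefficient x1 x2 p0 \<in> borel_measurable (lebesgue_on {0..1})"
    unfolding limit_coefficient_def using assms(1-3)
    by (intro zero_extension_measurable compact_Un compact_Icc) auto
  moreover have "0 \<le> limit_coefficient x1 x2 p0 x \<and> limit_coefficient x1 x2 p0 x \<le> 1 / m" for x
  proof (cases "x \<in> Om1 x1 x2")
    case True
    then have "1 / p0 x \<le> 1 / m" using p[OF True] assms(5)[OF True] assms(6) by (intro divide_left_mono) auto
    then show ?thesis using p[OF True] True unfolding limit_coefficient_def by (simp only: if_True) simp
  next
    case False
    then show ?thesis using assms(6) unfolding limit_coefficient_def by (simp only: if_False) simp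
  qed
  ultimately show ?thesis by (simp add: coefficient_def)
qed

text \<open>The bilinear form of \<open>A\<^sub>0\<close> is given by one integral over \<open>\<Omega>\<^sub>1\<close> and one over \<open>\<Omega>\<^sub>0\<close>. Extending \<open>p\<^sub>0\<close> by zero merges
them into integrals over \<open>[0,1]\<close>, to which integration by parts applies. The integrability of the product of two
derivatives is where \<open>L\<^sup>2\<close> (and not only \<open>L\<^sup>1\<close>) is used.\<close>

lemma A_0_form_split:
  fixes \<psi> V \<phi> U p0 :: "real \<Rightarrow> real"
  assumes x: "0 < x1" "x1 < x2" "x2 < 1" and p0: "continuous_on (Om1 x1 x2) p0"
    and L: "\<psi> \<in> L2 I01" "V \<in> L2 I01" and c: "continuous_on {0..1} \<phi>" "continuous_on {0..1} U"
  defines "P \<equiv> \<lambda>x. if x \<in> Om1 x1 x2 then p0 x else 0"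
  shows "(\<lambda>x. P x * (\<psi> x * V x)) absolutely_integrable_on {0..1}"
    and "integrable (lebesgue_on (Om1 x1 x2)) (\<lambda>x. p0 x * (\<psi> x * V x) + lam * \<phi> x * U x)"
    and "integrable (lebesgue_on (Om0 x1 x2)) (\<lambda>x. lam * \<phi> x * U x)"
    and "(LINT x|lebesgue_on (Om1 x1 x2). p0 x * (\<psi> x * V x) + lam * \<phi> x * U x)
        + (LINT x|lebesgue_on (Om0 x1 x2). lam * \<phi> x * U x)
      = integral {0..1} (\<lambda>x. P x * (\<psi> x * V x)) + integral {0..1} (\<lambda>x. lam * \<phi> x * U x)"
proof -
  let ?f1 = "\<lambda>x. P x * (\<psi> x * V x)" and ?f2 = "\<lambda>x. lam * \<phi> x * U x"
  have S1: "Om1 x1 x2 \<subseteq> {0..1}" "Om0 x1 x2 \<subseteq> {0..1}" using x by auto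
  have S2: "Om1 x1 x2 \<in> sets lebesgue" "Om0 x1 x2 \<in> sets lebesgue" by auto
  have K: "compact (Om1 x1 x2)" by (intro compact_Un compact_Icc)
  have "bounded (p0 ` Om1 x1 x2)" using compact_continuous_image[OF p0 K] compact_imp_bounded by blast
  then obtain B0 where B0: "\<forall>x\<in>Om1 x1 x2. \<bar>p0 x\<bar> \<le> B0" unfolding bounded_iff by (auto simp del: Un_iff atLeastAtMost_iff)
  show a1: "?f1 absolutely_integrable_on {0..1}"
  proof (rule absolutely_integrable_mult_bounded[OF L2_mult_integrable[OF L]])
    show "P \<in> borel_measurable (lebesgue_on {0..1})" unfolding P_def by (rule zero_extension_measurable[OF p0 K S1(1)])
    show "\<bar>P x\<bar> \<le> max B0 0" for x
      using B0 unfolding P_def by (cases "x \<in> Om1 x1 x2") (auto simp del: Un_iff atLeastAtMost_iff intro: max.coboundedI1)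
  qed auto
  have a2: "?f2 absolutely_integrable_on {0..1}"
    by (intro absolutely_integrable_continuous_real continuous_intros c)
  have a12: "(\<lambda>x. ?f1 x + ?f2 x) absolutely_integrable_on {0..1}"
    using a1 a2 by (rule set_integral_add(1))
  have P1: "P x = p0 x" if "x \<in> Om1 x1 x2" for x using that by (simp add: P_def)
  have P0: "P x = 0" if "x \<in> Om0 x1 x2" for x using that by (auto simp: P_def)
  have i1: "integrable (lebesgue_on (Om1 x1 x2)) (\<lambda>x. ?f1 x + ?f2 x)"
    using set_integrable_subset[OF a12 S2(1) S1(1)] S2 by (simp only: integrable_lebesgue_on_iff)
  have i0: "integrable (lebesgue_on (Om0 x1 x2)) (\<lambda>x. ?f1 x + ?f2 x)"
    using set_integrable_subset[OF a12 S2(2) S1(2)] S2 by (simp only: integrable_lebesgue_on_iff)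
  have e1: "p0 x * (\<psi> x * V x) + ?f2 x = ?f1 x + ?f2 x" if "x \<in> space (lebesgue_on (Om1 x1 x2))" for x
    using that P1[of x] by simp
  have e0: "?f2 x = ?f1 x + ?f2 x" if "x \<in> space (lebesgue_on (Om0 x1 x2))" for x
    using that P0[of x] by simp
  show "integrable (lebesgue_on (Om1 x1 x2)) (\<lambda>x. p0 x * (\<psi> x * V x) + lam * \<phi> x * U x)"
    by (rule iffD2[OF Bochner_Integration.integrable_cong[OF refl] i1]) (rule e1)
  show "integrable (lebesgue_on (Om0 x1 x2)) (\<lambda>x. lam * \<phi> x * U x)"
    by (rule iffD2[OF Bochner_Integration.integrable_cong[OF refl] i0]) (rule e0)
  have "(LINT x|lebesgue_on (Om1 x1 x2). p0 x * (\<psi> x * V x) + lam * \<phi> x * U x) = integral (Om1 x1 x2) (\<lambda>x. ?f1 x + ?f2 x)"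
    unfolding lebesgue_integral_eq_integral[OF i1 S2(1), symmetric]
    by (rule Bochner_Integration.integral_cong[OF refl]) (rule e1)
  moreover have "(LINT x|lebesgue_on (Om0 x1 x2). lam * \<phi> x * U x) = integral (Om0 x1 x2) (\<lambda>x. ?f1 x + ?f2 x)"
    unfolding lebesgue_integral_eq_integral[OF i0 S2(2), symmetric]
    by (rule Bochner_Integration.integral_cong[OF refl]) (rule e0)
  moreover have "integral (Om1 x1 x2 \<union> Om0 x1 x2) (\<lambda>x. ?f1 x + ?f2 x) =
      integral (Om1 x1 x2) (\<lambda>x. ?f1 x + ?f2 x) + integral (Om0 x1 x2) (\<lambda>x. ?f1 x + ?f2 x)"
  proof (rule Henstock_Kurzweil_Integration.integral_Un)
    show "(\<lambda>x. ?f1 x + ?f2 x) integrable_on Om1 x1 x2"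
      using set_integrable_subset[OF a12 S2(1) S1(1)] unfolding absolutely_integrable_on_def by blast
    show "(\<lambda>x. ?f1 x + ?f2 x) integrable_on Om0 x1 x2"
      using set_integrable_subset[OF a12 S2(2) S1(2)] unfolding absolutely_integrable_on_def by blast
    have "Om1 x1 x2 \<inter> Om0 x1 x2 = {}" by auto
    then show "negligible (Om1 x1 x2 \<inter> Om0 x1 x2)" by simp
  qed
  moreover have "Om1 x1 x2 \<union> Om0 x1 x2 = {0..1}" using x by auto
  moreover have "integral {0..1} (\<lambda>x. ?f1 x + ?f2 x) = integral {0..1} ?f1 + integral {0..1} ?f2"
    using a1 a2 by (intro Henstock_Kurzweil_Integration.integral_add) (auto simp only: absolutely_integrable_on_def)
  ultimately show "(LINT x|lebesgue_on (Om1 x1 x2). p0 x * (\<psi> x * V x) + lam * \<phi> x * U x)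
        + (LINT x|lebesgue_on (Om0 x1 x2). lam * \<phi> x * U x)
      = integral {0..1} ?f1 + integral {0..1} ?f2" by (simp only:)
qed

lemma H1_continuous: "u \<in> H1 \<Longrightarrow> continuous_on {0..1} u"
  by (simp add: H1_def)

lemma AE_I01_subset:
  assumes "AE x in lebesgue_on I01. Q x" "S \<subseteq> {0..1}" "S \<in> sets lebesgue"
  shows "AE x in lebesgue_on S. Q x"
proof -
  have "negligible ({x\<in>I01. \<not> Q x} \<union> {0,1})" using assms(1) by (auto simp: AE_lebesgue_on_iff_negligible)
  then have "negligible {x\<in>S. \<not> Q x}"
    by (rule negligible_subset) (use assms(2) in \<open>auto simp: subset_iff less_le\<close>)
  then show ?thesis using assms(3) by (simp add: AE_lebesgue_on_iff_negligible)
qed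

lemma flux_system_limit_const:
  assumes "flux_system (limit_coefficient x1 x2 p0) k a u w" "coefficient B (limit_coefficient x1 x2 p0)"
    and "0 < x1" "x1 < x2" "x2 < 1" "x \<in> {x1..x2}"
  shows "u x = u x1"
proof -
  have "u x - u x1 = integral {x1..x} (\<lambda>t. limit_coefficient x1 x2 p0 t * w t)"
    using assms by (intro flux_system_increment(1)[OF assms(1,2)]) auto
  also have "\<dots> = integral {x1..x} (\<lambda>t. 0)"
    by (rule integral_spike[of "{x1,x2}"]) (use assms(6) in \<open>auto simp: limit_coefficient_def\<close>)
  finally show ?thesis by simp
qed

text \<open>For a test function \<open>\<phi>\<close> that is constant on \<open>\<Omega>\<^sub>0\<close>, the integrand \<open>p\<^sub>0 u\<^sub>x \<phi>\<^sub>x\<close> on \<open>\<Omega>\<^sub>1\<close> is \<open>w \<phi>\<^sub>x\<close> on all of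
\<open>[0,1]\<close>, and integration by parts with \<open>w(0) = w(1) = 0\<close> gives the weak form. The right-hand side \<open>G\<close> and the
vector \<open>e\<close> are kept general: the equilibria are the case \<open>G = f(u)\<close>, \<open>e = 1\<close>, and the eigenfunctions of the
linearisation are complex multiples of real functions with \<open>G = f'(u) \<phi>\<close>.\<close>

lemma flux_system_imp_A_0:
  fixes e :: "'a::euclidean_space"
  assumes x: "0 < x1" "x1 < x2" "x2 < 1" and p0: "continuous_on (Om1 x1 x2) p0"
    and m: "\<And>x. x \<in> Om1 x1 x2 \<Longrightarrow> m \<le> p0 x" "0 < m"
    and F: "flux_system (limit_coefficient x1 x2 p0) k a u w" "w 1 = 0"
    and G: "continuous_on {0..1} G" "\<And>x. x \<in> {0..1} \<Longrightarrow> k x (u x) = lam * u x - G x"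
      "\<And>x. x \<in> Om0 x1 x2 \<Longrightarrow> G x = \<gamma>"
    and g: "\<And>x. x \<in> {0..1} \<Longrightarrow> g x = G x *\<^sub>R e"
  shows "A_0 x1 x2 p0 lam (restrict (\<lambda>x. u x *\<^sub>R e) {0..1}) g"
proof -
  let ?q = "limit_coefficient x1 x2 p0" and ?U = "restrict (\<lambda>x. u x *\<^sub>R e) {0..1}"
  have q: "coefficient (1/m) ?q" by (rule limit_coefficient[OF x p0 m])
  note U = flux_system_H1[OF F(1) q, of e]
  have I01s: "I01 \<subseteq> {0..1}" by auto
  have S1: "Om1 x1 x2 \<subseteq> {0..1}" "Om0 x1 x2 \<subseteq> {0..1}" "int_Om1 x1 x2 \<subseteq> {0..1}" "int_Om1 x1 x2 \<subseteq> I01"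
    "int_Om1 x1 x2 \<subseteq> Om1 x1 x2" using x by auto
  have S2: "Om1 x1 x2 \<in> sets lebesgue" "Om0 x1 x2 \<in> sets lebesgue" "int_Om1 x1 x2 \<in> sets lebesgue" "I01 \<in> sets lebesgue" by auto
  have cu: "continuous_on {0..1} u" and cw: "continuous_on {0..1} w" using F by (auto simp: flux_system_def)
  define K where "K = (\<lambda>x. lam * u x - G x)"
  have cK: "continuous_on {0..1} K" unfolding K_def by (intro continuous_intros cu G)
  have aK: "K absolutely_integrable_on {0..1}" by (rule absolutely_integrable_continuous_real[OF cK])
  have wK: "w x = integral {0..x} K" if "x \<in> {0..1}" for x
  proof -
    have "w x = integral {0..x} (\<lambda>y. k y (u y))" using F that by (simp add: flux_system_def)
    also have "\<dots> = integral {0..x} K" using that by (intro integral_cong) (simp add: K_def G(2))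
    finally show ?thesis .
  qed
  have q1: "p0 x * ?q x = 1" if "x \<in> Om1 x1 x2" for x
    using m(1)[OF that] m(2) that unfolding limit_coefficient_def by (simp only: if_True) simp
  have q0: "?q x = 0" if "x \<notin> Om1 x1 x2" for x using that unfolding limit_coefficient_def by (simp only: if_False)
  have AEs: "AE x in lebesgue_on S. wderiv I01 ?U x = (?q x * w x) *\<^sub>R e" if "S \<subseteq> {0..1}" "S \<in> sets lebesgue" for S
    by (rule AE_I01_subset[OF U(2) that])
  have wz: "AE x in lebesgue_on (Om0 x1 x2). wderiv I01 ?U x = 0"
    using AEs[OF S1(2) S2(2)]
  proof (rule AE_mp, intro AE_I2 impI)
    fix x assume "x \<in> space (lebesgue_on (Om0 x1 x2))" "wderiv I01 ?U x = (?q x * w x) *\<^sub>R e"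
    moreover from this have "?q x = 0" by (intro q0) auto
    ultimately show "wderiv I01 ?U x = 0" by simp
  qed
  have UH: "?U \<in> H1_Om0 x1 x2" using U(1) wz by (simp add: H1_Om0_def)
  have "has_weak_derivative I01 (\<lambda>x. (0 + integral {0..x} K) *\<^sub>R e) (\<lambda>x. K x *\<^sub>R e)"
    by (rule has_weak_derivative_indefinite_integral[OF aK])
  then have "has_weak_derivative (int_Om1 x1 x2) (\<lambda>x. (0 + integral {0..x} K) *\<^sub>R e) (\<lambda>x. K x *\<^sub>R e)"
    using S1(4) S2(4,3) by (rule has_weak_derivative_subset)
  then have wd: "has_weak_derivative (int_Om1 x1 x2) (\<lambda>x. p0 x *\<^sub>R wderiv I01 ?U x) (\<lambda>x. K x *\<^sub>R e)"
  proof (rule has_weak_derivative_cong_AE[OF _ S2(3)])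
    show "AE x in lebesgue_on (int_Om1 x1 x2). (0 + integral {0..x} K) *\<^sub>R e = p0 x *\<^sub>R wderiv I01 ?U x"
      using AEs[OF S1(3) S2(3)]
    proof (rule AE_mp, intro AE_I2 impI)
      fix x assume "x \<in> space (lebesgue_on (int_Om1 x1 x2))" and eq: "wderiv I01 ?U x = (?q x * w x) *\<^sub>R e"
      then have x': "x \<in> int_Om1 x1 x2" by simp
      then have "p0 x * ?q x = 1" "w x = integral {0..x} K" using S1(3,5) by (blast intro: q1 wK)+
      then show "(0 + integral {0..x} K) *\<^sub>R e = p0 x *\<^sub>R wderiv I01 ?U x"
        unfolding eq by (simp flip: mult.assoc)
    qed
  qed simp
  have KL: "(\<lambda>x. K x *\<^sub>R e) \<in> L2 (int_Om1 x1 x2)" by (rule continuous_L2[OF cK S1(3) S2(3)])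
  have dom: "?U \<in> dom_A_0 x1 x2 p0"
    using UH wd KL flux_zero_imp_neumann[OF F(1) q F(2), of e] unfolding dom_A_0_def by blast
  have gAE: "AE x in lebesgue_on I01. G x *\<^sub>R e = g x" by (rule AE_I2) (use g in auto)
  have gL: "g \<in> L2_Om0 x1 x2"
  proof -
    have "AE x in lebesgue_on (Om0 x1 x2). g x = \<gamma> *\<^sub>R e"
      by (rule AE_I2) (use g G(3) x in auto)
    moreover have "g \<in> L2 I01" by (rule L2_cong_AE[OF continuous_L2[OF G(1) I01s S2(4)] gAE])
    ultimately show ?thesis unfolding L2_Om0_def by blast
  qed
  have form: "(LINT x|lebesgue_on (Om1 x1 x2). (p0 x * wderiv I01 \<phi> x) *\<^sub>R wderiv I01 ?U x + (lam * \<phi> x) *\<^sub>R ?U x)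
        + (LINT x|lebesgue_on (Om0 x1 x2). (lam * \<phi> x) *\<^sub>R ?U x) = (LINT x|lebesgue_on I01. \<phi> x *\<^sub>R g x)"
    if \<phi>: "\<phi> \<in> H1_Om0 x1 x2" for \<phi>
  proof -
    let ?\<psi> = "wderiv I01 \<phi>"
    have \<phi>1: "\<phi> \<in> H1" and \<phi>0: "AE x in lebesgue_on (Om0 x1 x2). ?\<psi> x = 0" using \<phi> by (auto simp: H1_Om0_def)
    note h = H1_wderiv[OF \<phi>1]
    have c\<phi>: "continuous_on {0..1} \<phi>" by (rule H1_continuous[OF \<phi>1])
    have VL: "(\<lambda>x. ?q x * w x) \<in> L2 I01" using coefficient_mult_L2[OF q cw, of "1::real"] by simp
    note sp = A_0_form_split[OF x p0 h(1) VL c\<phi> cu]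
    have "(LINT x|lebesgue_on (Om1 x1 x2). (p0 x * ?\<psi> x) *\<^sub>R wderiv I01 ?U x + (lam * \<phi> x) *\<^sub>R ?U x)
      = (LINT x|lebesgue_on (Om1 x1 x2). (p0 x * (?\<psi> x * (?q x * w x)) + lam * \<phi> x * u x) *\<^sub>R e)"
    proof (rule LINT_cong_AE[OF S2(1)])
      show "AE x in lebesgue_on (Om1 x1 x2). (p0 x * ?\<psi> x) *\<^sub>R wderiv I01 ?U x + (lam * \<phi> x) *\<^sub>R ?U x
         = (p0 x * (?\<psi> x * (?q x * w x)) + lam * \<phi> x * u x) *\<^sub>R e"
        using AEs[OF S1(1) S2(1)]
      proof (rule AE_mp, intro AE_I2 impI)
        fix x assume "x \<in> space (lebesgue_on (Om1 x1 x2))" and eq: "wderiv I01 ?U x = (?q x * w x) *\<^sub>R e"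
        then have "x \<in> {0..1}" using S1(1) by auto
        then have Ux: "?U x = u x *\<^sub>R e" by simp
        show "(p0 x * ?\<psi> x) *\<^sub>R wderiv I01 ?U x + (lam * \<phi> x) *\<^sub>R ?U x
         = (p0 x * (?\<psi> x * (?q x * w x)) + lam * \<phi> x * u x) *\<^sub>R e"
          unfolding eq Ux by (simp add: scaleR_add_left mult.assoc)
      qed
    qed
    also have "\<dots> = (LINT x|lebesgue_on (Om1 x1 x2). p0 x * (?\<psi> x * (?q x * w x)) + lam * \<phi> x * u x) *\<^sub>R e"
      by (rule integral_scaleR_left) (use sp(2) in blast)
    finally have A: "(LINT x|lebesgue_on (Om1 x1 x2). (p0 x * ?\<psi> x) *\<^sub>R wderiv I01 ?U x + (lam * \<phi> x) *\<^sub>R ?U x)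
      = (LINT x|lebesgue_on (Om1 x1 x2). p0 x * (?\<psi> x * (?q x * w x)) + lam * \<phi> x * u x) *\<^sub>R e" .
    have "(LINT x|lebesgue_on (Om0 x1 x2). (lam * \<phi> x) *\<^sub>R ?U x) = (LINT x|lebesgue_on (Om0 x1 x2). (lam * \<phi> x * u x) *\<^sub>R e)"
    proof (rule Bochner_Integration.integral_cong[OF refl])
      fix x assume "x \<in> space (lebesgue_on (Om0 x1 x2))"
      then have "x \<in> {0..1}" using S1(2) by auto
      then have Ux: "?U x = u x *\<^sub>R e" by simp
      show "(lam * \<phi> x) *\<^sub>R ?U x = (lam * \<phi> x * u x) *\<^sub>R e" unfolding Ux by simp
    qed
    also have "\<dots> = (LINT x|lebesgue_on (Om0 x1 x2). lam * \<phi> x * u x) *\<^sub>R e"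
      by (rule integral_scaleR_left) (use sp(3) in blast)
    finally have B: "(LINT x|lebesgue_on (Om0 x1 x2). (lam * \<phi> x) *\<^sub>R ?U x) = (LINT x|lebesgue_on (Om0 x1 x2). lam * \<phi> x * u x) *\<^sub>R e" .
    have aG: "(\<lambda>x. \<phi> x * G x) absolutely_integrable_on {0..1}"
      by (intro absolutely_integrable_continuous_real continuous_intros c\<phi> G)
    have "(LINT x|lebesgue_on I01. \<phi> x *\<^sub>R g x) = (LINT x|lebesgue_on I01. (\<phi> x * G x) *\<^sub>R e)"
      by (rule Bochner_Integration.integral_cong[OF refl]) (use g in simp)
    also have "\<dots> = (LINT x|lebesgue_on I01. \<phi> x * G x) *\<^sub>R e"
      by (rule integral_scaleR_left) (use LINT_I01_eq(1)[OF aG] in blast)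
    also have "(LINT x|lebesgue_on I01. \<phi> x * G x) = integral {0..1} (\<lambda>x. \<phi> x * G x)" by (rule LINT_I01_eq(2)[OF aG])
    finally have C: "(LINT x|lebesgue_on I01. \<phi> x *\<^sub>R g x) = integral {0..1} (\<lambda>x. \<phi> x * G x) *\<^sub>R e" .
    have n: "negligible ({x\<in>Om0 x1 x2. ?\<psi> x \<noteq> 0})" using \<phi>0 by (simp add: AE_lebesgue_on_iff_negligible)
    have "integral {0..1} (\<lambda>x. (if x \<in> Om1 x1 x2 then p0 x else 0) * (?\<psi> x * (?q x * w x)))
        = integral {0..1} (\<lambda>x. integral {0..x} K * ?\<psi> x)"
    proof (rule integral_spike[OF n])
      fix x assume x': "x \<in> {0..1} - {x\<in>Om0 x1 x2. ?\<psi> x \<noteq> 0}"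
      show "integral {0..x} K * ?\<psi> x = (if x \<in> Om1 x1 x2 then p0 x else 0) * (?\<psi> x * (?q x * w x))"
      proof (cases "x \<in> Om1 x1 x2")
        case True
        have "p0 x * (?\<psi> x * (?q x * w x)) = (p0 x * ?q x) * (w x * ?\<psi> x)" by (simp only: mult_ac)
        then show ?thesis using True q1[OF True] wK[of x] x' by (simp only: if_True DiffD1)
      next
        case False
        then have "x \<in> Om0 x1 x2" using x' by auto
        then have "?\<psi> x = 0" using x' by blast
        then show ?thesis by simp
      qed
    qed
    moreover have "integral {0..1} (\<lambda>x. K x * \<phi> x) = \<phi> 1 * integral {0..1} K - integral {0..1} (\<lambda>x. integral {0..x} K * ?\<psi> x)"
      using h(4) by (rule integral_by_parts_H1[OF aK h(2)])
    moreover have "integral {0..1} K = 0" using wK[of 1] F(2) by simp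
    moreover have "integral {0..1} (\<lambda>x. K x * \<phi> x) = integral {0..1} (\<lambda>x. lam * \<phi> x * u x) - integral {0..1} (\<lambda>x. \<phi> x * G x)"
      by (subst Henstock_Kurzweil_Integration.integral_diff[symmetric])
        (auto intro!: integrable_continuous_real continuous_intros c\<phi> cu G(1) simp: K_def algebra_simps)
    ultimately have "integral {0..1} (\<lambda>x. (if x \<in> Om1 x1 x2 then p0 x else 0) * (?\<psi> x * (?q x * w x)))
        + integral {0..1} (\<lambda>x. lam * \<phi> x * u x) = integral {0..1} (\<lambda>x. \<phi> x * G x)" by simp
    then show ?thesis unfolding A B C scaleR_add_left[symmetric] sp(4)[where lam=lam] by (simp only:)
  qed
  show ?thesis unfolding A_0_def using dom gL form by blast
qed

text \<open>Let \<open>w\<close> be the indefinite integral of \<open>lam u - f(u)\<close>. After integration by parts the weak form reads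
\<open>\<integral>\<^bsub>\<Omega>\<^sub>1\<^esub> (p\<^sub>0 u\<^sub>x - w) \<phi>\<^sub>x + \<phi>(1) w(1) = 0\<close>. The test function \<open>1\<close> gives \<open>w(1) = 0\<close>, and the indefinite integral of
the sign of \<open>p\<^sub>0 u\<^sub>x - w\<close> on \<open>\<Omega>\<^sub>1\<close>, which is constant on \<open>\<Omega>\<^sub>0\<close>, gives \<open>p\<^sub>0 u\<^sub>x = w\<close> there.\<close>

lemma A_0_imp_flux_system:
  fixes u f :: "real \<Rightarrow> real"
  assumes x: "0 < x1" "x1 < x2" "x2 < 1" and p0: "continuous_on (Om1 x1 x2) p0"
    and m: "\<And>x. x \<in> Om1 x1 x2 \<Longrightarrow> m \<le> p0 x" "0 < m"
    and A: "A_0 x1 x2 p0 lam u (\<lambda>x. f (u x))" and f: "continuous_on UNIV f"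
  shows "\<exists>w. flux_system (limit_coefficient x1 x2 p0) (\<lambda>_ s. lam * s - f s) (u 0) u w \<and> w 1 = 0"
proof -
  let ?v = "wderiv I01 u" and ?q = "limit_coefficient x1 x2 p0"
  define P where "P = (\<lambda>x. if x \<in> Om1 x1 x2 then p0 x else 0)"
  have S1: "Om1 x1 x2 \<subseteq> {0..1}" "Om0 x1 x2 \<subseteq> {0..1}" using x by auto
  have S2: "Om1 x1 x2 \<in> sets lebesgue" "Om0 x1 x2 \<in> sets lebesgue" "I01 \<in> sets lebesgue" by auto
  have K: "compact (Om1 x1 x2)" by (intro compact_Un compact_Icc)
  have u1: "u \<in> H1" and v0: "AE x in lebesgue_on (Om0 x1 x2). ?v x = 0"
    using A by (auto simp: A_0_def dom_A_0_def H1_Om0_def)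
  note u = H1_wderiv[OF u1]
  have cu: "continuous_on {0..1} u" by (rule H1_continuous[OF u1])
  have cf: "continuous_on {0..1} (\<lambda>x. f (u x))" by (rule continuous_on_compose2[OF f cu]) auto
  define k where "k = (\<lambda>x. lam * u x - f (u x))"
  have ck: "continuous_on {0..1} k" unfolding k_def by (intro continuous_intros cu cf)
  have ak: "k absolutely_integrable_on {0..1}" by (rule absolutely_integrable_continuous_real[OF ck])
  define w where "w = (\<lambda>x. integral {0..x} k)"
  have cw: "continuous_on {0..1} w" unfolding w_def by (rule continuous_on_indefinite_integral[OF ak])
  have form: "integral {0..1} (\<lambda>x. P x * (wderiv I01 \<phi> x * ?v x)) + \<phi> 1 * w 1
      = integral {0..1} (\<lambda>x. w x * wderiv I01 \<phi> x)" if \<phi>: "\<phi> \<in> H1_Om0 x1 x2" for \<phi>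
  proof -
    have \<phi>1: "\<phi> \<in> H1" using \<phi> by (auto simp: H1_Om0_def)
    note h = H1_wderiv[OF \<phi>1]
    have c\<phi>: "continuous_on {0..1} \<phi>" by (rule H1_continuous[OF \<phi>1])
    have "(LINT x|lebesgue_on (Om1 x1 x2). (p0 x * wderiv I01 \<phi> x) *\<^sub>R ?v x + (lam * \<phi> x) *\<^sub>R u x)
        + (LINT x|lebesgue_on (Om0 x1 x2). (lam * \<phi> x) *\<^sub>R u x) = (LINT x|lebesgue_on I01. \<phi> x *\<^sub>R f (u x))"
      using A \<phi> unfolding A_0_def by blast
    then have "integral {0..1} (\<lambda>x. P x * (wderiv I01 \<phi> x * ?v x)) + integral {0..1} (\<lambda>x. lam * \<phi> x * u x)
       = (LINT x|lebesgue_on I01. \<phi> x * f (u x))"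
      unfolding P_def using A_0_form_split(4)[OF x p0 h(1) u(1) c\<phi> cu, where lam=lam]
      by (simp only: real_scaleR_def mult.assoc)
    moreover have "(LINT x|lebesgue_on I01. \<phi> x * f (u x)) = integral {0..1} (\<lambda>x. \<phi> x * f (u x))"
      by (intro LINT_I01_eq(2) absolutely_integrable_continuous_real continuous_intros c\<phi> cf)
    moreover have "integral {0..1} (\<lambda>x. k x * \<phi> x) = integral {0..1} (\<lambda>x. lam * \<phi> x * u x) - integral {0..1} (\<lambda>x. \<phi> x * f (u x))"
      by (subst Henstock_Kurzweil_Integration.integral_diff[symmetric])
        (auto intro!: integrable_continuous_real continuous_intros c\<phi> cu cf simp: k_def algebra_simps)
    moreover have "integral {0..1} (\<lambda>x. k x * \<phi> x) = \<phi> 1 * w 1 - integral {0..1} (\<lambda>x. w x * wderiv I01 \<phi> x)"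
      unfolding w_def using h(4) by (rule integral_by_parts_H1[OF ak h(2)])
    ultimately show ?thesis by simp
  qed
  have w1: "w 1 = 0"
  proof -
    let ?\<phi> = "restrict (\<lambda>_. 1::real) {0..1}"
    have L: "(\<lambda>x::real. 0 *\<^sub>R (1::real)) \<in> L2 I01" by (simp add: L2_def)
    have a0: "(\<lambda>x::real. 0::real) absolutely_integrable_on {0..1}" by simp
    have \<phi>: "?\<phi> \<in> H1" "AE x in lebesgue_on I01. wderiv I01 ?\<phi> x = 0"
      using H1_I(1,2)[OF a0 L restrict_extensional, of "\<lambda>_. 1" 1] by auto
    have n: "negligible ({x\<in>I01. wderiv I01 ?\<phi> x \<noteq> 0} \<union> {0,1})" using \<phi>(2) by (auto simp: AE_lebesgue_on_iff_negligible)
    have z: "integral {0..1} (\<lambda>x. g x * wderiv I01 ?\<phi> x) = 0" for g :: "real \<Rightarrow> real"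
    proof -
      have "integral {0..1} (\<lambda>x. g x * wderiv I01 ?\<phi> x) = integral {0..1} (\<lambda>x::real. 0::real)"
        by (rule integral_spike[OF n]) auto
      then show ?thesis by simp
    qed
    have "?\<phi> \<in> H1_Om0 x1 x2" unfolding H1_Om0_def using \<phi>(1) AE_I01_subset[OF \<phi>(2) S1(2) S2(2)] by blast
    from form[OF this] show ?thesis using z[of "\<lambda>x. P x * ?v x"] z[of w] by (simp add: mult_ac)
  qed
  \<comment> \<open>The defect \<open>p\<^sub>0 u\<^sub>x - w\<close> on \<open>\<Omega>\<^sub>1\<close>, extended by zero.\<close>
  define g where "g = (\<lambda>x. P x * ?v x - (if x \<in> Om1 x1 x2 then 1 else 0) * w x)"
  have aPv: "(\<lambda>x. P x * ?v x) absolutely_integrable_on {0..1}" and Pm: "P \<in> borel_measurable (lebesgue_on {0..1})"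
  proof -
    have "bounded (p0 ` Om1 x1 x2)" using compact_continuous_image[OF p0 K] compact_imp_bounded by blast
    then obtain B0 where B0: "\<forall>x\<in>Om1 x1 x2. \<bar>p0 x\<bar> \<le> B0" unfolding bounded_iff by (auto simp del: Un_iff atLeastAtMost_iff)
    show Pm: "P \<in> borel_measurable (lebesgue_on {0..1})" unfolding P_def by (rule zero_extension_measurable[OF p0 K S1(1)])
    show "(\<lambda>x. P x * ?v x) absolutely_integrable_on {0..1}"
    proof (rule absolutely_integrable_mult_bounded[OF u(2) _ Pm])
      show "\<bar>P x\<bar> \<le> max B0 0" for x
        using B0 unfolding P_def by (cases "x \<in> Om1 x1 x2") (auto simp del: Un_iff atLeastAtMost_iff intro: max.coboundedI1)
    qed auto
  qed
  have \<chi>m: "(\<lambda>x. if x \<in> Om1 x1 x2 then 1 else 0::real) \<in> borel_measurable (lebesgue_on {0..1})"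
    by (rule zero_extension_measurable[OF _ K S1(1)]) auto
  have a\<chi>: "(\<lambda>x. (if x \<in> Om1 x1 x2 then 1 else 0) * w x) absolutely_integrable_on {0..1}"
    by (rule absolutely_integrable_mult_bounded[OF absolutely_integrable_continuous_real[OF cw] _ \<chi>m, where B=1]) auto
  have ag: "g absolutely_integrable_on {0..1}" unfolding g_def using aPv a\<chi> by (rule set_integral_diff(1))
  then have gm: "g \<in> borel_measurable (lebesgue_on {0..1})"
    by (metis integrable_lebesgue_on_iff borel_measurable_integrable sets_completionI_sets sets_lborel atLeastAtMost_borel)
  \<comment> \<open>The sign, rather than the defect itself, is bounded and hence trivially square integrable.\<close>
  define \<psi> where "\<psi> = (\<lambda>x. sgn (g x))"
  have \<psi>m: "\<psi> \<in> borel_measurable (lebesgue_on {0..1})"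
    unfolding \<psi>_def using gm by measurable
  have a\<psi>: "\<psi> absolutely_integrable_on {0..1}"
    using absolutely_integrable_mult_bounded[OF absolutely_integrable_continuous_real[OF continuous_on_const[of _ 1]] _ \<psi>m, where B=1]
    by (auto simp: \<psi>_def sgn_real_def)
  have \<psi>L: "(\<lambda>x. \<psi> x *\<^sub>R (1::real)) \<in> L2 I01"
    by (rule L2_bounded_scaleR[OF \<psi>m, where B=1]) (auto simp: \<psi>_def sgn_real_def)
  let ?\<phi> = "restrict (\<lambda>x. (0 + integral {0..x} \<psi>) *\<^sub>R (1::real)) {0..1}"
  have \<phi>: "?\<phi> \<in> H1" "AE x in lebesgue_on I01. wderiv I01 ?\<phi> x = \<psi> x"
    using H1_I(1,2)[OF a\<psi> \<psi>L restrict_extensional, of "\<lambda>x. (0 + integral {0..x} \<psi>) *\<^sub>R (1::real)" 0] by auto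
  have g0: "g x = 0" if "x \<in> Om0 x1 x2" for x
  proof -
    have "x \<notin> Om1 x1 x2" using that by auto
    then show ?thesis unfolding g_def P_def by (simp only: if_False)
  qed
  have n: "negligible ({x\<in>I01. wderiv I01 ?\<phi> x \<noteq> \<psi> x} \<union> {0,1})" using \<phi>(2) by (auto simp: AE_lebesgue_on_iff_negligible)
  have "AE x in lebesgue_on (Om0 x1 x2). wderiv I01 ?\<phi> x = 0"
    using AE_I01_subset[OF \<phi>(2) S1(2) S2(2)]
    by (rule AE_mp) (auto intro!: AE_I2 simp: \<psi>_def g0)
  then have "?\<phi> \<in> H1_Om0 x1 x2" unfolding H1_Om0_def using \<phi>(1) by blast
  note F = form[OF this]
  have "integral {0..1} (\<lambda>x. P x * (wderiv I01 ?\<phi> x * ?v x)) = integral {0..1} (\<lambda>x. \<psi> x * (P x * ?v x))"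
    by (rule integral_spike[OF n]) auto
  moreover have "integral {0..1} (\<lambda>x. w x * wderiv I01 ?\<phi> x) = integral {0..1} (\<lambda>x. \<psi> x * ((if x \<in> Om1 x1 x2 then 1 else 0) * w x))"
  proof (rule integral_spike[OF n])
    fix x assume x': "x \<in> {0..1} - ({x\<in>I01. wderiv I01 ?\<phi> x \<noteq> \<psi> x} \<union> {0,1})"
    then have e: "wderiv I01 ?\<phi> x = \<psi> x" by auto
    show "\<psi> x * ((if x \<in> Om1 x1 x2 then 1 else 0) * w x) = w x * wderiv I01 ?\<phi> x"
    proof (cases "x \<in> Om1 x1 x2")
      case False
      then have "x \<in> Om0 x1 x2" using x' by auto
      then have "\<psi> x = 0" by (simp add: \<psi>_def g0)
      then show ?thesis unfolding e by simp
    next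
      case True
      then show ?thesis unfolding e by simp
    qed
  qed
  moreover have i: "(\<lambda>x. \<psi> x * (P x * ?v x)) absolutely_integrable_on {0..1}"
    "(\<lambda>x. \<psi> x * ((if x \<in> Om1 x1 x2 then 1 else 0) * w x)) absolutely_integrable_on {0..1}"
    by (rule absolutely_integrable_mult_bounded[OF aPv _ \<psi>m, where B=1]; simp add: \<psi>_def sgn_real_def)
       (rule absolutely_integrable_mult_bounded[OF a\<chi> _ \<psi>m, where B=1]; simp add: \<psi>_def sgn_real_def)
  moreover have "integral {0..1} (\<lambda>x. \<bar>g x\<bar>) = integral {0..1} (\<lambda>x. \<psi> x * (P x * ?v x)) - integral {0..1} (\<lambda>x. \<psi> x * ((if x \<in> Om1 x1 x2 then 1 else 0) * w x))"
  proof -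
    have "\<bar>g x\<bar> = \<psi> x * (P x * ?v x) - \<psi> x * ((if x \<in> Om1 x1 x2 then 1 else 0) * w x)" for x
      unfolding \<psi>_def right_diff_distrib[symmetric] g_def[symmetric, THEN fun_cong] by (simp add: abs_sgn mult.commute)
    then have "(\<lambda>x. \<bar>g x\<bar>) = (\<lambda>x. \<psi> x * (P x * ?v x) - \<psi> x * ((if x \<in> Om1 x1 x2 then 1 else 0) * w x))" by blast
    then show ?thesis using i by (simp only: absolutely_integrable_on_def Henstock_Kurzweil_Integration.integral_diff)
  qed
  ultimately have "integral {0..1} (\<lambda>x. \<bar>g x\<bar>) = 0" using F w1 by simp
  moreover have abs_ag: "(\<lambda>x. \<bar>g x\<bar>) absolutely_integrable_on {0..1}"
    using absolutely_integrable_abs[OF ag] by simp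
  ultimately have "AE x in lebesgue_on I01. \<bar>g x\<bar> = 0"
    using integral_nonneg_eq_0_iff_AE[OF LINT_I01_eq(1)[OF abs_ag]] LINT_I01_eq(2)[OF abs_ag] by auto
  then have ng: "negligible {x\<in>I01. g x \<noteq> 0}" by (simp add: AE_lebesgue_on_iff_negligible)
  have nv: "negligible {x\<in>Om0 x1 x2. ?v x \<noteq> 0}" using v0 by (simp add: AE_lebesgue_on_iff_negligible)
  have nn: "negligible ({x\<in>I01. g x \<noteq> 0} \<union> {x\<in>Om0 x1 x2. ?v x \<noteq> 0} \<union> {0,1})" using ng nv by auto
  have vq: "?v x = ?q x * w x" if "x \<in> {0..1} - ({x\<in>I01. g x \<noteq> 0} \<union> {x\<in>Om0 x1 x2. ?v x \<noteq> 0} \<union> {0,1})" for x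
  proof (cases "x \<in> Om1 x1 x2")
    case True
    have "g x = 0" using that by auto
    then have "p0 x * ?v x = w x" using True unfolding g_def P_def by (simp only: if_True)
    moreover have "p0 x > 0" using m(1)[OF True] m(2) by simp
    ultimately show ?thesis using True unfolding limit_coefficient_def by (simp only: if_True) (simp add: field_simps)
  next
    case False
    then have "x \<in> Om0 x1 x2" using that by auto
    then have "?v x = 0" using that by blast
    then show ?thesis using False unfolding limit_coefficient_def by (simp only: if_False)
  qed
  have "flux_system ?q (\<lambda>_ s. lam * s - f s) (u 0) u w"
    unfolding flux_system_def
  proof (intro conjI ballI cu cw)
    fix x :: real assume x': "x \<in> {0..1}"
    have "integral {0..x} ?v = integral {0..x} (\<lambda>y. ?q y * w y)"
    proof (rule integral_spike[OF nn])
      fix y assume "y \<in> {0..x} - ({x\<in>I01. g x \<noteq> 0} \<union> {x\<in>Om0 x1 x2. ?v x \<noteq> 0} \<union> {0,1})"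
      moreover have "{0..x} \<subseteq> {0..1}" using x' by auto
      ultimately have "?v y = ?q y * w y" by (intro vq) blast
      then show "?q y * w y = ?v y" by (rule sym)
    qed
    then show "u x = u 0 + integral {0..x} (\<lambda>y. ?q y * w y)" using u(4)[OF x'] by simp
    show "w x = integral {0..x} (\<lambda>y. lam * u y - f (u y))" by (simp add: w_def k_def)
  qed
  then show ?thesis using w1 by blast
qed

section \<open>Gronwall estimates and global solvability\<close>

lemma gronwall:
  fixes s :: "real \<Rightarrow> real"
  assumes c: "continuous_on {0..1} s" and K: "0 \<le> K"
    and s: "\<And>x. x \<in> {0..1} \<Longrightarrow> s x \<le> \<gamma> + K * integral {0..x} s" and x: "x \<in> {0..1}"
  shows "s x \<le> \<gamma> * exp (K * x)"
proof -
  define y where "y = (\<lambda>x. exp (- (K * x)) * (\<gamma> + K * integral {0..x} s))"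
  have "y x \<le> y 0"
  proof (rule DERIV_nonpos_imp_decreasing_open[where f=y and a=0 and b=x])
    show "0 \<le> x" using x by simp
    show "continuous_on {0..x} y"
      unfolding y_def using x continuous_on_indefinite_integral[OF absolutely_integrable_continuous_real[OF c]]
      by (intro continuous_intros) (auto intro: continuous_on_subset)
    fix t assume t: "0 < t" "t < x"
    then have "((\<lambda>x. integral {0..x} s) has_real_derivative s t) (at t within {0..1})"
      using x by (intro integral_has_real_derivative c) auto
    then have "((\<lambda>x. integral {0..x} s) has_real_derivative s t) (at t)"
      using t x at_within_Icc_at[of 0 t 1] by auto
    then have "(y has_real_derivative exp (- (K * t)) * (- K) * (\<gamma> + K * integral {0..t} s) + K * s t * exp (- (K * t))) (at t)"
      unfolding y_def by (auto intro!: derivative_eq_intros)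
    moreover have "exp (- (K * t)) * (- K) * (\<gamma> + K * integral {0..t} s) + K * s t * exp (- (K * t))
       = exp (- (K * t)) * K * (s t - (\<gamma> + K * integral {0..t} s))" by (simp add: algebra_simps)
    moreover have "\<dots> \<le> 0" using s[of t] t x K by (intro mult_nonneg_nonpos) auto
    ultimately show "\<exists>z. (y has_real_derivative z) (at t) \<and> z \<le> 0" by metis
  qed
  then have "exp (- (K * x)) * (\<gamma> + K * integral {0..x} s) \<le> \<gamma>" by (simp add: y_def)
  then have "exp (K * x) * (exp (- (K * x)) * (\<gamma> + K * integral {0..x} s)) \<le> exp (K * x) * \<gamma>"
    by (intro mult_left_mono) auto
  then have "\<gamma> + K * integral {0..x} s \<le> \<gamma> * exp (K * x)"
    by (simp add: mult.assoc[symmetric] mult_exp_exp mult.commute)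
  then show ?thesis using s[OF x] by simp
qed

text \<open>All later estimates compare two solutions and have this form: \<open>e\<close> and \<open>g\<close> are the differences of the two
components, \<open>r1\<close> collects the error made in the coefficient and \<open>r2\<close> the error made in the nonlinearity. The first
error enters only through its integral, which is why \<open>L\<^sup>1\<close> convergence of the coefficients suffices.\<close>

lemma flux_perturbation:
  fixes e g e' g' r1 :: "real \<Rightarrow> real"
  assumes c: "continuous_on {0..1} e" "continuous_on {0..1} g"
    and e: "\<And>x. x \<in> {0..1} \<Longrightarrow> e x = b + integral {0..x} e'"
    and g: "\<And>x. x \<in> {0..1} \<Longrightarrow> g x = integral {0..x} g'"
    and i: "e' absolutely_integrable_on {0..1}" "g' absolutely_integrable_on {0..1}" "r1 absolutely_integrable_on {0..1}"
    and e': "\<And>x. x \<in> {0..1} \<Longrightarrow> \<bar>e' x\<bar> \<le> B * \<bar>g x\<bar> + r1 x"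
    and g': "\<And>x. x \<in> {0..1} \<Longrightarrow> \<bar>g' x\<bar> \<le> L * \<bar>e x\<bar> + r2"
    and r: "\<And>x. x \<in> {0..1} \<Longrightarrow> 0 \<le> r1 x" "0 \<le> r2" and BL: "0 \<le> B" "0 \<le> L" and x: "x \<in> {0..1}"
  shows "\<bar>e x\<bar> + \<bar>g x\<bar> \<le> (\<bar>b\<bar> + integral {0..1} r1 + r2) * exp (B + L)"
proof -
  define s where "s = (\<lambda>x. \<bar>e x\<bar> + \<bar>g x\<bar>)"
  have cs: "continuous_on {0..1} s" unfolding s_def by (intro continuous_intros c)
  let ?\<gamma> = "\<bar>b\<bar> + integral {0..1} r1 + r2"
  have "s t \<le> ?\<gamma> + (B + L) * integral {0..t} s" if t: "t \<in> {0..1}" for t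
  proof -
    have sub: "{0..t} \<subseteq> {0..1}" using t by auto
    have ic: "h integrable_on {0..t}" if "continuous_on {0..1} h" for h :: "real \<Rightarrow> real"
      by (rule integrable_continuous_real[OF continuous_on_subset[OF that sub]])
    have ia: "h integrable_on {0..t}" if "h absolutely_integrable_on {0..1}" for h :: "real \<Rightarrow> real"
      using absolutely_integrable_on_subinterval[OF that sub] by (simp add: absolutely_integrable_on_def)
    have ie: "(\<lambda>x. \<bar>e x\<bar>) integrable_on {0..t}" "(\<lambda>x. \<bar>g x\<bar>) integrable_on {0..t}" "s integrable_on {0..t}"
      by (auto intro!: ic continuous_intros c cs)
    have "norm (integral {0..t} e') \<le> integral {0..t} (\<lambda>x. B * s x + r1 x)"
    proof (rule Henstock_Kurzweil_Integration.integral_norm_bound_integral)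
      show "(\<lambda>x. B * s x + r1 x) integrable_on {0..t}"
        by (intro Henstock_Kurzweil_Integration.integrable_add integrable_on_mult_right ie ia i)
      fix x assume "x \<in> {0..t}"
      then have x: "x \<in> {0..1}" using sub by auto
      have "B * \<bar>g x\<bar> \<le> B * s x" using BL by (intro mult_left_mono) (auto simp: s_def)
      then show "norm (e' x) \<le> B * s x + r1 x" using e'[OF x] by simp
    qed (intro ia i)
    also have "\<dots> = B * integral {0..t} s + integral {0..t} r1"
      by (subst Henstock_Kurzweil_Integration.integral_add) (auto intro: integrable_on_mult_right ie ia i)
    also have "integral {0..t} r1 \<le> integral {0..1} r1"
      using i(3) r(1) by (intro integral_subset_le sub ia i) (auto simp: absolutely_integrable_on_def)
    finally have E: "\<bar>integral {0..t} e'\<bar> \<le> B * integral {0..t} s + integral {0..1} r1" by simp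
    have "norm (integral {0..t} g') \<le> integral {0..t} (\<lambda>x. L * s x + r2)"
    proof (rule Henstock_Kurzweil_Integration.integral_norm_bound_integral)
      show "(\<lambda>x. L * s x + r2) integrable_on {0..t}"
        by (intro Henstock_Kurzweil_Integration.integrable_add integrable_on_mult_right ie integrable_const_ivl)
      fix x assume "x \<in> {0..t}"
      then have x: "x \<in> {0..1}" using sub by auto
      have "L * \<bar>e x\<bar> \<le> L * s x" using BL by (intro mult_left_mono) (auto simp: s_def)
      then show "norm (g' x) \<le> L * s x + r2" using g'[OF x] by simp
    qed (intro ia i)
    also have "\<dots> = L * integral {0..t} s + t * r2"
      using t by (subst Henstock_Kurzweil_Integration.integral_add) (auto intro: integrable_on_mult_right ie)
    also have "t * r2 \<le> r2" using t r(2) by (simp add: mult_left_le_one_le)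
    finally have G: "\<bar>integral {0..t} g'\<bar> \<le> L * integral {0..t} s + r2" by simp
    have "s t \<le> \<bar>b\<bar> + \<bar>integral {0..t} e'\<bar> + \<bar>integral {0..t} g'\<bar>"
      unfolding s_def e[OF t] g[OF t] by (simp add: abs_triangle_ineq)
    then show ?thesis using E G by (simp add: algebra_simps)
  qed
  then have "s x \<le> ?\<gamma> * exp ((B + L) * x)" using BL by (intro gronwall[OF cs _ _ x]) auto
  also have "\<dots> \<le> ?\<gamma> * exp (B + L)"
  proof (intro mult_left_mono)
    have "(B + L) * x \<le> (B + L) * 1" using BL x by (intro mult_left_mono) auto
    then show "exp ((B + L) * x) \<le> exp (B + L)" by simp
    show "0 \<le> ?\<gamma>" using r i(3) by (auto intro!: add_nonneg_nonneg integral_nonneg simp: absolutely_integrable_on_def)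
  qed
  finally show ?thesis by (simp add: s_def)
qed

text \<open>Eliminating \<open>w\<close> leaves a fixed point equation for \<open>u\<close>. In the unknown \<open>v(x) = exp(-K x) u(x)\<close> it is a contraction
on all of \<open>[0,1]\<close> once \<open>K\<^sup>2 \<ge> 2 L B\<close>, because integrating \<open>exp(K x)\<close> twice gains the factor \<open>1/K\<^sup>2\<close>.\<close>

lemma flux_system_exists:
  fixes k :: "real \<Rightarrow> real \<Rightarrow> real"
  assumes q: "coefficient B q" and B: "0 \<le> B" and L: "0 \<le> L"
    and ck: "continuous_on ({0..1} \<times> UNIV) (\<lambda>(x, s). k x s)"
    and lip: "\<And>x s t. x \<in> {0..1} \<Longrightarrow> \<bar>k x s - k x t\<bar> \<le> L * \<bar>s - t\<bar>"
  shows "\<exists>u w. flux_system q k a u w"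
proof -
  define K where "K = 1 + 2 * (L * B)"
  have LB: "0 \<le> L * B" using L B by simp
  have K: "K > 0" "L * B / K\<^sup>2 \<le> 1/2"
  proof -
    show "K > 0" using LB by (simp add: K_def)
    have "K \<ge> 1" using LB by (simp add: K_def)
    then have "K \<le> K\<^sup>2" by (rule self_le_power) simp
    then have "2 * (L * B) \<le> K\<^sup>2" by (simp add: K_def)
    then show "L * B / K\<^sup>2 \<le> 1/2" using \<open>K > 0\<close> by (simp add: field_simps)
  qed
  have ckv: "continuous_on {0..1} (\<lambda>z. k z (v z))" if "continuous_on {0..1} v" for v
  proof -
    have 1: "continuous_on {0..1} (\<lambda>z. (z, v z))" by (intro continuous_intros that)
    have 2: "(\<lambda>z. (z, v z)) ` {0..1} \<subseteq> {0..1} \<times> UNIV" by auto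
    from continuous_on_compose2[OF ck 1 2] show ?thesis by simp
  qed
  define I where "I = (\<lambda>(v :: real \<Rightarrow>\<^sub>C real) y. integral {0..y} (\<lambda>z. k z (exp (K * z) * v z)))"
  define G where "G = (\<lambda>v x. exp (- (K * x)) * (a + integral {0..x} (\<lambda>y. q y * I v y)))"
  have cv: "continuous_on {0..1} (\<lambda>z. exp (K * z) * apply_bcontfun v z)" for v
    by (intro continuous_intros) auto
  have ai: "(\<lambda>z. k z (exp (K * z) * apply_bcontfun v z)) absolutely_integrable_on {0..1}" for v
    by (intro absolutely_integrable_continuous_real ckv cv)
  have cI: "continuous_on {0..1} (I v)" for v
    unfolding I_def by (rule continuous_on_indefinite_integral[OF ai])
  have aq: "(\<lambda>y. q y * I v y) absolutely_integrable_on {0..1}" for v by (rule coefficient_mult_integrable[OF q cI])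
  have cG: "continuous_on {0..1} (G v)" for v
    unfolding G_def by (intro continuous_intros continuous_on_indefinite_integral aq)
  \<comment> \<open>Functions on \<open>[0,1]\<close> are extended by constants, since the Banach space consists of functions on the whole line.\<close>
  define c where "c = (\<lambda>x::real. max 0 (min 1 x))"
  have c01: "c x \<in> {0..1}" and cid: "x \<in> {0..1} \<Longrightarrow> c x = x" for x by (auto simp: c_def)
  have cc: "continuous_on UNIV c" unfolding c_def by (intro continuous_intros)
  have bG: "(\<lambda>x. G v (c x)) \<in> bcontfun" for v
  proof -
    have "bounded (G v ` {0..1})" using compact_continuous_image[OF cG] compact_imp_bounded by blast
    then obtain M where "\<forall>x\<in>{0..1}. norm (G v x) \<le> M" by (auto simp: bounded_iff)
    then show ?thesis using c01 by (intro bcontfun_normI[of _ M] continuous_on_compose2[OF cG cc]) auto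
  qed
  define T where "T = (\<lambda>v. Bcontfun (\<lambda>x. G v (c x)))"
  have Tv: "apply_bcontfun (T v) x = G v (c x)" for v x unfolding T_def by (simp add: Bcontfun_inverse[OF bG])
  have lipG: "\<bar>G v x - G v' x\<bar> \<le> 1/2 * dist v v'" if x: "x \<in> {0..1}" for v v' x
  proof -
    let ?D = "dist v v'"
    have expI: "((\<lambda>z. C * exp (K * z)) has_integral C * (exp (K * y) - 1) / K) {0..y}" if "0 \<le> y" for C y
    proof -
      have "((\<lambda>z. C * exp (K * z)) has_integral (C * exp (K * y) / K - C * exp (K * 0) / K)) {0..y}"
        using that K by (intro fundamental_theorem_of_calculus)
          (auto intro!: derivative_eq_intros simp flip: has_real_derivative_iff_has_vector_derivative)
      then show ?thesis by (simp add: right_diff_distrib diff_divide_distrib)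
    qed
    have dI: "\<bar>I v y - I v' y\<bar> \<le> L * ?D / K * exp (K * y)" if y: "y \<in> {0..1}" for y
    proof -
      have sub: "{0..y} \<subseteq> {0..1}" using y by auto
      have i: "(\<lambda>z. k z (exp (K * z) * apply_bcontfun v z)) integrable_on {0..y}" for v
        using absolutely_integrable_on_subinterval[OF ai sub] by (simp add: absolutely_integrable_on_def)
      have "I v y - I v' y = integral {0..y} (\<lambda>z. k z (exp (K * z) * v z) - k z (exp (K * z) * v' z))"
        unfolding I_def by (rule Henstock_Kurzweil_Integration.integral_diff[OF i i, symmetric])
      also have "norm \<dots> \<le> integral {0..y} (\<lambda>z. L * ?D * exp (K * z))"
      proof (rule Henstock_Kurzweil_Integration.integral_norm_bound_integral)
        show "(\<lambda>z. L * ?D * exp (K * z)) integrable_on {0..y}" using y by (intro has_integral_integrable[OF expI]) auto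
        fix z assume z: "z \<in> {0..y}"
        have "\<bar>k z (exp (K * z) * v z) - k z (exp (K * z) * v' z)\<bar> \<le> L * \<bar>exp (K * z) * v z - exp (K * z) * v' z\<bar>"
          using z sub by (intro lip) auto
        also have "\<bar>exp (K * z) * v z - exp (K * z) * v' z\<bar> = exp (K * z) * dist (v z) (v' z)"
          by (simp add: dist_real_def abs_mult flip: right_diff_distrib)
        also have "L * \<dots> \<le> L * (exp (K * z) * ?D)"
          by (intro mult_left_mono dist_bounded L) auto
        finally show "norm (k z (exp (K * z) * v z) - k z (exp (K * z) * v' z)) \<le> L * ?D * exp (K * z)"
          by (simp add: mult_ac)
      qed (intro Henstock_Kurzweil_Integration.integrable_diff i)
      also have "\<dots> = L * ?D * (exp (K * y) - 1) / K" using y by (intro integral_unique expI) auto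
      also have "\<dots> \<le> L * ?D / K * exp (K * y)" using L K by (simp add: field_simps)
      finally show ?thesis by simp
    qed
    have sub: "{0..x} \<subseteq> {0..1}" using x by auto
    have i: "(\<lambda>y. q y * I v y) integrable_on {0..x}" for v
      using absolutely_integrable_on_subinterval[OF aq sub] by (simp add: absolutely_integrable_on_def)
    have "integral {0..x} (\<lambda>y. q y * I v y) - integral {0..x} (\<lambda>y. q y * I v' y) = integral {0..x} (\<lambda>y. q y * I v y - q y * I v' y)"
      by (rule Henstock_Kurzweil_Integration.integral_diff[OF i i, symmetric])
    also have "norm \<dots> \<le> integral {0..x} (\<lambda>y. B * (L * ?D / K) * exp (K * y))"
    proof (rule Henstock_Kurzweil_Integration.integral_norm_bound_integral)
      show "(\<lambda>z. B * (L * ?D / K) * exp (K * z)) integrable_on {0..x}" using x by (intro has_integral_integrable[OF expI]) auto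
      fix y assume y: "y \<in> {0..x}"
      then have "\<bar>q y\<bar> \<le> B" using q sub by (auto simp: coefficient_def)
      moreover have "\<bar>I v y - I v' y\<bar> \<le> L * ?D / K * exp (K * y)" using y sub by (intro dI) auto
      ultimately have "\<bar>q y\<bar> * \<bar>I v y - I v' y\<bar> \<le> B * (L * ?D / K * exp (K * y))" using B by (intro mult_mono) auto
      then show "norm (q y * I v y - q y * I v' y) \<le> B * (L * ?D / K) * exp (K * y)"
        by (simp add: abs_mult mult.assoc flip: right_diff_distrib)
    qed (intro Henstock_Kurzweil_Integration.integrable_diff i)
    also have "\<dots> = B * (L * ?D / K) * (exp (K * x) - 1) / K"
      using x by (intro integral_unique expI) auto
    also have "\<dots> \<le> L * B / K\<^sup>2 * ?D * exp (K * x)"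
    proof -
      have "B * (L * ?D / K) / K * (exp (K * x) - 1) \<le> B * (L * ?D / K) / K * exp (K * x)"
        using B L K by (intro mult_left_mono) auto
      then show ?thesis by (simp add: power2_eq_square mult_ac)
    qed
    also have "\<dots> \<le> 1/2 * ?D * exp (K * x)" using K(2) by (intro mult_right_mono) auto
    finally have d: "\<bar>integral {0..x} (\<lambda>y. q y * I v y) - integral {0..x} (\<lambda>y. q y * I v' y)\<bar> \<le> 1/2 * ?D * exp (K * x)"
      by simp
    have "G v x - G v' x = exp (- (K * x)) * (integral {0..x} (\<lambda>y. q y * I v y) - integral {0..x} (\<lambda>y. q y * I v' y))"
      by (simp add: G_def algebra_simps)
    then have "\<bar>G v x - G v' x\<bar> = exp (- (K * x)) * \<bar>integral {0..x} (\<lambda>y. q y * I v y) - integral {0..x} (\<lambda>y. q y * I v' y)\<bar>"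
      by (simp add: abs_mult)
    also have "\<dots> \<le> exp (- (K * x)) * (1/2 * ?D * exp (K * x))" by (intro mult_left_mono d) auto
    also have "\<dots> = 1/2 * ?D * (exp (- (K * x)) * exp (K * x))" by (simp only: mult_ac)
    also have "exp (- (K * x)) * exp (K * x) = 1" by (simp add: mult_exp_exp)
    finally show ?thesis by simp
  qed
  have "\<exists>!v. T v = v"
  proof (rule banach_fix_type[of "1/2"])
    show "\<forall>v v'. dist (T v) (T v') \<le> 1/2 * dist v v'"
      by (intro allI dist_bound) (simp only: Tv dist_real_def lipG[OF c01])
  qed auto
  then obtain v where v: "T v = v" by blast
  define u where "u = (\<lambda>x. exp (K * x) * apply_bcontfun v x)"
  define w where "w = I v"
  have "flux_system q k a u w"
    unfolding flux_system_def
  proof (intro conjI ballI)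
    show "continuous_on {0..1} u" unfolding u_def by (rule cv)
    show "continuous_on {0..1} w" unfolding w_def by (rule cI)
    fix x :: real assume x: "x \<in> {0..1}"
    show "w x = integral {0..x} (\<lambda>y. k y (u y))" by (simp add: w_def I_def u_def)
    have "apply_bcontfun v x = G v x" using Tv[of v x] v cid[OF x] by simp
    then have "u x = exp (K * x) * exp (- (K * x)) * (a + integral {0..x} (\<lambda>y. q y * I v y))"
      by (simp add: u_def G_def)
    also have "exp (K * x) * exp (- (K * x)) = 1" by (simp add: mult_exp_exp)
    finally show "u x = a + integral {0..x} (\<lambda>y. q y * w y)" by (simp add: w_def)
  qed
  then show ?thesis by blast
qed

section \<open>Dependence on the coefficient and the initial value\<close>

lemma lipschitz_imp_continuous:
  fixes h :: "real \<Rightarrow> real"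
  assumes "\<And>s t. \<bar>h s - h t\<bar> \<le> L * \<bar>s - t\<bar>" "0 \<le> L"
  shows "continuous_on S h"
  by (rule lipschitz_on_continuous_on[of L], rule lipschitz_onI) (use assms in \<open>auto simp: dist_real_def\<close>)

lemma coefficient_diff_integrable:
  assumes "coefficient B q1" "coefficient B q2"
  shows "(\<lambda>x. \<bar>q1 x - q2 x\<bar>) absolutely_integrable_on {0..1}"
proof -
  have "q1 absolutely_integrable_on {0..1}" "q2 absolutely_integrable_on {0..1}"
    using coefficient_mult_integrable[OF assms(1) continuous_on_const[of _ 1]]
      coefficient_mult_integrable[OF assms(2) continuous_on_const[of _ 1]] by simp_all
  then have "(\<lambda>x. q1 x - q2 x) absolutely_integrable_on {0..1}" by (rule set_integral_diff(1))
  from absolutely_integrable_abs[OF this] show ?thesis by simp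
qed

lemma flux_bound:
  assumes f: "flux_system q k a u w" and q: "coefficient B q" and n: "0 \<le> B" "0 \<le> L" "0 \<le> H"
    and ck: "continuous_on {0..1} (\<lambda>x. k x (u x))" and k: "\<And>x s. x \<in> {0..1} \<Longrightarrow> \<bar>k x s\<bar> \<le> H + L * \<bar>s\<bar>"
    and x: "x \<in> {0..1}"
  shows "\<bar>u x\<bar> + \<bar>w x\<bar> \<le> (\<bar>a\<bar> + H) * exp (B + L)"
proof -
  have c: "continuous_on {0..1} u" "continuous_on {0..1} w" using f by (auto simp: flux_system_def)
  have "\<bar>u x\<bar> + \<bar>w x\<bar> \<le> (\<bar>a\<bar> + integral {0..1} (\<lambda>_::real. 0::real) + H) * exp (B + L)"
  proof (rule flux_perturbation[where ?r1.0="\<lambda>_. 0", OF c _ _ coefficient_mult_integrable[OF q c(2)] absolutely_integrable_continuous_real[OF ck]])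
    fix y :: real assume y: "y \<in> {0..1}"
    show "u y = a + integral {0..y} (\<lambda>y. q y * w y)" "w y = integral {0..y} (\<lambda>y. k y (u y))"
      using f y by (auto simp: flux_system_def)
    show "\<bar>q y * w y\<bar> \<le> B * \<bar>w y\<bar> + 0"
      using q y by (auto simp: abs_mult coefficient_def intro!: mult_right_mono)
    show "\<bar>k y (u y)\<bar> \<le> L * \<bar>u y\<bar> + H" using k[OF y, of "u y"] by simp
  qed (use n x in auto)
  then show ?thesis by simp
qed

text \<open>For equal coefficients this is Lipschitz dependence on the initial value and uniqueness; for equal initial values
it bounds the effect of the coefficient by its change in \<open>L\<^sup>1\<close>.\<close>

lemma flux_difference:
  assumes f1: "flux_system q1 (\<lambda>_. h) a1 u1 w1" and f2: "flux_system q2 (\<lambda>_. h) a2 u2 w2"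
    and q1: "coefficient B q1" and q2: "coefficient B q2" and n: "0 \<le> B" "0 \<le> L" "0 \<le> M"
    and lip: "\<And>s t. \<bar>h s - h t\<bar> \<le> L * \<bar>s - t\<bar>"
    and M: "\<And>x. x \<in> {0..1} \<Longrightarrow> \<bar>w2 x\<bar> \<le> M" and x: "x \<in> {0..1}"
  shows "\<bar>u1 x - u2 x\<bar> + \<bar>w1 x - w2 x\<bar> \<le> (\<bar>a1 - a2\<bar> + M * integral {0..1} (\<lambda>x. \<bar>q1 x - q2 x\<bar>)) * exp (B + L)"
proof -
  have c: "continuous_on {0..1} u1" "continuous_on {0..1} w1" "continuous_on {0..1} u2" "continuous_on {0..1} w2"
    using f1 f2 by (auto simp: flux_system_def)
  have ch: "continuous_on UNIV h" by (rule lipschitz_imp_continuous[OF lip n(2)])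
  have chu: "continuous_on {0..1} (\<lambda>x. h (u1 x))" "continuous_on {0..1} (\<lambda>x. h (u2 x))"
    by (rule continuous_on_compose2[OF ch]; use c in auto)+
  note i1 = coefficient_mult_integrable[OF q1 c(2)] and i2 = coefficient_mult_integrable[OF q2 c(4)]
  have sub: "h integrable_on {0..y}" if "h absolutely_integrable_on {0..1}" "y \<in> {0..1}" for h :: "real \<Rightarrow> real" and y
    using absolutely_integrable_on_subinterval[OF that(1), of 0 y] that(2) by (auto simp: absolutely_integrable_on_def)
  have "\<bar>u1 x - u2 x\<bar> + \<bar>w1 x - w2 x\<bar> \<le> (\<bar>a1 - a2\<bar> + integral {0..1} (\<lambda>x. M * \<bar>q1 x - q2 x\<bar>) + 0) * exp (B + L)"
  proof (rule flux_perturbation[where e="\<lambda>x. u1 x - u2 x" and g="\<lambda>x. w1 x - w2 x" and x=x and e'="\<lambda>y. q1 y * w1 y - q2 y * w2 y" and g'="\<lambda>y. h (u1 y) - h (u2 y)"])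
    show "(\<lambda>y. q1 y * w1 y - q2 y * w2 y) absolutely_integrable_on {0..1}" using i1 i2 by (rule set_integral_diff(1))
    show "(\<lambda>y. h (u1 y) - h (u2 y)) absolutely_integrable_on {0..1}"
      by (intro absolutely_integrable_continuous_real continuous_intros chu)
    show "(\<lambda>x. M * \<bar>q1 x - q2 x\<bar>) absolutely_integrable_on {0..1}"
      by (intro set_integrable_mult_right impI coefficient_diff_integrable[OF q1 q2])
    fix y :: real assume y: "y \<in> {0..1}"
    show "u1 y - u2 y = a1 - a2 + integral {0..y} (\<lambda>y. q1 y * w1 y - q2 y * w2 y)"
      using f1 f2 y Henstock_Kurzweil_Integration.integral_diff[OF sub[OF i1 y] sub[OF i2 y]] by (auto simp: flux_system_def)
    show "w1 y - w2 y = integral {0..y} (\<lambda>y. h (u1 y) - h (u2 y))"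
      using f1 f2 y Henstock_Kurzweil_Integration.integral_diff[OF
          sub[OF absolutely_integrable_continuous_real[OF chu(1)] y] sub[OF absolutely_integrable_continuous_real[OF chu(2)] y]]
      by (auto simp: flux_system_def)
    show "\<bar>q1 y * w1 y - q2 y * w2 y\<bar> \<le> B * \<bar>w1 y - w2 y\<bar> + M * \<bar>q1 y - q2 y\<bar>"
    proof -
      have "q1 y * w1 y - q2 y * w2 y = q1 y * (w1 y - w2 y) + w2 y * (q1 y - q2 y)" by (simp add: algebra_simps)
      also have "\<bar>\<dots>\<bar> \<le> \<bar>q1 y\<bar> * \<bar>w1 y - w2 y\<bar> + \<bar>w2 y\<bar> * \<bar>q1 y - q2 y\<bar>"
        by (rule order_trans[OF abs_triangle_ineq]) (simp add: abs_mult)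
      also have "\<dots> \<le> B * \<bar>w1 y - w2 y\<bar> + M * \<bar>q1 y - q2 y\<bar>"
        using q1 y M by (intro add_mono mult_right_mono) (auto simp: coefficient_def)
      finally show ?thesis .
    qed
    show "\<bar>h (u1 y) - h (u2 y)\<bar> \<le> L * \<bar>u1 y - u2 y\<bar> + 0" using lip by simp
  qed (use n x c in \<open>auto intro!: continuous_intros\<close>)
  then show ?thesis by simp
qed

text \<open>Difference quotients of the shooting function \<open>w(1)\<close> are compared with the solution \<open>\<psi>\<close> of the system linearised
at a reference solution \<open>u0\<close>, which may belong to another coefficient \<open>q0\<close>. The factor \<open>\<bar>a1 - a2\<bar>\<close> in front is
decisive: it makes the shooting functions monotone near a simple zero, uniformly in the coefficient, and it comes
from \<open>\<bar>u1 - u2\<bar> \<le> \<bar>a1 - a2\<bar> exp(B + L)\<close>.\<close>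

lemma flux_linearisation:
  assumes f1: "flux_system q (\<lambda>_. h) a1 u1 w1" and f2: "flux_system q (\<lambda>_. h) a2 u2 w2"
    and lin: "flux_system q0 (\<lambda>x s. h' (u0 x) * s) 1 \<phi> \<psi>"
    and q: "coefficient B q" and q0: "coefficient B q0" and n: "0 \<le> B" "0 \<le> L" "0 \<le> M" "0 \<le> K" "0 \<le> \<rho>"
    and lip: "\<And>s t. \<bar>h s - h t\<bar> \<le> L * \<bar>s - t\<bar>" and h': "\<And>s. \<bar>h' s\<bar> \<le> L" "continuous_on UNIV h'"
    and taylor: "\<And>r s t. \<bar>h s - h t - h' r * (s - t)\<bar> \<le> K * max \<bar>s - r\<bar> \<bar>t - r\<bar> * \<bar>s - t\<bar>"
    and u0: "continuous_on {0..1} u0"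
    and \<rho>: "\<And>x. x \<in> {0..1} \<Longrightarrow> \<bar>u1 x - u0 x\<bar> \<le> \<rho>" "\<And>x. x \<in> {0..1} \<Longrightarrow> \<bar>u2 x - u0 x\<bar> \<le> \<rho>"
    and M: "\<And>x. x \<in> {0..1} \<Longrightarrow> \<bar>\<psi> x\<bar> \<le> M"
  shows "\<bar>w1 1 - w2 1 - (a1 - a2) * \<psi> 1\<bar> \<le>
    \<bar>a1 - a2\<bar> * (M * integral {0..1} (\<lambda>x. \<bar>q x - q0 x\<bar>) + K * \<rho> * exp (B + L)) * exp (B + L)"
proof -
  let ?d = "a1 - a2" and ?E = "exp (B + L)"
  have c: "continuous_on {0..1} u1" "continuous_on {0..1} w1" "continuous_on {0..1} u2" "continuous_on {0..1} w2"
    "continuous_on {0..1} \<phi>" "continuous_on {0..1} \<psi>"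
    using f1 f2 lin by (auto simp: flux_system_def)
  have ch: "continuous_on UNIV h" by (rule lipschitz_imp_continuous[OF lip n(2)])
  have chu: "continuous_on {0..1} (\<lambda>x. h (u1 x))" "continuous_on {0..1} (\<lambda>x. h (u2 x))"
    by (rule continuous_on_compose2[OF ch]; use c in auto)+
  have ch': "continuous_on {0..1} (\<lambda>x. h' (u0 x))" by (rule continuous_on_compose2[OF h'(2) u0]) auto
  have cl: "continuous_on {0..1} (\<lambda>x. h' (u0 x) * \<phi> x)" by (intro continuous_intros ch' c)
  note i1 = coefficient_mult_integrable[OF q c(2)] and i2 = coefficient_mult_integrable[OF q c(4)]
    and i3 = coefficient_mult_integrable[OF q0 c(6)]
  note a1 = absolutely_integrable_continuous_real[OF chu(1)] and a2 = absolutely_integrable_continuous_real[OF chu(2)]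
    and a3 = absolutely_integrable_continuous_real[OF cl]
  have comb: "integral {0..y} (\<lambda>y. f y - g y - ?d * k y) = integral {0..y} f - integral {0..y} g - ?d * integral {0..y} k"
    if y: "y \<in> {0..1}" and i: "f absolutely_integrable_on {0..1}" "g absolutely_integrable_on {0..1}" "k absolutely_integrable_on {0..1}"
    for f g k :: "real \<Rightarrow> real" and y
  proof -
    have sub: "h integrable_on {0..y}" if "h absolutely_integrable_on {0..1}" for h :: "real \<Rightarrow> real"
      using absolutely_integrable_on_subinterval[OF that, of 0 y] y by (auto simp: absolutely_integrable_on_def)
    have "integral {0..y} (\<lambda>y. f y - g y - ?d * k y) = integral {0..y} (\<lambda>y. f y - g y) - integral {0..y} (\<lambda>y. ?d * k y)"
      by (intro Henstock_Kurzweil_Integration.integral_diff Henstock_Kurzweil_Integration.integrable_diff integrable_on_mult_right sub i)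
    then show ?thesis by (simp add: Henstock_Kurzweil_Integration.integral_diff[OF sub[OF i(1)] sub[OF i(2)]])
  qed
  have acomb: "(\<lambda>y. f y - g y - ?d * k y) absolutely_integrable_on {0..1}"
    if i: "f absolutely_integrable_on {0..1}" "g absolutely_integrable_on {0..1}" "k absolutely_integrable_on {0..1}"
    for f g k :: "real \<Rightarrow> real"
    by (intro set_integral_diff(1) set_integrable_mult_right impI i)
  have du: "\<bar>u1 y - u2 y\<bar> \<le> \<bar>?d\<bar> * ?E" if y: "y \<in> {0..1}" for y
  proof -
    have "bounded (w2 ` {0..1})" using c(4) compact_continuous_image compact_imp_bounded by blast
    then obtain M2 where M2: "\<forall>x\<in>{0..1}. \<bar>w2 x\<bar> \<le> M2" by (auto simp: bounded_iff)
    then have "0 \<le> M2" by (metis abs_ge_zero atLeastAtMost_iff order_trans order_refl zero_le_one)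
    from flux_difference[OF f1 f2 q q n(1,2) this lip _ y] M2 show ?thesis by auto
  qed
  let ?e = "\<lambda>x. u1 x - u2 x - ?d * \<phi> x" and ?g = "\<lambda>x. w1 x - w2 x - ?d * \<psi> x"
  \<comment> \<open>The equation for the error is the linearised equation with coefficient \<open>q\<close>, up to the change of coefficient in \<open>\<psi>\<close> and the Taylor remainder of \<open>h\<close>.\<close>
  have "\<bar>?e 1\<bar> + \<bar>?g 1\<bar> \<le> (\<bar>0\<bar> + integral {0..1} (\<lambda>x. \<bar>?d\<bar> * M * \<bar>q x - q0 x\<bar>) + K * \<rho> * (\<bar>?d\<bar> * ?E)) * ?E"
  proof (rule flux_perturbation[where e="?e" and g="?g" and x=1 and e'="\<lambda>y. q y * w1 y - q y * w2 y - ?d * (q0 y * \<psi> y)"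
        and g'="\<lambda>y. h (u1 y) - h (u2 y) - ?d * (h' (u0 y) * \<phi> y)"])
    show "continuous_on {0..1} ?e" "continuous_on {0..1} ?g" by (intro continuous_intros c)+
    show "(\<lambda>y. q y * w1 y - q y * w2 y - ?d * (q0 y * \<psi> y)) absolutely_integrable_on {0..1}" by (rule acomb[OF i1 i2 i3])
    show "(\<lambda>y. h (u1 y) - h (u2 y) - ?d * (h' (u0 y) * \<phi> y)) absolutely_integrable_on {0..1}" by (rule acomb[OF a1 a2 a3])
    show "(\<lambda>x. \<bar>?d\<bar> * M * \<bar>q x - q0 x\<bar>) absolutely_integrable_on {0..1}"
      by (intro set_integrable_mult_right impI coefficient_diff_integrable[OF q q0])
    fix y :: real assume y: "y \<in> {0..1}"
    show "?e y = 0 + integral {0..y} (\<lambda>y. q y * w1 y - q y * w2 y - ?d * (q0 y * \<psi> y))"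
      unfolding comb[OF y i1 i2 i3] using f1 f2 lin y by (auto simp: flux_system_def algebra_simps)
    show "?g y = integral {0..y} (\<lambda>y. h (u1 y) - h (u2 y) - ?d * (h' (u0 y) * \<phi> y))"
      unfolding comb[OF y a1 a2 a3] using f1 f2 lin y by (auto simp: flux_system_def)
    show "\<bar>q y * w1 y - q y * w2 y - ?d * (q0 y * \<psi> y)\<bar> \<le> B * \<bar>?g y\<bar> + \<bar>?d\<bar> * M * \<bar>q y - q0 y\<bar>"
    proof -
      have "q y * w1 y - q y * w2 y - ?d * (q0 y * \<psi> y) = q y * ?g y + ?d * \<psi> y * (q y - q0 y)" by (simp add: algebra_simps)
      also have "\<bar>\<dots>\<bar> \<le> \<bar>q y\<bar> * \<bar>?g y\<bar> + \<bar>?d\<bar> * \<bar>\<psi> y\<bar> * \<bar>q y - q0 y\<bar>"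
        by (rule order_trans[OF abs_triangle_ineq]) (simp add: abs_mult)
      also have "\<dots> \<le> B * \<bar>?g y\<bar> + \<bar>?d\<bar> * M * \<bar>q y - q0 y\<bar>"
        using q y M[OF y] by (intro add_mono mult_right_mono mult_left_mono) (auto simp: coefficient_def)
      finally show ?thesis .
    qed
    show "\<bar>h (u1 y) - h (u2 y) - ?d * (h' (u0 y) * \<phi> y)\<bar> \<le> L * \<bar>?e y\<bar> + K * \<rho> * (\<bar>?d\<bar> * ?E)"
    proof -
      have "h (u1 y) - h (u2 y) - ?d * (h' (u0 y) * \<phi> y) = h' (u0 y) * ?e y + (h (u1 y) - h (u2 y) - h' (u0 y) * (u1 y - u2 y))"
        by (simp add: algebra_simps)
      also have "\<bar>\<dots>\<bar> \<le> \<bar>h' (u0 y)\<bar> * \<bar>?e y\<bar> + \<bar>h (u1 y) - h (u2 y) - h' (u0 y) * (u1 y - u2 y)\<bar>"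
        by (rule order_trans[OF abs_triangle_ineq]) (simp add: abs_mult)
      also have "\<dots> \<le> L * \<bar>?e y\<bar> + K * \<rho> * (\<bar>?d\<bar> * ?E)"
      proof (intro add_mono mult_right_mono h'(1))
        have "\<bar>h (u1 y) - h (u2 y) - h' (u0 y) * (u1 y - u2 y)\<bar> \<le> K * max \<bar>u1 y - u0 y\<bar> \<bar>u2 y - u0 y\<bar> * \<bar>u1 y - u2 y\<bar>"
          by (rule taylor)
        also have "\<dots> \<le> K * \<rho> * (\<bar>?d\<bar> * ?E)"
          using \<rho>[OF y] du[OF y] n by (intro mult_mono mult_nonneg_nonneg) auto
        finally show "\<bar>h (u1 y) - h (u2 y) - h' (u0 y) * (u1 y - u2 y)\<bar> \<le> K * \<rho> * (\<bar>?d\<bar> * ?E)" .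
      qed simp
      finally show ?thesis .
    qed
  qed (use n in auto)
  then have "\<bar>?g 1\<bar> \<le> (\<bar>?d\<bar> * M * integral {0..1} (\<lambda>x. \<bar>q x - q0 x\<bar>) + K * \<rho> * (\<bar>?d\<bar> * ?E)) * ?E" by simp
  then show ?thesis by (simp add: algebra_simps)
qed

section \<open>A priori bounds\<close>

text \<open>Above the level \<open>R\<close> the flux increases, and a nonnegative flux keeps \<open>u\<close> above \<open>R\<close>; hence a solution that once
lies above \<open>R\<close> with nonnegative flux never returns and ends with positive flux.\<close>

lemma flux_escape_right:
  fixes u w q g :: "real \<Rightarrow> real"
  assumes ab: "a < b" and cu: "continuous_on {a..b} u" and cg: "continuous_on {a..b} g"
    and q: "\<And>x. x \<in> {a..b} \<Longrightarrow> 0 \<le> q x" and i: "(\<lambda>x. q x * w x) integrable_on {a..b}"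
    and inc: "\<And>y. y \<in> {a..b} \<Longrightarrow> u y - u a = integral {a..y} (\<lambda>x. q x * w x) \<and> w y - w a = integral {a..y} g"
    and pos: "\<And>x. x \<in> {a..b} \<Longrightarrow> R < u x \<Longrightarrow> 0 < g x"
    and start: "R < u a" "0 \<le> w a"
  shows "0 < w b"
proof -
  have ig: "g integrable_on {a..y}" if "y \<in> {a..b}" for y
    using that by (intro integrable_continuous_real continuous_on_subset[OF cg]) auto
  have above: "R < u x" if x: "x \<in> {a..b}" for x
  proof (rule ccontr)
    assume "\<not> R < u x"
    define S where "S = {y\<in>{a..b}. u y \<le> R}"
    have "S = {a..b} \<inter> u -` {..R}" by (auto simp: S_def)
    then have "closed S" using continuous_closed_preimage[OF cu closed_atLeastAtMost closed_atMost] by simp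
    moreover have "bounded S" by (rule bounded_subset[of "{a..b}"]) (auto simp: S_def)
    ultimately have "compact S" by (simp add: compact_eq_bounded_closed)
    moreover have "S \<noteq> {}" using x \<open>\<not> R < u x\<close> by (auto simp: S_def)
    ultimately obtain y where y: "y \<in> S" "\<forall>z\<in>S. y \<le> z" using compact_attains_inf[of S] by blast
    then have yab: "y \<in> {a..b}" "u y \<le> R" by (auto simp: S_def)
    have gpos: "0 \<le> g z" if "z \<in> {a..y} - {y}" for z
    proof -
      have "z \<notin> S" "z \<in> {a..b}" using y(2) that yab by auto
      then show ?thesis using pos[of z] by (auto simp: S_def)
    qed
    have wpos: "0 \<le> w z" if z: "z \<in> {a..y} - {y}" for z
    proof -
      have "0 \<le> integral {a..z} g"
        using z yab by (intro integral_nonneg ig gpos) auto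
      then show ?thesis using inc[of z] z yab start by simp
    qed
    \<comment> \<open>At the first time \<open>y\<close> at which \<open>u\<close> is back at \<open>R\<close>, the sign of the flux is known only before \<open>y\<close>.\<close>
    have "0 \<le> integral {a..y} (\<lambda>x. if x = y then 0 else q x * w x)"
    proof (rule integral_nonneg)
      have "(\<lambda>x. q x * w x) integrable_on {a..y}" using i yab by (rule_tac integrable_on_subinterval) auto
      then show "(\<lambda>x. if x = y then 0 else q x * w x) integrable_on {a..y}"
        by (rule integrable_spike_finite[of "{y}", rotated 2]) auto
      show "0 \<le> (if x = y then 0 else q x * w x)" if "x \<in> {a..y}" for x
        using that wpos[of x] q[of x] yab by auto
    qed
    also have "integral {a..y} (\<lambda>x. if x = y then 0 else q x * w x) = integral {a..y} (\<lambda>x. q x * w x)"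
      by (rule integral_spike[of "{y}"]) auto
    finally show False using inc[OF yab(1)] yab(2) start by simp
  qed
  have "continuous_on {a..b} g" by (rule cg)
  then obtain y where y: "y \<in> {a..b}" "\<And>z. z \<in> {a..b} \<Longrightarrow> g y \<le> g z"
    using continuous_attains_inf[of "{a..b}" g] ab by auto
  have gy: "0 < g y" using pos above y by auto
  have "integral {a..b} (\<lambda>_. g y) \<le> integral {a..b} g"
    by (rule integral_le) (use y ig[of b] ab in auto)
  moreover have "integral {a..b} (\<lambda>_. g y) = g y * (b - a)" using ab by simp
  moreover have "0 < g y * (b - a)" using gy ab by simp
  moreover have "w b - w a = integral {a..b} g" using inc[of b] ab by auto
  ultimately show ?thesis using start by linarith
qed

text \<open>If \<open>u(x) > R\<close>, then either \<open>w(x) \<ge> 0\<close> and the solution escapes to the right, or \<open>w(x) \<le> 0\<close> and the reflected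
solution, whose flux is \<open>-w(-t)\<close>, escapes. Both contradict \<open>w(0) = w(1) = 0\<close>.\<close>

lemma flux_upper_bound:
  assumes f: "flux_system q (\<lambda>_. h) a u w" "w 1 = 0" and q: "coefficient B q" and h: "continuous_on UNIV h"
    and pos: "\<And>s. R < s \<Longrightarrow> 0 < h s" and x: "x \<in> {0..1}"
  shows "u x \<le> R"
proof (rule ccontr)
  assume "\<not> u x \<le> R"
  then have ux: "R < u x" by simp
  have cu: "continuous_on {0..1} u" and cw: "continuous_on {0..1} w" using f by (auto simp: flux_system_def)
  have ch: "continuous_on {0..1} (\<lambda>t. h (u t))" by (rule continuous_on_compose2[OF h cu]) auto
  note inc = flux_system_increment(1)[OF f(1) q] flux_system_increment(2)[OF f(1) q _ _ _ ch]
  have i: "(\<lambda>t. q t * w t) integrable_on {s..t}" if "0 \<le> s" "t \<le> 1" for s t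
    using absolutely_integrable_on_subinterval[OF coefficient_mult_integrable[OF q cw], of s t] that
    by (auto simp: absolutely_integrable_on_def)
  have w0: "w 0 = 0" using f by (simp add: flux_system_def)
  show False
  proof (cases "0 \<le> w x \<and> x < 1")
    case True
    have "0 < w 1"
    proof (rule flux_escape_right[where a=x and b=1 and w=w and u=u and q=q and g="\<lambda>t. h (u t)" and R=R])
      show "x < 1" "R < u x" "0 \<le> w x" using True ux by auto
      show "continuous_on {x..1} u" "continuous_on {x..1} (\<lambda>t. h (u t))"
        using x cu ch by (auto elim: continuous_on_subset)
      show "(\<lambda>t. q t * w t) integrable_on {x..1}" using x by (intro i) auto
      show "0 \<le> q t" if "t \<in> {x..1}" for t using that x q by (auto simp: coefficient_def)
      show "u y - u x = integral {x..y} (\<lambda>t. q t * w t) \<and> w y - w x = integral {x..y} (\<lambda>t. h (u t))"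
        if "y \<in> {x..1}" for y using that x by (intro conjI inc) auto
      show "R < u t \<Longrightarrow> 0 < h (u t)" for t using pos by blast
    qed
    then show False using f(2) by simp
  next
    case False
    have x0: "0 < x" "w x \<le> 0"
      using False f(2) w0 x by (auto simp: not_le less_le)
    have "0 < - w (- 0)"
    proof (rule flux_escape_right[where a="-x" and b=0 and u="\<lambda>t. u (-t)" and w="\<lambda>t. - w (-t)" and q="\<lambda>t. q (-t)"
          and g="\<lambda>t. h (u (-t))" and R=R])
      show "-x < 0" "R < u (- (- x))" "0 \<le> - w (- (- x))" using x0 ux by auto
      have m: "uminus ` {-x..0} \<subseteq> {0..1}" using x by auto
      show "continuous_on {-x..0} (\<lambda>t. u (-t))" "continuous_on {-x..0} (\<lambda>t. h (u (-t)))"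
        using continuous_on_compose2[OF cu _ m] continuous_on_compose2[OF ch _ m]
        by (simp_all add: continuous_on_minus)
      have r: "integral {-x..y} (\<lambda>t. g (-t)) = integral {-y..x} g" for y and g :: "real \<Rightarrow> real"
        using Henstock_Kurzweil_Integration.integral_reflect_real[of x "-y" g] by simp
      have "(\<lambda>t. q t * w t) integrable_on {0..x}" using x by (intro i) auto
      then have "(\<lambda>t. q (-t) * w (-t)) integrable_on {-x..-0}"
        using Henstock_Kurzweil_Integration.integrable_reflect_real[where f="\<lambda>t. q t * w t" and b=x and a=0] by simp
      then have "(\<lambda>t. - (q (-t) * w (-t))) integrable_on {-x..0}" by (simp add: integrable_neg_iff)
      then show "(\<lambda>t. q (-t) * - w (-t)) integrable_on {-x..0}" by simp
      show "0 \<le> q (-t)" if "t \<in> {-x..0}" for t using that x q by (auto simp: coefficient_def)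
      show "u (-y) - u (-(-x)) = integral {-x..y} (\<lambda>t. q (-t) * - w (-t)) \<and> - w (-y) - - w (-(-x)) = integral {-x..y} (\<lambda>t. h (u (-t)))"
        if y: "y \<in> {-x..0}" for y
      proof -
        have "u x - u (-y) = integral {-y..x} (\<lambda>t. q t * w t)" "w x - w (-y) = integral {-y..x} (\<lambda>t. h (u t))"
          using x y by (auto intro!: inc)
        moreover have "integral {-x..y} (\<lambda>t. q (-t) * - w (-t)) = - integral {-y..x} (\<lambda>t. q t * w t)"
          using r[of y "\<lambda>t. q t * w t"] by simp
        ultimately show ?thesis using r[of y "\<lambda>t. h (u t)"] by simp
      qed
      show "R < u (-t) \<Longrightarrow> 0 < h (u (-t))" for t using pos by blast
    qed
    then show False using w0 by simp
  qed
qed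

lemma flux_bounded_by_sign:
  assumes f: "flux_system q (\<lambda>_. h) a u w" "w 1 = 0" and q: "coefficient B q" and h: "continuous_on UNIV h"
    and pos: "\<And>s. R < s \<Longrightarrow> 0 < h s" "\<And>s. s < - R \<Longrightarrow> h s < 0" and x: "x \<in> {0..1}"
  shows "\<bar>u x\<bar> \<le> R"
proof -
  have "u x \<le> R" by (rule flux_upper_bound[OF f q h pos(1) x])
  moreover have "- u x \<le> R"
  proof (rule flux_upper_bound[OF _ _ q _ _ x])
    show "flux_system q (\<lambda>_ s. - h (- s)) (- a) (\<lambda>x. - u x) (\<lambda>x. - w x)"
      using f by (auto simp: flux_system_def intro!: continuous_intros)
    show "continuous_on UNIV (\<lambda>s. - h (- s))"
      by (intro continuous_intros continuous_on_compose2[OF h]) auto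
    show "R < s \<Longrightarrow> 0 < - h (- s)" for s using pos(2)[of "-s"] by simp
  qed (use f in simp)
  ultimately show ?thesis by simp
qed

section \<open>Truncation of the nonlinearity\<close>

lemma exists_antiderivative:
  fixes g :: "real \<Rightarrow> real"
  assumes g: "continuous_on UNIV g"
  obtains A where "\<And>s. (A has_real_derivative g s) (at s)" "A 0 = 0"
proof
  define A where "A = (\<lambda>s. integral {0..s} g - integral {s..0} g)"
  have i: "g integrable_on {a..b}" for a b by (intro integrable_continuous_real continuous_on_subset[OF g]) auto
  show "(A has_real_derivative g s) (at s)" for s
  proof -
    define N where "N = \<bar>s\<bar> + 1"
    have N: "0 < N" "-N < s" "s < N" by (auto simp: N_def)
    have eq: "integral {-N..t} g - integral {-N..0} g = A t" if "t \<in> {-N<..<N}" for t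
    proof (cases "0 \<le> t")
      case True
      then have "integral {-N..0} g + integral {0..t} g = integral {-N..t} g"
        using N by (intro Henstock_Kurzweil_Integration.integral_combine i) auto
      moreover have "integral {t..0} g = 0" using True by (cases "t = 0") auto
      ultimately show ?thesis by (simp add: A_def)
    next
      case False
      then have "integral {-N..t} g + integral {t..0} g = integral {-N..0} g"
        using N that by (intro Henstock_Kurzweil_Integration.integral_combine i) auto
      then show ?thesis using False by (simp add: A_def)
    qed
    have "((\<lambda>t. integral {-N..t} g) has_real_derivative g s) (at s within {-N..N})"
      using N by (intro integral_has_real_derivative continuous_on_subset[OF g]) auto
    then have "((\<lambda>t. integral {-N..t} g) has_real_derivative g s) (at s)"
      using N at_within_Icc_at[of "-N" s N] by auto
    then have "((\<lambda>t. integral {-N..t} g - integral {-N..0} g) has_real_derivative g s) (at s)"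
      by (auto intro!: derivative_eq_intros)
    then show ?thesis
      by (rule has_field_derivative_transform_within_open[where S="{-N<..<N}"]) (use N eq in auto)
  qed
  show "A 0 = 0" by (simp add: A_def)
qed

lemma mean_value_between:
  fixes h h' :: "real \<Rightarrow> real"
  assumes "\<And>s. (h has_real_derivative h' s) (at s)"
  obtains z where "min s t \<le> z" "z \<le> max s t" "h s - h t = h' z * (s - t)"
proof (cases s t rule: linorder_cases)
  case less
  obtain z where "s < z" "z < t" "h t - h s = (t - s) * h' z" using MVT2[OF less, of h h'] assms by blast
  then show thesis by (intro that[of z]) (auto simp: algebra_simps)
next
  case equal
  then show thesis by (intro that[of s]) auto
next
  case greater
  obtain z where "t < z" "z < s" "h s - h t = (s - t) * h' z" using MVT2[OF greater, of h h'] assms by blast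
  then show thesis by (intro that[of z]) (auto simp: algebra_simps)
qed

text \<open>The condition on \<open>f\<close> makes \<open>H s = lam s - f s\<close> grow at least linearly with the sign of \<open>s\<close>. Continuing \<open>H\<close> linearly
from arbitrary points could destroy that sign. But \<open>H\<close> is unbounded on both sides, so the mean value theorem gives
points \<open>b1 < -R\<close> and \<open>b2 > R\<close> with \<open>H' \<ge> 0\<close>, and there the linear continuation keeps the sign.\<close>

lemma truncated_nonlinearity:
  fixes f :: "real \<Rightarrow> real" and lam :: real
  assumes f: "C2_on UNIV f" and lim: "Limsup at_infinity (\<lambda>s. ereal (f s / s)) < ereal lam"
  obtains R h h' L K where "0 < R" "0 \<le> L" "0 \<le> K"
    "\<And>s. \<bar>s\<bar> \<le> R \<Longrightarrow> h s = lam * s - f s" "\<And>s. \<bar>s\<bar> \<le> R \<Longrightarrow> h' s = lam - deriv f s"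
    "\<And>s t. \<bar>h s - h t\<bar> \<le> L * \<bar>s - t\<bar>" "\<And>s. \<bar>h' s\<bar> \<le> L" "continuous_on UNIV h'"
    "\<And>r s t. \<bar>h s - h t - h' r * (s - t)\<bar> \<le> K * max \<bar>s - r\<bar> \<bar>t - r\<bar> * \<bar>s - t\<bar>"
    "\<And>s. R < s \<Longrightarrow> 0 < h s" "\<And>s. s < - R \<Longrightarrow> h s < 0"
    "\<And>s. R < s \<Longrightarrow> 0 < lam * s - f s" "\<And>s. s < - R \<Longrightarrow> lam * s - f s < 0"
proof -
  obtain f' f'' where f': "\<And>x. (f has_real_derivative f' x) (at x)" and f'': "\<And>x. (f' has_real_derivative f'' x) (at x)"
    and cf'': "continuous_on UNIV f''" using f by (auto simp: C2_on_def)
  have df: "deriv f x = f' x" for x by (rule DERIV_imp_deriv[OF f'])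
  obtain l where l: "Limsup at_infinity (\<lambda>s. ereal (f s / s)) < ereal l" "ereal l < ereal lam"
    using ereal_dense2[OF lim] by auto
  then have "\<forall>\<^sub>F s in at_infinity. ereal (f s / s) < ereal l" by (intro Limsup_lessD)
  then obtain b0 where b0: "\<And>s. b0 \<le> norm s \<Longrightarrow> f s / s < l" by (auto simp: eventually_at_infinity)
  define R where "R = max b0 1"
  define \<mu> where "\<mu> = lam - l"
  have \<mu>: "0 < \<mu>" using l by (simp add: \<mu>_def)
  have R: "0 < R" "b0 \<le> R" by (auto simp: R_def)
  define H where "H = (\<lambda>s. lam * s - f s)"
  define H' where "H' = (\<lambda>s. lam - f' s)"
  have dH: "(H has_real_derivative H' s) (at s)" for s
    unfolding H_def H'_def by (auto intro!: derivative_eq_intros f')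
  have dH': "(H' has_real_derivative - f'' s) (at s)" for s
    unfolding H'_def by (auto intro!: derivative_eq_intros f'')
  have cH': "continuous_on S H'" for S using dH' by (meson DERIV_isCont continuous_at_imp_continuous_on)
  have up: "\<mu> * s < H s" if "R \<le> s" for s
  proof -
    have "f s / s < l" "0 < s" using b0[of s] that R by auto
    then show ?thesis by (simp add: field_simps H_def \<mu>_def)
  qed
  have lo: "H s < \<mu> * s" if "s \<le> - R" for s
  proof -
    have "f s / s < l" "s < 0" using b0[of s] that R by auto
    then show ?thesis by (simp add: field_simps H_def \<mu>_def)
  qed
  have "\<exists>b2. R < b2 \<and> 0 \<le> H' b2"
  proof -
    define S where "S = max (R + 1) (H R / \<mu>)"
    have "H R \<le> \<mu> * S" using \<mu> by (simp add: S_def field_simps max_def)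
    moreover have RS: "R < S" by (simp add: S_def)
    ultimately have "H R < H S" using up[of S] by linarith
    with RS obtain z where z: "R < z" "H S - H R = (S - R) * H' z" using MVT2[OF RS, of H H'] dH by blast
    then have "0 < H' z" using \<open>H R < H S\<close> RS by (metis diff_gt_0_iff_gt zero_less_mult_pos)
    then show ?thesis using z by (intro exI[of _ z]) auto
  qed
  then obtain b2 where b2: "R < b2" "0 \<le> H' b2" by blast
  have "\<exists>b1. b1 < - R \<and> 0 \<le> H' b1"
  proof -
    define S where "S = min (- R - 1) (H (- R) / \<mu>)"
    have "\<mu> * S \<le> H (- R)" using \<mu> by (simp add: S_def field_simps min_def)
    moreover have RS: "S < - R" by (simp add: S_def)
    ultimately have "H S < H (- R)" using lo[of S] by linarith
    with RS obtain z where z: "z < - R" "H (- R) - H S = (- R - S) * H' z" using MVT2[OF RS, of H H'] dH by blast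
    then have "0 < H' z" using \<open>H S < H (- R)\<close> RS by (metis diff_gt_0_iff_gt zero_less_mult_pos)
    then show ?thesis using z by (intro exI[of _ z]) auto
  qed
  then obtain b1 where b1: "b1 < - R" "0 \<le> H' b1" by blast
  define c where "c = (\<lambda>s. max b1 (min b2 s))"
  have c: "c s \<in> {b1..b2}" "\<bar>c s - c t\<bar> \<le> \<bar>s - t\<bar>" for s t using b1 b2 R by (auto simp: c_def)
  have cid: "c s = s" if "s \<in> {b1..b2}" for s using that by (auto simp: c_def)
  \<comment> \<open>Freezing the derivative outside \<open>[b1,b2]\<close> is the linear continuation of \<open>H\<close>; it is bounded, Lipschitz continuous and integrates to a \<open>C\<^sup>1\<close> function.\<close>
  define h' where "h' = (\<lambda>s. H' (c s))"
  have ch': "continuous_on UNIV h'"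
    unfolding h'_def by (rule continuous_on_compose2[OF cH']) (auto simp: c_def intro!: continuous_intros)
  obtain A where A: "\<And>s. (A has_real_derivative h' s) (at s)" "A 0 = 0" using exists_antiderivative[OF ch'] by blast
  define h where "h = (\<lambda>s. H 0 + A s)"
  have dh: "(h has_real_derivative h' s) (at s)" for s
    unfolding h_def by (auto intro!: derivative_eq_intros A(1))
  have hH: "h s = H s" if s: "s \<in> {b1..b2}" for s
  proof -
    have d0: "((\<lambda>s. h s - H s) has_real_derivative 0) (at t)" if "t \<in> {b1..b2}" for t
      using DERIV_diff[OF dh[of t] dH[of t]] cid[OF that] by (simp add: h'_def)
    have "continuous_on {b1..b2} (\<lambda>s. h s - H s)"
      using d0 by (meson DERIV_isCont continuous_at_imp_continuous_on)
    then have *: "t \<in> {b1..b2} \<Longrightarrow> h t - H t = h b1 - H b1" for t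
      using b1 b2 R by (intro DERIV_isconst2[of b1 b2 "\<lambda>s. h s - H s"]) (auto intro!: d0)
    from *[of 0] *[OF s] show ?thesis using b1 b2 R by (simp add: h_def A(2))
  qed
  have "bounded (H' ` {b1..b2})" using compact_continuous_image[OF cH'] compact_imp_bounded compact_Icc by blast
  then obtain L where L: "\<And>s. s \<in> {b1..b2} \<Longrightarrow> \<bar>H' s\<bar> \<le> L" unfolding bounded_iff by (metis image_eqI real_norm_def)
  have "bounded (f'' ` {b1..b2})"
    using compact_continuous_image[OF continuous_on_subset[OF cf'']] compact_imp_bounded compact_Icc by blast
  then obtain K where K: "\<And>s. s \<in> {b1..b2} \<Longrightarrow> \<bar>f'' s\<bar> \<le> K" unfolding bounded_iff by (metis image_eqI real_norm_def)
  have b12: "b1 \<in> {b1..b2}" using b1 b2 R by auto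
  have L0: "0 \<le> L" "0 \<le> K" using L[OF b12] K[OF b12] by auto
  have h'L: "\<bar>h' s\<bar> \<le> L" for s unfolding h'_def by (rule L[OF c(1)])
  have h'K: "\<bar>h' s - h' t\<bar> \<le> K * \<bar>s - t\<bar>" for s t
  proof -
    obtain z where z: "min (c s) (c t) \<le> z" "z \<le> max (c s) (c t)" "H' (c s) - H' (c t) = - f'' z * (c s - c t)"
      using mean_value_between[of H' "\<lambda>s. - f'' s"] dH' by blast
    have "z \<in> {b1..b2}" using z(1,2) c(1)[of s] c(1)[of t] by auto
    then have "\<bar>f'' z\<bar> * \<bar>c s - c t\<bar> \<le> K * \<bar>s - t\<bar>" using K c(2) L0 by (intro mult_mono) auto
    then show ?thesis unfolding h'_def z(3) by (simp add: abs_mult)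
  qed
  have Hu: "0 < lam * s - f s" if "R < s" for s
  proof -
    have "0 < \<mu> * s" using \<mu> R that by simp
    then show ?thesis using up[of s] that by (simp add: H_def)
  qed
  have Hl: "lam * s - f s < 0" if "s < - R" for s
  proof -
    have "\<mu> * s < 0" using \<mu> R that by (simp add: mult_pos_neg)
    then show ?thesis using lo[of s] that by (simp add: H_def)
  qed
  show thesis
  proof (rule that[of R L K h h'])
    show "0 < R" "0 \<le> L" "0 \<le> K" by (rule R L0)+
    fix r s t :: real
    have sb: "s \<in> {b1..b2}" if "\<bar>s\<bar> \<le> R" using that b1 b2 by auto
    show "\<bar>s\<bar> \<le> R \<Longrightarrow> h s = lam * s - f s" using hH[OF sb] by (simp add: H_def)
    show "\<bar>s\<bar> \<le> R \<Longrightarrow> h' s = lam - deriv f s" using cid[OF sb] by (simp add: h'_def H'_def df)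
    show "\<bar>h' s\<bar> \<le> L" by (rule h'L)
    show "continuous_on UNIV h'" by (rule ch')
    obtain z where z: "min s t \<le> z" "z \<le> max s t" "h s - h t = h' z * (s - t)"
      using mean_value_between[of h h'] dh by blast
    show "\<bar>h s - h t\<bar> \<le> L * \<bar>s - t\<bar>" unfolding z(3) abs_mult by (intro mult_right_mono h'L) simp
    have "\<bar>z - r\<bar> \<le> max \<bar>s - r\<bar> \<bar>t - r\<bar>" using z(1,2) by auto
    then have "\<bar>h' z - h' r\<bar> \<le> K * max \<bar>s - r\<bar> \<bar>t - r\<bar>"
      using h'K[of z r] L0 by (meson mult_left_mono order_trans)
    then have "\<bar>h' z - h' r\<bar> * \<bar>s - t\<bar> \<le> K * max \<bar>s - r\<bar> \<bar>t - r\<bar> * \<bar>s - t\<bar>" by (intro mult_right_mono) auto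
    then show "\<bar>h s - h t - h' r * (s - t)\<bar> \<le> K * max \<bar>s - r\<bar> \<bar>t - r\<bar> * \<bar>s - t\<bar>"
      unfolding z(3) by (simp add: abs_mult flip: left_diff_distrib)
    show "R < s \<Longrightarrow> 0 < lam * s - f s" by (rule Hu)
    show "s < - R \<Longrightarrow> lam * s - f s < 0" by (rule Hl)
    show "0 < h s" if "R < s"
    proof (cases "s \<le> b2")
      case True
      then have "s \<in> {b1..b2}" using that b1 R by auto
      from hH[OF this] show ?thesis using Hu[OF that] by (simp add: H_def)
    next
      case False
      have "h b2 \<le> h s"
      proof (rule DERIV_nonneg_imp_nondecreasing[where f=h and a=b2 and b=s])
        fix x assume "b2 \<le> x"
        then have "c x = b2" using b1 b2 R by (auto simp: c_def)
        then have "0 \<le> h' x" using b2 by (simp add: h'_def)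
        then show "\<exists>y. (h has_real_derivative y) (at x) \<and> 0 \<le> y" using dh by blast
      qed (use False in simp)
      moreover have "h b2 = H b2" using b1 b2 R by (intro hH) auto
      ultimately show ?thesis using Hu[OF b2(1)] by (simp add: H_def)
    qed
    show "h s < 0" if "s < - R"
    proof (cases "b1 \<le> s")
      case True
      then have "s \<in> {b1..b2}" using that b2 R by auto
      from hH[OF this] show ?thesis using Hl[OF that] by (simp add: H_def)
    next
      case False
      have "h s \<le> h b1"
      proof (rule DERIV_nonneg_imp_nondecreasing[where f=h and a=s and b=b1])
        fix x assume "x \<le> b1"
        then have "c x = b1" using b1 b2 R by (auto simp: c_def)
        then have "0 \<le> h' x" using b1 by (simp add: h'_def)
        then show "\<exists>y. (h has_real_derivative y) (at x) \<and> 0 \<le> y" using dh by blast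
      qed (use False in simp)
      moreover have "h b1 = H b1" using b1 b2 R by (intro hH) auto
      ultimately show ?thesis using Hl[OF b1(1)] by (simp add: H_def)
    qed
  qed
qed

section \<open>Persistence of simple zeros\<close>

lemma finite_common_lower_bound:
  fixes m :: "'a \<Rightarrow> real"
  assumes "finite Z" "\<And>z. z \<in> Z \<Longrightarrow> 0 < m z"
  obtains c where "0 < c" "\<And>z. z \<in> Z \<Longrightarrow> c \<le> m z"
proof
  show "0 < Min (insert 1 (m ` Z))" using assms by (subst Min_gr_iff) auto
  show "Min (insert 1 (m ` Z)) \<le> m z" if "z \<in> Z" for z using assms(1) that by (intro Min_le) auto
qed

text \<open>The hypothesis \<open>strict\<close> says that near a zero \<open>z\<close> of \<open>F 0\<close> all functions \<open>F \<epsilon>\<close> with \<open>\<delta> \<epsilon>\<close> small are strictly monotone,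
with the same direction and a common lower bound for the slope. So \<open>z\<close> is isolated, \<open>F \<epsilon>\<close> has at most one
zero near \<open>z\<close>, and one exists by the intermediate value theorem; its distance from \<open>z\<close> is at most
\<open>\<bar>F \<epsilon> z\<bar>\<close> divided by the slope. Away from the zeros, \<open>\<bar>F 0\<bar>\<close> is bounded below by compactness.
The unperturbed function is the member \<open>\<epsilon> = 0\<close> of the family, with \<open>\<delta> 0 = 0\<close>, so that \<open>strict\<close> covers it too.\<close>

lemma perturbed_simple_zeros:
  fixes F :: "real \<Rightarrow> real \<Rightarrow> real" and \<delta> :: "real \<Rightarrow> real"
  assumes e0: "0 < \<epsilon>0" and C: "0 \<le> C1"
    and cF: "\<And>\<epsilon>. \<epsilon> \<in> {0..\<epsilon>0} \<Longrightarrow> continuous_on {-(R+1)..R+1} (F \<epsilon>)"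
    and zF: "\<And>\<epsilon> a. \<epsilon> \<in> {0..\<epsilon>0} \<Longrightarrow> F \<epsilon> a = 0 \<Longrightarrow> \<bar>a\<bar> \<le> R"
    and close: "\<And>\<epsilon> a. \<epsilon> \<in> {0..\<epsilon>0} \<Longrightarrow> \<bar>a\<bar> \<le> R + 1 \<Longrightarrow> \<bar>F \<epsilon> a - F 0 a\<bar> \<le> C1 * \<delta> \<epsilon>"
    and \<delta>: "\<delta> 0 = 0" "\<And>\<epsilon>. 0 \<le> \<delta> \<epsilon>" "(\<delta> \<longlongrightarrow> 0) (at_right 0)"
    and strict: "\<And>z. F 0 z = 0 \<Longrightarrow> \<exists>D K. D \<noteq> 0 \<and> (\<forall>\<epsilon>\<in>{0..\<epsilon>0}. \<forall>a b. \<bar>a\<bar> \<le> R + 1 \<longrightarrow> \<bar>b\<bar> \<le> R + 1 \<longrightarrow>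
        \<bar>F \<epsilon> a - F \<epsilon> b - (a - b) * D\<bar> \<le> \<bar>a - b\<bar> * (K * (\<delta> \<epsilon> + \<bar>a - z\<bar> + \<bar>b - z\<bar>)))"
  shows "finite {a. F 0 a = 0}"
    and "\<exists>C>0. \<exists>\<epsilon>1\<in>{0<..\<epsilon>0}. \<exists>\<zeta>. \<forall>\<epsilon>\<in>{0<..\<epsilon>1}.
      bij_betw (\<zeta> \<epsilon>) {a. F 0 a = 0} {a. F \<epsilon> a = 0} \<and> (\<forall>z. F 0 z = 0 \<longrightarrow> \<bar>\<zeta> \<epsilon> z - z\<bar> \<le> C * \<delta> \<epsilon>)"
proof -
  define Z where "Z = {a. F 0 a = 0}"
  have ZR: "\<bar>z\<bar> \<le> R" if "z \<in> Z" for z using zF[of 0 z] e0 that by (auto simp: Z_def)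
  define P where "P = (\<lambda>z \<sigma> m s. \<bar>\<sigma>\<bar> = (1::real) \<and> 0 < m \<and> 0 < s \<and> s \<le> 1 \<and> (\<forall>\<epsilon>\<in>{0..\<epsilon>0}. \<delta> \<epsilon> \<le> s \<longrightarrow>
      (\<forall>a b. z - s \<le> b \<and> b \<le> a \<and> a \<le> z + s \<longrightarrow> m * (a - b) \<le> \<sigma> * (F \<epsilon> a - F \<epsilon> b))))"
  have "\<exists>\<sigma> m s. P z \<sigma> m s" if z: "z \<in> Z" for z
  proof -
    from z have "F 0 z = 0" by (simp add: Z_def)
    from strict[OF this] obtain D K where D: "D \<noteq> 0" and K0: "\<forall>\<epsilon>\<in>{0..\<epsilon>0}. \<forall>a b. \<bar>a\<bar> \<le> R + 1 \<longrightarrow> \<bar>b\<bar> \<le> R + 1 \<longrightarrow>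
        \<bar>F \<epsilon> a - F \<epsilon> b - (a - b) * D\<bar> \<le> \<bar>a - b\<bar> * (K * (\<delta> \<epsilon> + \<bar>a - z\<bar> + \<bar>b - z\<bar>))"
      by blast
    have K: "\<bar>F \<epsilon> a - F \<epsilon> b - (a - b) * D\<bar> \<le> \<bar>a - b\<bar> * (K * (\<delta> \<epsilon> + \<bar>a - z\<bar> + \<bar>b - z\<bar>))"
      if "\<epsilon> \<in> {0..\<epsilon>0}" "\<bar>a\<bar> \<le> R + 1" "\<bar>b\<bar> \<le> R + 1" for \<epsilon> a b using K0 that by blast
    define K1 where "K1 = max K 1"
    have K1: "0 < K1" "K \<le> K1" by (auto simp: K1_def)
    \<comment> \<open>Then the error term \<open>K (\<delta> + \<bar>a - z\<bar> + \<bar>b - z\<bar>) \<le> 3 K1 s\<close> takes away at most half of the slope \<open>\<bar>D\<bar>\<close>.\<close>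
    define s where "s = min 1 (\<bar>D\<bar> / (6 * K1))"
    have s: "0 < s" "s \<le> 1" using D K1 by (auto simp: s_def)
    have "s \<le> \<bar>D\<bar> / (6 * K1)" by (simp add: s_def)
    then have sK: "K1 * (3 * s) \<le> \<bar>D\<bar> / 2" using K1 by (simp add: field_simps)
    have "\<bar>D\<bar> / 2 * (a - b) \<le> sgn D * (F \<epsilon> a - F \<epsilon> b)"
      if h: "\<epsilon> \<in> {0..\<epsilon>0}" "\<delta> \<epsilon> \<le> s" "z - s \<le> b" "b \<le> a" "a \<le> z + s" for \<epsilon> a b
    proof -
      have ab: "\<bar>a - z\<bar> \<le> s" "\<bar>b - z\<bar> \<le> s" using h by auto
      then have R1: "\<bar>a\<bar> \<le> R + 1" "\<bar>b\<bar> \<le> R + 1" using ZR[OF z] s by auto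
      have "K * (\<delta> \<epsilon> + \<bar>a - z\<bar> + \<bar>b - z\<bar>) \<le> K1 * (\<delta> \<epsilon> + \<bar>a - z\<bar> + \<bar>b - z\<bar>)"
        using K1 \<delta>(2) by (intro mult_right_mono) auto
      also have "\<dots> \<le> K1 * (3 * s)" using K1 ab h by (intro mult_left_mono) auto
      finally have "K * (\<delta> \<epsilon> + \<bar>a - z\<bar> + \<bar>b - z\<bar>) \<le> \<bar>D\<bar> / 2" using sK by simp
      moreover have ab': "\<bar>a - b\<bar> = a - b" using h by simp
      ultimately have "\<bar>a - b\<bar> * (K * (\<delta> \<epsilon> + \<bar>a - z\<bar> + \<bar>b - z\<bar>)) \<le> (a - b) * (\<bar>D\<bar> / 2)"
        unfolding ab' using h by (intro mult_left_mono) auto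
      with K[OF h(1) R1] have e: "\<bar>F \<epsilon> a - F \<epsilon> b - (a - b) * D\<bar> \<le> (a - b) * (\<bar>D\<bar> / 2)" by linarith
      have "\<bar>sgn D * (F \<epsilon> a - F \<epsilon> b) - (a - b) * \<bar>D\<bar>\<bar> = \<bar>sgn D\<bar> * \<bar>F \<epsilon> a - F \<epsilon> b - (a - b) * D\<bar>"
        unfolding abs_mult[symmetric] by (simp add: right_diff_distrib abs_sgn mult_ac)
      also have "\<dots> = \<bar>F \<epsilon> a - F \<epsilon> b - (a - b) * D\<bar>" using D by (simp add: abs_sgn_eq)
      finally have "\<bar>sgn D * (F \<epsilon> a - F \<epsilon> b) - (a - b) * \<bar>D\<bar>\<bar> \<le> (a - b) * (\<bar>D\<bar> / 2)" using e by simp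
      note e2 = this
      have half: "T \<le> X" if "\<bar>X - Y\<bar> \<le> T" "Y = 2 * T" for X Y T :: real using that by linarith
      have "(a - b) * (\<bar>D\<bar> / 2) \<le> sgn D * (F \<epsilon> a - F \<epsilon> b)" by (rule half[OF e2]) simp
      then show ?thesis by (simp only: mult.commute)
    qed
    moreover have "\<bar>sgn D\<bar> = 1" using D by (simp add: abs_sgn_eq)
    ultimately show ?thesis using s D unfolding P_def by (intro exI[of _ "sgn D"] exI[of _ "\<bar>D\<bar> / 2"] exI[of _ s]) auto
  qed
  then obtain \<sigma> m s where "\<And>z. z \<in> Z \<Longrightarrow> P z (\<sigma> z) (m z) (s z)" by metis
  then have loc: "\<And>z. z \<in> Z \<Longrightarrow> \<bar>\<sigma> z\<bar> = (1::real)" "\<And>z. z \<in> Z \<Longrightarrow> 0 < m z" "\<And>z. z \<in> Z \<Longrightarrow> 0 < s z"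
    "\<And>z. z \<in> Z \<Longrightarrow> s z \<le> 1"
    "\<And>z \<epsilon> a b. z \<in> Z \<Longrightarrow> \<epsilon> \<in> {0..\<epsilon>0} \<Longrightarrow> \<delta> \<epsilon> \<le> s z \<Longrightarrow> z - s z \<le> b \<Longrightarrow> b \<le> a \<Longrightarrow> a \<le> z + s z \<Longrightarrow>
       m z * (a - b) \<le> \<sigma> z * (F \<epsilon> a - F \<epsilon> b)" unfolding P_def by blast+
  have uniq: "a = b" if "z \<in> Z" "\<epsilon> \<in> {0..\<epsilon>0}" "\<delta> \<epsilon> \<le> s z" "\<bar>a - z\<bar> \<le> s z" "\<bar>b - z\<bar> \<le> s z" "F \<epsilon> a = 0" "F \<epsilon> b = 0" for z \<epsilon> a b
  proof -
    have "\<not> b < a" if "\<bar>a - z\<bar> \<le> s z" "\<bar>b - z\<bar> \<le> s z" "F \<epsilon> a = 0" "F \<epsilon> b = 0" for a b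
    proof
      assume "b < a"
      then have "0 < m z * (a - b)" using loc(2)[OF \<open>z \<in> Z\<close>] by simp
      moreover have "m z * (a - b) \<le> \<sigma> z * (F \<epsilon> a - F \<epsilon> b)"
        using \<open>z \<in> Z\<close> \<open>\<epsilon> \<in> {0..\<epsilon>0}\<close> \<open>\<delta> \<epsilon> \<le> s z\<close> \<open>b < a\<close> that by (intro loc(5)) auto
      ultimately show False using that by simp
    qed
    from this[OF that(4,5,6,7)] this[OF that(5,4,7,6)] show ?thesis by simp
  qed
  have c0: "continuous_on {-(R+1)..R+1} (F 0)" using cF[of 0] e0 by simp
  have "finite ({-R..R} \<inter> Z)"
  proof (rule finite_not_islimpt_in_compact)
    fix y assume y: "y \<in> {-R..R}"
    show "\<not> y islimpt Z"
    proof
      assume lim: "y islimpt Z"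
      have "Z \<subseteq> {a\<in>{-(R+1)..R+1}. F 0 a = 0}" using ZR by (force simp: Z_def)
      then have lim': "y islimpt {a\<in>{-(R+1)..R+1}. F 0 a = 0}" using lim islimpt_subset by blast
      have eq: "{a\<in>{-(R+1)..R+1}. F 0 a = 0} = {-(R+1)..R+1} \<inter> F 0 -` {0}" by auto
      have "closed {a\<in>{-(R+1)..R+1}. F 0 a = 0}" unfolding eq
        by (rule continuous_closed_preimage[OF c0]) auto
      then have "y \<in> {a\<in>{-(R+1)..R+1}. F 0 a = 0}" using lim' unfolding closed_limpt by (elim allE impE)
      then have "F 0 y = 0" by simp
      then have yZ: "y \<in> Z" by (simp add: Z_def)
      obtain z where z: "z \<in> Z" "z \<noteq> y" "dist z y < s y"
        using lim loc(3)[OF yZ] unfolding islimpt_approachable by blast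
      have "z = y"
      proof (rule uniq[OF yZ, of 0])
        show "\<delta> 0 \<le> s y" using \<delta>(1) loc(3)[OF yZ] by simp
        show "\<bar>z - y\<bar> \<le> s y" using z(3) by (simp add: dist_real_def)
        show "\<bar>y - y\<bar> \<le> s y" using loc(3)[OF yZ] by simp
      qed (use z yZ e0 in \<open>auto simp: Z_def\<close>)
      then show False using z by simp
    qed
  qed auto
  moreover have "{-R..R} \<inter> Z = Z" using ZR by force
  ultimately have fin: "finite Z" by simp
  then show "finite {a. F 0 a = 0}" by (simp add: Z_def)
  obtain m0 where m0: "0 < m0" "\<And>z. z \<in> Z \<Longrightarrow> m0 \<le> m z" using finite_common_lower_bound[where m=m, OF fin loc(2)] by blast
  obtain s0 where s0: "0 < s0" "\<And>z. z \<in> Z \<Longrightarrow> s0 \<le> s z" using finite_common_lower_bound[where m=s, OF fin loc(3)] by blast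
  \<comment> \<open>With half the isolation radius, two different zeros of \<open>F 0\<close> cannot share a perturbed zero.\<close>
  define r where "r = s0 / 2"
  have r: "0 < r" "r \<le> s0" using s0 by (auto simp: r_def)
  have low: "m0 * (a - b) \<le> \<sigma> z * (F \<epsilon> a - F \<epsilon> b)"
    if "z \<in> Z" "\<epsilon> \<in> {0..\<epsilon>0}" "\<delta> \<epsilon> \<le> s0" "z - r \<le> b" "b \<le> a" "a \<le> z + r" for z \<epsilon> a b
  proof -
    have "m0 * (a - b) \<le> m z * (a - b)" using m0(2)[OF that(1)] that by (intro mult_right_mono) auto
    also have "\<dots> \<le> \<sigma> z * (F \<epsilon> a - F \<epsilon> b)" using that s0(2)[OF that(1)] r by (intro loc(5)) auto
    finally show ?thesis .
  qed
  define A where "A = {-R..R} - (\<Union>z\<in>Z. ball z r)"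
  have "compact A" unfolding A_def by (intro compact_diff open_UN) auto
  have cA: "continuous_on A (\<lambda>a. \<bar>F 0 a\<bar>)"
    by (intro continuous_intros continuous_on_subset[OF c0]) (auto simp: A_def)
  have A0: "0 < \<bar>F 0 a\<bar>" if "a \<in> A" for a
  proof -
    have "a \<notin> Z" using that r by (force simp: A_def)
    then show ?thesis by (simp add: Z_def)
  qed
  obtain c where c: "0 < c" "\<And>a. a \<in> A \<Longrightarrow> c \<le> \<bar>F 0 a\<bar>"
  proof (cases "A = {}")
    case True then show thesis using that[of 1] by auto
  next
    case False
    obtain a where "a \<in> A" "\<forall>b\<in>A. \<bar>F 0 a\<bar> \<le> \<bar>F 0 b\<bar>"
      using continuous_attains_inf[OF \<open>compact A\<close> False cA] by blast
    then show thesis using that[of "\<bar>F 0 a\<bar>"] A0 by auto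
  qed
  define \<eta> where "\<eta> = min s0 (min (m0 * r / (C1 + 1)) (c / (C1 + 1)))"
  have \<eta>: "0 < \<eta>" using s0 m0 r c C by (auto simp: \<eta>_def)
  have \<eta>s: "\<eta> \<le> s0" "C1 * \<eta> < m0 * r" "C1 * \<eta> < c"
  proof -
    show "\<eta> \<le> s0" by (simp add: \<eta>_def)
    have "\<eta> \<le> m0 * r / (C1 + 1)" "\<eta> \<le> c / (C1 + 1)" by (auto simp: \<eta>_def)
    then have "(C1 + 1) * \<eta> \<le> m0 * r" "(C1 + 1) * \<eta> \<le> c" using C by (auto simp: field_simps)
    then show "C1 * \<eta> < m0 * r" "C1 * \<eta> < c" using \<eta> by (auto simp: distrib_right)
  qed
  have "\<forall>\<^sub>F \<epsilon> in at_right 0. \<delta> \<epsilon> < \<eta>" using order_tendstoD(2)[OF \<delta>(3) \<eta>] .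
  then obtain b where b: "0 < b" "\<And>\<epsilon>. 0 < \<epsilon> \<Longrightarrow> \<epsilon> < b \<Longrightarrow> \<delta> \<epsilon> < \<eta>"
    unfolding eventually_at_right_field by auto
  define \<epsilon>1 where "\<epsilon>1 = min \<epsilon>0 (b / 2)"
  have e1: "\<epsilon>1 \<in> {0<..\<epsilon>0}" using e0 b by (auto simp: \<epsilon>1_def)
  have small: "\<delta> \<epsilon> < \<eta>" "\<epsilon> \<in> {0..\<epsilon>0}" if "\<epsilon> \<in> {0<..\<epsilon>1}" for \<epsilon>
    using that b by (auto simp: \<epsilon>1_def)
  define C2 where "C2 = C1 / m0 + 1"
  have C2: "0 < C2" using C m0 by (simp add: C2_def add_nonneg_pos)
  have main: "\<exists>\<xi>. \<bar>\<xi> - z\<bar> \<le> C2 * \<delta> \<epsilon> \<and> \<bar>\<xi> - z\<bar> \<le> r \<and> F \<epsilon> \<xi> = 0" if z: "z \<in> Z" and \<epsilon>: "\<epsilon> \<in> {0<..\<epsilon>1}" for z \<epsilon>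
  proof -
    note sm = small[OF \<epsilon>]
    have ds: "\<delta> \<epsilon> \<le> s0" using sm \<eta>s by simp
    have zR: "\<bar>z\<bar> \<le> R" by (rule ZR[OF z])
    have rs: "r \<le> 1" using r s0(2)[OF z] loc(4)[OF z] by simp
    have Fz: "\<bar>F \<epsilon> z\<bar> \<le> C1 * \<delta> \<epsilon>" using close[OF sm(2), of z] zR z by (simp add: Z_def)
    define G where "G = (\<lambda>a. \<sigma> z * F \<epsilon> a)"
    have sg: "\<bar>\<sigma> z * t\<bar> = \<bar>t\<bar>" for t using loc(1)[OF z] by (simp add: abs_mult)
    have Cd: "C1 * \<delta> \<epsilon> < m0 * r"
    proof -
      have "C1 * \<delta> \<epsilon> \<le> C1 * \<eta>" using sm C by (intro mult_left_mono) auto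
      then show ?thesis using \<eta>s by simp
    qed
    have Gz: "\<bar>G z\<bar> \<le> C1 * \<delta> \<epsilon>" using Fz by (simp add: G_def sg)
    have "m0 * (z + r - z) \<le> G (z + r) - G z" "m0 * (z - (z - r)) \<le> G z - G (z - r)"
      using low[OF z sm(2) ds, of z "z + r"] low[OF z sm(2) ds, of "z - r" z] r by (auto simp: G_def right_diff_distrib)
    then have "0 \<le> G (z + r)" "G (z - r) \<le> 0" using Gz Cd by auto
    moreover have "continuous_on {z - r..z + r} G" unfolding G_def
      using zR rs by (intro continuous_intros continuous_on_subset[OF cF[OF sm(2)]]) auto
    ultimately obtain \<xi> where \<xi>: "z - r \<le> \<xi>" "\<xi> \<le> z + r" "G \<xi> = 0"
      using IVT'[of G "z - r" 0 "z + r"] r by auto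
    have F0: "F \<epsilon> \<xi> = 0" using \<xi>(3) loc(1)[OF z] by (auto simp: G_def)
    have "m0 * \<bar>\<xi> - z\<bar> \<le> \<bar>G \<xi> - G z\<bar>"
    proof (cases "z \<le> \<xi>")
      case True
      have "m0 * (\<xi> - z) \<le> G \<xi> - G z"
        using low[OF z sm(2) ds, of z \<xi>] r \<xi> True by (auto simp: G_def right_diff_distrib)
      then show ?thesis using True by simp
    next
      case False
      have "m0 * (z - \<xi>) \<le> G z - G \<xi>"
        using low[OF z sm(2) ds, of \<xi> z] r \<xi> False by (auto simp: G_def right_diff_distrib)
      then show ?thesis using False by simp
    qed
    also have "\<dots> \<le> C1 * \<delta> \<epsilon>" using \<xi>(3) Gz by simp
    finally have "\<bar>\<xi> - z\<bar> \<le> C1 / m0 * \<delta> \<epsilon>" using m0 by (simp add: field_simps)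
    also have "\<dots> \<le> C2 * \<delta> \<epsilon>" using \<delta>(2) by (intro mult_right_mono) (auto simp: C2_def)
    finally show ?thesis using \<xi> F0 by (intro exI[of _ \<xi>]) auto
  qed
  define \<zeta> where "\<zeta> = (\<lambda>\<epsilon> z. SOME \<xi>. \<bar>\<xi> - z\<bar> \<le> C2 * \<delta> \<epsilon> \<and> \<bar>\<xi> - z\<bar> \<le> r \<and> F \<epsilon> \<xi> = 0)"
  have \<zeta>: "\<bar>\<zeta> \<epsilon> z - z\<bar> \<le> C2 * \<delta> \<epsilon> \<and> \<bar>\<zeta> \<epsilon> z - z\<bar> \<le> r \<and> F \<epsilon> (\<zeta> \<epsilon> z) = 0"
    if "z \<in> Z" "\<epsilon> \<in> {0<..\<epsilon>1}" for z \<epsilon>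
    unfolding \<zeta>_def by (rule someI_ex[OF main[OF that]])
  have "bij_betw (\<zeta> \<epsilon>) Z {a. F \<epsilon> a = 0}" if \<epsilon>: "\<epsilon> \<in> {0<..\<epsilon>1}" for \<epsilon>
  proof (rule bij_betw_imageI)
    note sm = small[OF \<epsilon>]
    show "inj_on (\<zeta> \<epsilon>) Z"
    proof (rule inj_onI)
      fix y z assume yz: "y \<in> Z" "z \<in> Z" and eq: "\<zeta> \<epsilon> y = \<zeta> \<epsilon> z"
      have "\<bar>y - z\<bar> \<le> s z" 
      proof -
        have "\<bar>\<zeta> \<epsilon> z - y\<bar> \<le> s0 / 2" "\<bar>\<zeta> \<epsilon> z - z\<bar> \<le> s0 / 2"
          using \<zeta>[OF yz(1) \<epsilon>] \<zeta>[OF yz(2) \<epsilon>] eq by (simp_all add: r_def)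
        then show ?thesis using s0(2)[OF yz(2)] by linarith
      qed
      then show "y = z"
        using uniq[OF yz(2), of 0 y z] \<delta>(1) loc(3)[OF yz(2)] yz e0 by (auto simp: Z_def)
    qed
    show "\<zeta> \<epsilon> ` Z = {a. F \<epsilon> a = 0}"
    proof (intro equalityI subsetI)
      fix a assume "a \<in> \<zeta> \<epsilon> ` Z" then show "a \<in> {a. F \<epsilon> a = 0}" using \<zeta> \<epsilon> by auto
    next
      fix a assume "a \<in> {a. F \<epsilon> a = 0}"
      then have Fa: "F \<epsilon> a = 0" by simp
      then have aR: "\<bar>a\<bar> \<le> R" by (rule zF[OF sm(2)])
      have "\<bar>F 0 a\<bar> \<le> C1 * \<delta> \<epsilon>" using close[OF sm(2), of a] aR Fa by simp
      also have "\<dots> \<le> C1 * \<eta>" using sm C by (intro mult_left_mono) auto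
      finally have "\<bar>F 0 a\<bar> < c" using \<eta>s by simp
      then have "a \<notin> A" using c(2)[of a] by auto
      then obtain z where z: "z \<in> Z" "a \<in> ball z r" using aR by (auto simp: A_def)
      have "a = \<zeta> \<epsilon> z"
      proof (rule uniq[OF z(1) sm(2)])
        show "\<delta> \<epsilon> \<le> s z" using sm \<eta>s s0(2)[OF z(1)] by simp
        show "\<bar>a - z\<bar> \<le> s z" using z(2) r s0(2)[OF z(1)] by (auto simp: dist_real_def)
        show "\<bar>\<zeta> \<epsilon> z - z\<bar> \<le> s z" using \<zeta>[OF z(1) \<epsilon>] r s0(2)[OF z(1)] by auto
      qed (use Fa \<zeta>[OF z(1) \<epsilon>] in auto)
      then show "a \<in> \<zeta> \<epsilon> ` Z" using z(1) by blast
    qed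
  qed
  then show "\<exists>C>0. \<exists>\<epsilon>1\<in>{0<..\<epsilon>0}. \<exists>\<zeta>. \<forall>\<epsilon>\<in>{0<..\<epsilon>1}.
      bij_betw (\<zeta> \<epsilon>) {a. F 0 a = 0} {a. F \<epsilon> a = 0} \<and> (\<forall>z. F 0 z = 0 \<longrightarrow> \<bar>\<zeta> \<epsilon> z - z\<bar> \<le> C * \<delta> \<epsilon>)"
  proof (intro exI[of _ C2] conjI bexI[of _ \<epsilon>1] exI[of _ \<zeta>] ballI allI impI)
    fix \<epsilon> z assume "\<epsilon> \<in> {0<..\<epsilon>1}"
    then show "F 0 z = 0 \<Longrightarrow> \<bar>\<zeta> \<epsilon> z - z\<bar> \<le> C2 * \<delta> \<epsilon>" using \<zeta>[of z \<epsilon>] by (simp add: Z_def)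
  qed (use C2 e1 in \<open>simp_all add: Z_def\<close>)
qed

section \<open>Distance of coefficients and of solutions\<close>

text \<open>The norm is the real number attached to an extended real essential supremum, so its properties depend on that
supremum being neither \<open>\<infinity>\<close> nor \<open>-\<infinity>\<close>: continuity on a compact set excludes the first, and \<open>\<Omega>\<^sub>1\<close> not being a null
set excludes the second.\<close>

lemma Linf_norm_bounds:
  assumes x: "0 < x1" "x1 < x2" "x2 < 1" and g: "continuous_on (Om1 x1 x2) g"
  shows "AE x in lebesgue_on (Om1 x1 x2). \<bar>g x\<bar> \<le> Linf_norm (Om1 x1 x2) g"
    and "0 \<le> Linf_norm (Om1 x1 x2) g"
    and "(\<And>x. x \<in> Om1 x1 x2 \<Longrightarrow> \<bar>g x\<bar> \<le> c) \<Longrightarrow> Linf_norm (Om1 x1 x2) g \<le> c"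
proof -
  let ?S = "Om1 x1 x2"
  let ?M = "lebesgue_on ?S" and ?f = "\<lambda>x. ereal \<bar>g x\<bar>"
  let ?e = "esssup ?M ?f"
  have S: "?S \<in> sets lebesgue" by auto
  have K: "compact ?S" by (intro compact_Un compact_Icc)
  have m: "?f \<in> borel_measurable ?M"
    using continuous_imp_measurable_on_sets_lebesgue[OF g S] by measurable
  have ae: "AE x in ?M. ?f x \<le> ?e" by (rule esssup_AE)
  have up: "?e \<le> ereal c" if "\<And>x. x \<in> ?S \<Longrightarrow> \<bar>g x\<bar> \<le> c" for c
    by (rule esssup_I[OF m], rule AE_I2) (use that in \<open>simp del: Un_iff atLeastAtMost_iff\<close>)
  have nz: "emeasure ?M (space ?M) \<noteq> 0"
  proof
    assume "emeasure ?M (space ?M) = 0"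
    then have "emeasure lebesgue ?S = 0" by (simp add: emeasure_restrict_space)
    then have "?S \<in> null_sets lebesgue" using S by (simp add: null_sets_def)
    then have "negligible ?S" by (simp only: negligible_iff_null_sets)
    then have "negligible {0..x1}" by (rule negligible_subset) auto
    then show False using x negligible_interval(1)[of 0 x1] by simp
  qed
  have "esssup ?M (\<lambda>_. 0::ereal) \<le> ?e" by (rule esssup_mono) auto
  then have e0: "0 \<le> ?e" using esssup_const[OF nz, of "0::ereal"] by simp
  have "bounded (g ` ?S)" using compact_continuous_image[OF g K] compact_imp_bounded by blast
  then obtain c0 where c0: "\<And>x. x \<in> ?S \<Longrightarrow> \<bar>g x\<bar> \<le> c0" unfolding bounded_iff by (metis image_eqI real_norm_def)
  have er: "?e = ereal (Linf_norm ?S g)"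
    using up[OF c0] e0 unfolding Linf_norm_def by (cases ?e) auto
  show "0 \<le> Linf_norm ?S g" using e0 er by simp
  show "AE x in ?M. \<bar>g x\<bar> \<le> Linf_norm ?S g" using ae unfolding er by simp
  show "Linf_norm ?S g \<le> c" if "\<And>x. x \<in> ?S \<Longrightarrow> \<bar>g x\<bar> \<le> c" using up[OF that] er by simp
qed

text \<open>On \<open>\<Omega>\<^sub>1\<close> the reciprocals differ by at most \<open>d / m\<^sup>2\<close>. On \<open>\<Omega>\<^sub>0\<close> the limit is \<open>0\<close>, and \<open>1 / p\<close> is at most \<open>\<epsilon>\<close> except on
two intervals of length \<open>\<epsilon>\<close>, where it is at most \<open>1 / m\<close>.\<close>

lemma coefficient_L1_distance:
  assumes x: "0 < x1" "x1 < x2" "x2 < 1" and m: "0 < m"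
    and p: "continuous_on {0..1} p" "\<And>x. x \<in> {0..1} \<Longrightarrow> m \<le> p x"
    and p0: "continuous_on (Om1 x1 x2) p0" "\<And>x. x \<in> Om1 x1 x2 \<Longrightarrow> m \<le> p0 x"
    and \<epsilon>: "0 < \<epsilon>" "\<And>x. x \<in> {x1 + \<epsilon>..x2 - \<epsilon>} \<Longrightarrow> 1 / \<epsilon> \<le> p x"
    and d: "AE x in lebesgue_on (Om1 x1 x2). \<bar>p x - p0 x\<bar> \<le> d" "0 \<le> d"
  shows "integral {0..1} (\<lambda>x. \<bar>1 / p x - limit_coefficient x1 x2 p0 x\<bar>) \<le> (1 / m\<^sup>2 + 1 + 2 / m) * (d + \<epsilon>)"
proof -
  let ?q = "limit_coefficient x1 x2 p0"
  define N where "N = {x\<in>Om1 x1 x2. \<not> \<bar>p x - p0 x\<bar> \<le> d}"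
  have N: "negligible N" using d(1) unfolding N_def by (subst (asm) AE_lebesgue_on_iff_negligible) auto
  let ?g = "\<lambda>x. \<bar>1 / p x - ?q x\<bar>"
  let ?c = "\<lambda>S x::real. if x \<in> S then 1 / m else 0"
  let ?b = "\<lambda>x. (d / m\<^sup>2 + \<epsilon>) + (?c {x1..x1+\<epsilon>} x + ?c {x2-\<epsilon>..x2} x)"
  have ig: "?g integrable_on {0..1}"
    using coefficient_diff_integrable[OF coefficient_inverse[OF p m] limit_coefficient[OF x p0 m]]
    by (simp add: absolutely_integrable_on_def)
  have ic: "(?c {s..t}) integrable_on {0..1} \<and> integral {0..1} (?c {s..t}) \<le> \<epsilon> / m" if "t - s \<le> \<epsilon>" for s t
  proof
    have eq: "{s..t} \<inter> {0..1} = {max s 0..min t 1}" by auto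
    have "(\<lambda>x. 1 / m) integrable_on {max s 0..min t 1}" by (rule integrable_const_ivl)
    then show "(?c {s..t}) integrable_on {0..1}" unfolding eq[symmetric] by (rule integrable_restrict_Int[THEN iffD2])
    have "integral {0..1} (?c {s..t}) = integral {max s 0..min t 1} (\<lambda>x. 1 / m)"
      unfolding Henstock_Kurzweil_Integration.integral_restrict_Int eq by simp
    also have "\<dots> = (1 / m) * (if max s 0 \<le> min t 1 then min t 1 - max s 0 else 0)" by simp
    also have "\<dots> \<le> (1 / m) * \<epsilon>" using that m \<epsilon>(1) by (intro mult_left_mono) (auto simp: max_def min_def)
    finally show "integral {0..1} (?c {s..t}) \<le> \<epsilon> / m" by simp
  qed
  note i1 = ic[of "x1+\<epsilon>" x1] and i2 = ic[of x2 "x2-\<epsilon>"]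
  have i12: "(\<lambda>x. ?c {x1..x1+\<epsilon>} x + ?c {x2-\<epsilon>..x2} x) integrable_on {0..1}"
    using i1 i2 by (intro Henstock_Kurzweil_Integration.integrable_add) auto
  have ib: "?b integrable_on {0..1}" by (intro Henstock_Kurzweil_Integration.integrable_add integrable_const_ivl i12)
  have "integral {0..1} ?g = integral {0..1} (\<lambda>x. if x \<in> N then 0 else ?g x)"
    by (rule integral_spike[OF N]) auto
  also have "\<dots> \<le> integral {0..1} ?b"
  proof (rule integral_le[OF _ ib])
    show "(\<lambda>x. if x \<in> N then 0 else ?g x) integrable_on {0..1}" by (rule integrable_spike[OF ig N]) auto
    fix x :: real assume x': "x \<in> {0..1}"
    have c0: "0 \<le> ?c {x1..x1+\<epsilon>} x" "0 \<le> ?c {x2-\<epsilon>..x2} x" using m by auto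
    have b0: "0 \<le> d / m\<^sup>2 + \<epsilon>" using d(2) \<epsilon>(1) by simp
    have px: "m \<le> p x" by (rule p(2)[OF x'])
    show "(if x \<in> N then 0 else ?g x) \<le> ?b x"
    proof (cases "x \<in> N")
      case True then show ?thesis using c0 b0 by simp
    next
      case False
      have "?g x \<le> ?b x"
      proof (cases "x \<in> Om1 x1 x2")
        case True
        then have dx: "\<bar>p x - p0 x\<bar> \<le> d" using False unfolding N_def by blast
        have p0x: "m \<le> p0 x" by (rule p0(2)[OF True])
        have q: "?q x = 1 / p0 x" using True unfolding limit_coefficient_def by (simp only: if_True)
        have "1 / p x - 1 / p0 x = (p0 x - p x) / (p x * p0 x)" using px p0x m by (simp add: field_simps)
        then have "?g x = \<bar>p x - p0 x\<bar> / (p x * p0 x)" unfolding q using px p0x m by (simp add: abs_minus_commute abs_mult)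
        also have "\<dots> \<le> d / m\<^sup>2"
          using dx px p0x m d(2) by (intro frac_le) (auto simp: power2_eq_square intro!: mult_mono)
        finally show ?thesis using c0 \<epsilon>(1) by linarith
      next
        case out: False
        then have q: "?q x = 0" unfolding limit_coefficient_def by (simp only: if_False)
        have gq: "?g x = 1 / p x" unfolding q using px m by simp
        have pm: "1 / p x \<le> 1 / m" using px m by (intro divide_left_mono) auto
        have Om0: "x1 < x" "x < x2" using out x' by auto
        consider "x \<in> {x1..x1+\<epsilon>}" | "x \<in> {x2-\<epsilon>..x2}" | "x \<in> {x1+\<epsilon>..x2-\<epsilon>}" using Om0 by force
        then show ?thesis
        proof cases
          case 1
          then have "?c {x1..x1+\<epsilon>} x = 1 / m" by simp
          then show ?thesis using gq pm c0 b0 by linarith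
        next
          case 2
          then have "?c {x2-\<epsilon>..x2} x = 1 / m" by simp
          then show ?thesis using gq pm c0 b0 by linarith
        next
          case 3
          then have "1 / \<epsilon> \<le> p x" by (rule \<epsilon>(2))
          then have "1 / p x \<le> \<epsilon>" using \<epsilon>(1) px m by (simp add: field_simps)
          moreover have "0 \<le> d / m\<^sup>2" using d(2) by simp
          ultimately show ?thesis using gq c0 by linarith
        qed
      qed
      then show ?thesis using False by simp
    qed
  qed
  also have "integral {0..1} ?b = (d / m\<^sup>2 + \<epsilon>) + integral {0..1} (\<lambda>x. ?c {x1..x1+\<epsilon>} x + ?c {x2-\<epsilon>..x2} x)"
    by (subst Henstock_Kurzweil_Integration.integral_add[OF integrable_const_ivl i12]) simp
  also have "integral {0..1} (\<lambda>x. ?c {x1..x1+\<epsilon>} x + ?c {x2-\<epsilon>..x2} x) \<le> \<epsilon> / m + \<epsilon> / m"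
    using i1 i2 by (subst Henstock_Kurzweil_Integration.integral_add) auto
  also have "d / m\<^sup>2 + \<epsilon> + (\<epsilon> / m + \<epsilon> / m) \<le> (1 / m\<^sup>2 + 1 + 2 / m) * (d + \<epsilon>)"
  proof -
    have "0 \<le> \<epsilon> / m\<^sup>2" "0 \<le> d" "0 \<le> 2 / m * d" using m d(2) \<epsilon>(1) by auto
    then show ?thesis by (simp add: distrib_left distrib_right)
  qed
  finally show ?thesis by simp
qed

text \<open>With \<open>q = 1 / p\<close>, the energy density of the difference is \<open>p (q w - q\<^sub>0 w\<^sub>0)\<^sup>2 = q (w - p q\<^sub>0 w\<^sub>0)\<^sup>2\<close>. On \<open>\<Omega>\<^sub>1\<close> the
bracket is at most \<open>\<Delta> + d M / m\<close>. On \<open>\<Omega>\<^sub>0\<close> it is \<open>w\<close>, which is not small; there only the factor \<open>q = \<bar>q - q\<^sub>0\<bar>\<close> is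
small in the mean.\<close>

lemma X_norm_flux_difference:
  assumes x: "0 < x1" "x1 < x2" "x2 < 1" and m: "0 < m" and lam: "0 \<le> lam"
    and p: "continuous_on {0..1} p" "\<And>x. x \<in> {0..1} \<Longrightarrow> m \<le> p x"
    and p0: "continuous_on (Om1 x1 x2) p0" "\<And>x. x \<in> Om1 x1 x2 \<Longrightarrow> m \<le> p0 x"
    and d: "AE x in lebesgue_on (Om1 x1 x2). \<bar>p x - p0 x\<bar> \<le> d" "0 \<le> d"
    and f: "flux_system (\<lambda>x. 1 / p x) k a u w" and f0: "flux_system (limit_coefficient x1 x2 p0) k0 a0 u0 w0"
    and M: "\<And>x. x \<in> {0..1} \<Longrightarrow> \<bar>w x\<bar> \<le> M" "\<And>x. x \<in> {0..1} \<Longrightarrow> \<bar>w0 x\<bar> \<le> M"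
    and \<Delta>: "\<And>x. x \<in> {0..1} \<Longrightarrow> \<bar>w x - w0 x\<bar> \<le> \<Delta>" "\<And>x. x \<in> {0..1} \<Longrightarrow> \<bar>u x - u0 x\<bar> \<le> \<Delta>"
  shows "X_norm p lam (\<lambda>x. restrict u {0..1} x - restrict u0 {0..1} x) \<le>
    sqrt (1 / m * (\<Delta> + d * M / m)\<^sup>2 + M\<^sup>2 * integral {0..1} (\<lambda>x. \<bar>1 / p x - limit_coefficient x1 x2 p0 x\<bar>) + lam * \<Delta>\<^sup>2)"
proof -
  let ?q = "\<lambda>x. 1 / p x" and ?r = "limit_coefficient x1 x2 p0"
  let ?D = "\<lambda>x. restrict u {0..1} x - restrict u0 {0..1} x"
  have q: "coefficient (1/m) ?q" by (rule coefficient_inverse[OF p m])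
  have q0: "coefficient (1/m) ?r" by (rule limit_coefficient[OF x p0 m])
  note H = flux_system_H1[OF f q, of "1::real", simplified] and H0 = flux_system_H1[OF f0 q0, of "1::real", simplified]
  have wd: "AE x in lebesgue_on I01. wderiv I01 ?D x = w x / p x - ?r x * w0 x"
    using wderiv_AE_eq(1)[OF has_weak_derivative_diff[OF H(3) H0(3)]] by simp
  define N where "N = {x\<in>Om1 x1 x2. \<not> \<bar>p x - p0 x\<bar> \<le> d}"
  have "negligible N" using d(1) unfolding N_def by (subst (asm) AE_lebesgue_on_iff_negligible) auto
  then have "negligible {x\<in>I01. \<not> x \<notin> N}" by (rule negligible_subset) auto
  then have N: "AE x in lebesgue_on I01. x \<notin> N" by (subst AE_lebesgue_on_iff_negligible) auto
  let ?g = "\<lambda>x. \<bar>1 / p x - ?r x\<bar>" and ?A = "1 / m * (\<Delta> + d * M / m)\<^sup>2"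
  have ag: "?g absolutely_integrable_on {0..1}" by (rule coefficient_diff_integrable[OF q q0])
  have ab: "(\<lambda>x. ?A + M\<^sup>2 * ?g x) absolutely_integrable_on {0..1}"
    by (intro set_integral_add(1) set_integrable_mult_right impI ag absolutely_integrable_continuous_real continuous_intros)
  have A0: "0 \<le> ?A" using m by simp
  have "(LINT x|lebesgue_on I01. p x * wderiv I01 ?D x * wderiv I01 ?D x) \<le> (LINT x|lebesgue_on I01. ?A + M\<^sup>2 * ?g x)"
  proof (rule integral_mono_AE'[OF LINT_I01_eq(1)[OF ab]])
    show "AE x in lebesgue_on I01. 0 \<le> ?A + M\<^sup>2 * ?g x" using A0 by (intro AE_I2) auto
    show "AE x in lebesgue_on I01. p x * wderiv I01 ?D x * wderiv I01 ?D x \<le> ?A + M\<^sup>2 * ?g x"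
      using wd N AE_space[of "lebesgue_on I01"]
    proof eventually_elim
      case (elim x)
      then have x': "x \<in> {0..1}" by simp
      have px: "m \<le> p x" by (rule p(2)[OF x'])
      have g0: "0 \<le> M\<^sup>2 * ?g x" by simp
      show ?case
      proof (cases "x \<in> Om1 x1 x2")
        case True
        have dx: "\<bar>p x - p0 x\<bar> \<le> d" using True elim(2) unfolding N_def by blast
        have p0x: "m \<le> p0 x" by (rule p0(2)[OF True])
        have q0x: "?r x = 1 / p0 x" using True unfolding limit_coefficient_def by (simp only: if_True)
        define T where "T = (w x - w0 x) + (p0 x - p x) * w0 x / p0 x"
        have W: "wderiv I01 ?D x = T / p x" unfolding elim(1) q0x T_def using px p0x m by (simp add: field_simps)
        have "\<bar>(p0 x - p x) * w0 x / p0 x\<bar> = \<bar>p x - p0 x\<bar> * \<bar>w0 x\<bar> / p0 x"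
          using p0x m by (simp add: abs_mult abs_minus_commute)
        also have "\<dots> \<le> d * M / m"
          using dx M(2)[OF x'] p0x m d(2) by (intro frac_le mult_mono) auto
        finally have "\<bar>T\<bar> \<le> \<Delta> + d * M / m" using \<Delta>(1)[OF x'] unfolding T_def by linarith
        then have "T\<^sup>2 \<le> (\<Delta> + d * M / m)\<^sup>2" by (metis abs_ge_zero power2_abs power_mono)
        then have "T\<^sup>2 / p x \<le> (\<Delta> + d * M / m)\<^sup>2 / m" using px m by (intro frac_le) auto
        then have "T\<^sup>2 / p x \<le> ?A" by simp
        moreover have "p x * wderiv I01 ?D x * wderiv I01 ?D x = T\<^sup>2 / p x"
          unfolding W using px m by (simp add: power2_eq_square field_simps)
        ultimately show ?thesis using g0 by linarith
      next
        case False
        then have q0x: "?r x = 0" unfolding limit_coefficient_def by (simp only: if_False)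
        have W: "wderiv I01 ?D x = w x / p x" unfolding elim(1) q0x by simp
        have "p x * wderiv I01 ?D x * wderiv I01 ?D x = (w x)\<^sup>2 * (1 / p x)"
          unfolding W using px m by (simp add: power2_eq_square)
        also have "\<dots> \<le> M\<^sup>2 * (1 / p x)"
        proof (rule mult_right_mono)
          show "(w x)\<^sup>2 \<le> M\<^sup>2" using M(1)[OF x'] by (metis abs_ge_zero power2_abs power_mono)
        qed (use px m in simp)
        also have "1 / p x = ?g x" unfolding q0x using px m by simp
        finally show ?thesis using A0 by linarith
      qed
    qed
  qed
  also have "\<dots> = integral {0..1} (\<lambda>x. ?A + M\<^sup>2 * ?g x)" by (rule LINT_I01_eq(2)[OF ab])
  also have "\<dots> = integral {0..1} (\<lambda>x::real. ?A) + integral {0..1} (\<lambda>x. M\<^sup>2 * ?g x)"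
    using ag by (intro Henstock_Kurzweil_Integration.integral_add integrable_const_ivl integrable_on_mult_right)
      (simp add: absolutely_integrable_on_def)
  also have "\<dots> = ?A + M\<^sup>2 * integral {0..1} ?g" by simp
  finally have 1: "(LINT x|lebesgue_on I01. p x * wderiv I01 ?D x * wderiv I01 ?D x) \<le> ?A + M\<^sup>2 * integral {0..1} ?g" .
  have ac: "(\<lambda>x::real. lam * \<Delta>\<^sup>2) absolutely_integrable_on {0..1}"
    by (intro absolutely_integrable_continuous_real continuous_intros)
  have "(LINT x|lebesgue_on I01. lam * ?D x * ?D x) \<le> (LINT x|lebesgue_on I01. lam * \<Delta>\<^sup>2)"
  proof (rule integral_mono'[OF LINT_I01_eq(1)[OF ac]])
    fix x :: real assume "x \<in> space (lebesgue_on I01)"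
    then have x': "x \<in> {0..1}" by simp
    have "(u x - u0 x)\<^sup>2 \<le> \<Delta>\<^sup>2" using \<Delta>(2)[OF x'] by (metis abs_ge_zero power2_abs power_mono)
    then have "lam * (u x - u0 x)\<^sup>2 \<le> lam * \<Delta>\<^sup>2" using lam by (rule mult_left_mono)
    then show "lam * ?D x * ?D x \<le> lam * \<Delta>\<^sup>2" using x' by (simp add: power2_eq_square mult.assoc)
    show "0 \<le> lam * \<Delta>\<^sup>2" using lam by simp
  qed
  also have "\<dots> = integral {0..1} (\<lambda>x::real. lam * \<Delta>\<^sup>2)" by (rule LINT_I01_eq(2)[OF ac])
  also have "\<dots> = lam * \<Delta>\<^sup>2" by simp
  finally have 2: "(LINT x|lebesgue_on I01. lam * ?D x * ?D x) \<le> lam * \<Delta>\<^sup>2" .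
  show ?thesis unfolding X_norm_def X_inner_def using 1 2 by (intro real_sqrt_le_mono) linarith
qed

section \<open>Shooting for equilibria\<close>

lemma C2_on_imp_C1:
  assumes "C2_on S h"
  obtains h' where "\<And>x. x \<in> S \<Longrightarrow> (h has_real_derivative h' x) (at x within S)" "continuous_on S h'" "continuous_on S h"
proof -
  obtain h' h'' where h: "\<And>x. x \<in> S \<Longrightarrow> (h has_real_derivative h' x) (at x within S)"
    "\<And>x. x \<in> S \<Longrightarrow> (h' has_real_derivative h'' x) (at x within S)"
    using assms unfolding C2_on_def by blast
  show thesis by (rule that[OF h(1)]) (use DERIV_continuous_on[OF h(1)] DERIV_continuous_on[OF h(2)] in auto)
qed

lemma flux_system_cong:
  assumes "\<And>x. x \<in> {0..1} \<Longrightarrow> k x (u x) = k' x (u x)" "flux_system q k a u w"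
  shows "flux_system q k' a u w"
proof -
  have "integral {0..x} (\<lambda>y. k y (u y)) = integral {0..x} (\<lambda>y. k' y (u y))" if "x \<in> {0..1}" for x
    by (rule integral_cong) (use that assms(1) in auto)
  then show ?thesis using assms(2) by (auto simp: flux_system_def)
qed

lemma flux_system_unique:
  assumes f1: "flux_system q (\<lambda>_. h) a u1 w1" and f2: "flux_system q (\<lambda>_. h) a u2 w2"
    and q: "coefficient B q" and n: "0 \<le> B" "0 \<le> L" and lip: "\<And>s t. \<bar>h s - h t\<bar> \<le> L * \<bar>s - t\<bar>" and x: "x \<in> {0..1}"
  shows "u1 x = u2 x" "w1 x = w2 x"
proof -
  have "continuous_on {0..1} w2" using f2 by (simp add: flux_system_def)
  then have "bounded (w2 ` {0..1})" using compact_continuous_image compact_imp_bounded by blast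
  then obtain M where "\<forall>x\<in>{0..1}. \<bar>w2 x\<bar> \<le> M" by (auto simp: bounded_iff)
  then have M: "\<bar>w2 y\<bar> \<le> max M 0" if "y \<in> {0..1}" for y using that by (simp add: le_max_iff_disj)
  have "\<bar>u1 x - u2 x\<bar> + \<bar>w1 x - w2 x\<bar> \<le> (\<bar>a - a\<bar> + max M 0 * integral {0..1} (\<lambda>x. \<bar>q x - q x\<bar>)) * exp (B + L)"
    by (rule flux_difference[OF f1 f2 q q n _ lip M x]) simp
  then have "\<bar>u1 x - u2 x\<bar> + \<bar>w1 x - w2 x\<bar> \<le> 0" by simp
  then show "u1 x = u2 x" "w1 x = w2 x" by linarith+
qed

text \<open>The a priori bound holds for the original nonlinearity and for its truncation \<open>h\<close>. Both agree on \<open>[-R,R]\<close>, so they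
have the same solutions with \<open>w(1) = 0\<close>. The hypotheses \<open>fwd\<close> and \<open>bwd\<close> tie the operator to the flux system; they
are met by \<open>A\<^sub>\<epsilon>\<close> and by \<open>A\<^sub>0\<close>.\<close>

lemma equilibria_eq_shooting_zeros:
  fixes T :: "real operator" and f h :: "real \<Rightarrow> real"
  assumes q: "coefficient B q" and n: "0 \<le> B" "0 \<le> L" and lip: "\<And>s t. \<bar>h s - h t\<bar> \<le> L * \<bar>s - t\<bar>"
    and f: "continuous_on UNIV f"
    and fwd: "\<And>u. T u (\<lambda>x. f (u x)) \<Longrightarrow>
        u \<in> extensional {0..1} \<and> (\<exists>w. flux_system q (\<lambda>_ s. lam * s - f s) (u 0) u w \<and> w 1 = 0)"
    and bwd: "\<And>a u w. flux_system q (\<lambda>_ s. lam * s - f s) a u w \<Longrightarrow> w 1 = 0 \<Longrightarrow>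
        T (restrict u {0..1}) (\<lambda>x. f (restrict u {0..1} x))"
    and hf: "\<And>s. \<bar>s\<bar> \<le> R \<Longrightarrow> h s = lam * s - f s"
    and sh: "\<And>s. R < s \<Longrightarrow> 0 < h s" "\<And>s. s < - R \<Longrightarrow> h s < 0"
    and sf: "\<And>s. R < s \<Longrightarrow> 0 < lam * s - f s" "\<And>s. s < - R \<Longrightarrow> lam * s - f s < 0"
    and UW: "\<And>a. flux_system q (\<lambda>_. h) a (U a) (W a)"
  shows "equilibria T f = (\<lambda>a. restrict (U a) {0..1}) ` {a. W a 1 = 0}"
proof (intro equalityI subsetI)
  have ch: "continuous_on UNIV h" by (rule lipschitz_imp_continuous[OF lip n(2)])
  have cH: "continuous_on UNIV (\<lambda>s. lam * s - f s)" by (intro continuous_intros f)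
  {
    fix u assume "u \<in> equilibria T f"
    then have "T u (\<lambda>x. f (u x))" by (simp add: equilibria_def)
    from fwd[OF this] obtain w where ext: "u \<in> extensional {0..1}"
      and F: "flux_system q (\<lambda>_ s. lam * s - f s) (u 0) u w" "w 1 = 0" by blast
    have b: "\<bar>u x\<bar> \<le> R" if "x \<in> {0..1}" for x by (rule flux_bounded_by_sign[OF F q cH sf that])
    have F': "flux_system q (\<lambda>_. h) (u 0) u w"
      by (rule flux_system_cong[OF _ F(1)]) (use hf b in simp)
    note un = flux_system_unique[OF F' UW q n lip]
    have "u = restrict (U (u 0)) {0..1}"
    proof
      fix x show "u x = restrict (U (u 0)) {0..1} x"
        using un(1)[of x] ext by (cases "x \<in> {0..1}") (auto simp: extensional_def)
    qed
    moreover have "W (u 0) 1 = 0" using un(2)[of 1] F(2) by simp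
    ultimately show "u \<in> (\<lambda>a. restrict (U a) {0..1}) ` {a. W a 1 = 0}" by blast
  }
  fix u assume "u \<in> (\<lambda>a. restrict (U a) {0..1}) ` {a. W a 1 = 0}"
  then obtain a where a: "u = restrict (U a) {0..1}" "W a 1 = 0" by blast
  have b: "\<bar>U a x\<bar> \<le> R" if "x \<in> {0..1}" for x by (rule flux_bounded_by_sign[OF UW a(2) q ch sh that])
  have "flux_system q (\<lambda>_ s. lam * s - f s) a (U a) (W a)"
    by (rule flux_system_cong[OF _ UW]) (use hf b in simp)
  from bwd[OF this a(2)] show "u \<in> equilibria T f" by (simp add: equilibria_def a(1))
qed

text \<open>If \<open>\<psi>(1) = 0\<close>, then \<open>\<phi>\<close> and the zero function both solve \<open>(A\<^sub>0 - f'(u)) v = 0\<close>, so that \<open>0\<close> lies in the spectrum.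
They differ because \<open>\<phi>(0) = 1\<close>.\<close>

lemma hyperbolic_imp_transversal:
  fixes f :: "real \<Rightarrow> real"
  assumes x: "0 < x1" "x1 < x2" "x2 < 1" and p0: "continuous_on (Om1 x1 x2) p0"
    and m: "\<And>x. x \<in> Om1 x1 x2 \<Longrightarrow> m \<le> p0 x" "0 < m"
    and hyp: "hyperbolic (L2_Om0 x1 x2) (A_0 x1 x2 p0 lam) f u"
    and lin: "flux_system (limit_coefficient x1 x2 p0) (\<lambda>x s. c x * s) 1 \<phi> \<psi>"
    and c: "continuous_on {0..1} c" "\<And>x. x \<in> {0..1} \<Longrightarrow> c x = lam - deriv f (u x)" "\<And>x. x \<in> Om0 x1 x2 \<Longrightarrow> c x = \<kappa>"
  shows "\<psi> 1 \<noteq> 0"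
proof
  assume \<psi>: "\<psi> 1 = 0"
  let ?q = "limit_coefficient x1 x2 p0" and ?V = "\<lambda>x. deriv f (u x)"
  let ?T = "minus_mult (A_0 x1 x2 p0 lam) ?V"
  have q: "coefficient (1/m) ?q" by (rule limit_coefficient[OF x p0 m])
  have c\<phi>: "continuous_on {0..1} \<phi>" using lin by (simp add: flux_system_def)
  let ?Y = "restrict (\<lambda>x. \<phi> x *\<^sub>R (1::complex)) {0..1}" and ?Z = "restrict (\<lambda>x. 0 *\<^sub>R (1::complex)) {0..1::real}"
  have Y: "?T ?Y (\<lambda>x. 0 + 0 * ?Y x)"
    unfolding minus_mult_def
  proof (rule flux_system_imp_A_0[OF x p0 m lin \<psi>, where G="\<lambda>x. (lam - c x) * \<phi> x" and \<gamma>="(lam - \<kappa>) * \<phi> x1"])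
    show "continuous_on {0..1} (\<lambda>x. (lam - c x) * \<phi> x)" by (intro continuous_intros c c\<phi>)
    fix t :: real
    show "c t * \<phi> t = lam * \<phi> t - (lam - c t) * \<phi> t" by (simp add: algebra_simps)
    show "(lam - c t) * \<phi> t = (lam - \<kappa>) * \<phi> x1" if "t \<in> Om0 x1 x2"
      using flux_system_limit_const[OF lin q x, of t] c(3)[OF that] that by simp
    show "0 + 0 * ?Y t + complex_of_real (?V t) * ?Y t = ((lam - c t) * \<phi> t) *\<^sub>R 1" if "t \<in> {0..1}"
      using c(2)[OF that] that by (simp add: scaleR_conv_of_real)
  qed
  have Z: "?T ?Z (\<lambda>x. 0 + 0 * ?Z x)"
    unfolding minus_mult_def
  proof (rule flux_system_imp_A_0[OF x p0 m, where u="\<lambda>_. 0" and w="\<lambda>_. 0" and k="\<lambda>_ _. 0" and a=0 and G="\<lambda>x. 0" and \<gamma>=0])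
    show "flux_system ?q (\<lambda>_ _. 0) 0 (\<lambda>_. 0) (\<lambda>_. 0)" by (simp add: flux_system_def)
  qed auto
  have zero: "(\<lambda>x::real. 0::complex) \<in> L2_Om0 x1 x2" by (auto simp: L2_Om0_def L2_def)
  have "0 \<notin> spectrum (L2_Om0 x1 x2) ?T" using hyp unfolding hyperbolic_def by auto
  then have "\<forall>g\<in>L2_Om0 x1 x2. \<exists>!u. ?T u (\<lambda>x. g x + 0 * u x)"
    unfolding spectrum_def resolvent_set_def by blast
  from bspec[OF this zero] have ex1: "\<exists>!u. ?T u (\<lambda>x. 0 + 0 * u x)" .
  have eq: "v = v'" if "\<exists>!u. P u" "P v" "P v'" for P and v v' :: "real \<Rightarrow> complex" using that by blast
  have "?Y = ?Z" by (rule eq[where P="\<lambda>u. ?T u (\<lambda>x. 0 + 0 * u x)", OF ex1 Y Z])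
  then have "?Y 0 = ?Z 0" by (rule fun_cong)
  then have "\<phi> 0 = 0" by simp
  moreover have "\<phi> 0 = 1" using lin by (simp add: flux_system_def)
  ultimately show False by simp
qed

section \<open>Continuity of the family of equilibria\<close>

text \<open>The Hausdorff semidistances in both directions are estimated by the same norms, but \<open>wderiv\<close> is an arbitrary
representative for each function, so that even the sign of a function matters only up to null sets.\<close>

lemma X_norm_diff_commute:
  assumes "has_weak_derivative I01 u v" "has_weak_derivative I01 u' v'"
  shows "X_norm p lam (\<lambda>x. u x - u' x) = X_norm p lam (\<lambda>x. u' x - u x)"
proof -
  have "(LINT x|lebesgue_on I01. p x * wderiv I01 (\<lambda>x. u x - u' x) x * wderiv I01 (\<lambda>x. u x - u' x) x)
      = (LINT x|lebesgue_on I01. p x * wderiv I01 (\<lambda>x. u' x - u x) x * wderiv I01 (\<lambda>x. u' x - u x) x)"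
  proof (rule LINT_cong_AE)
    show "AE x in lebesgue_on I01. p x * wderiv I01 (\<lambda>x. u x - u' x) x * wderiv I01 (\<lambda>x. u x - u' x) x
        = p x * wderiv I01 (\<lambda>x. u' x - u x) x * wderiv I01 (\<lambda>x. u' x - u x) x"
      using wderiv_AE_eq(1)[OF has_weak_derivative_diff[OF assms]] wderiv_AE_eq(1)[OF has_weak_derivative_diff[OF assms(2,1)]]
    proof eventually_elim
      case (elim x)
      show ?case unfolding elim by (simp add: algebra_simps)
    qed
  qed auto
  moreover have "(\<lambda>x. lam * (u x - u' x) * (u x - u' x)) = (\<lambda>x. lam * (u' x - u x) * (u' x - u x))"
    by (simp add: algebra_simps)
  ultimately show ?thesis unfolding X_norm_def X_inner_def by simp
qed

theorem corollary3p3: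
  fixes \<epsilon>0 lam m0 x1 x2 :: real
    and p :: "real \<Rightarrow> real \<Rightarrow> real" and p0 f :: "real \<Rightarrow> real"
  defines "E \<equiv> (\<lambda>\<epsilon>. equilibria (A_eps (p \<epsilon>) lam) f)"
    and "E0 \<equiv> equilibria (A_0 x1 x2 p0 lam) f"
  assumes "0 < \<epsilon>0" "\<epsilon>0 \<le> 1" "0 < lam" "0 < m0"
    and "0 < x1" "x1 < x2" "x2 < 1"
    and "\<And>\<epsilon>. \<epsilon> \<in> {0<..\<epsilon>0} \<Longrightarrow> C2_on {0..1} (p \<epsilon>)"
    and "C2_on (Om1 x1 x2) p0"
    and "uniform_limit (Om1 x1 x2) p p0 (at_right 0)"
    and "\<And>\<epsilon> x. \<epsilon> \<in> {0<..\<epsilon>0} \<Longrightarrow> x \<in> {x1 + \<epsilon>..x2 - \<epsilon>} \<Longrightarrow> p \<epsilon> x \<ge> 1 / \<epsilon>"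
    and "\<And>\<epsilon> x. \<epsilon> \<in> {0<..\<epsilon>0} \<Longrightarrow> x \<in> {0<..<1} \<Longrightarrow> p \<epsilon> x \<ge> m0"
    and "C2_on UNIV f"
    and "Limsup at_infinity (\<lambda>s. ereal (f s / s)) < ereal lam"
    and hyp: "\<And>u. u \<in> E0 \<Longrightarrow> hyperbolic (L2_Om0 x1 x2) (A_0 x1 x2 p0 lam) f u"
  shows "continuous_at_0 p lam E E0 \<and>
    (\<forall>k u0. inj_on u0 {1..k::nat} \<and> E0 = u0 ` {1..k} \<longrightarrow>
      (\<exists>C>0. \<exists>\<delta>\<in>{0<..\<epsilon>0}. \<exists>ue. \<forall>\<epsilon>\<in>{0<..\<delta>}.
         inj_on (ue \<epsilon>) {1..k} \<and> E \<epsilon> = ue \<epsilon> ` {1..k} \<and>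
         (\<forall>i\<in>{1..k}. X_norm (p \<epsilon>) lam (\<lambda>x. ue \<epsilon> i x - u0 i x)
            \<le> C * (Linf_norm (Om1 x1 x2) (\<lambda>x. p \<epsilon> x - p0 x) + \<epsilon>) powr (1 / 2))))"
proof -
  note e0 = assms(3) and lam = assms(5) and m0 = assms(6) and x = assms(7-9) and C2p = assms(10)
    and C2p0 = assms(11) and ul = assms(12) and large = assms(13) and ge = assms(14) and C2f = assms(15) and lim = assms(16)
  let ?S = "Om1 x1 x2"
  have S1: "?S \<subseteq> {0..1}" using x by auto
  have cp: "continuous_on {0..1} (p \<epsilon>)" if "\<epsilon> \<in> {0<..\<epsilon>0}" for \<epsilon> using C2p[OF that] by (rule C2_on_imp_C1)
  have pm: "m0 \<le> p \<epsilon> t" if "\<epsilon> \<in> {0<..\<epsilon>0}" "t \<in> {0..1}" for \<epsilon> t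
    by (rule continuous_ge_on_closure[of "{0<..<1}" "p \<epsilon>"]) (use cp that ge in auto)
  have cp0: "continuous_on ?S p0" using C2p0 by (rule C2_on_imp_C1)
  have ev0: "\<forall>\<^sub>F \<epsilon> in at_right 0. \<epsilon> \<in> {0<..\<epsilon>0}"
    unfolding eventually_at_right_field using e0 by (intro exI[of _ \<epsilon>0]) auto
  have p0m: "m0 \<le> p0 t" if "t \<in> ?S" for t
  proof (rule tendsto_lowerbound)
    show "((\<lambda>\<epsilon>. p \<epsilon> t) \<longlongrightarrow> p0 t) (at_right 0)" by (rule tendsto_uniform_limitI[OF ul that])
    show "\<forall>\<^sub>F \<epsilon> in at_right 0. m0 \<le> p \<epsilon> t"
      using ev0 by (rule eventually_mono) (use pm that S1 in blast)
  qed simp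
  have cdiff: "continuous_on ?S (\<lambda>t. p \<epsilon> t - p0 t)" if "\<epsilon> \<in> {0<..\<epsilon>0}" for \<epsilon>
    by (intro continuous_intros cp0 continuous_on_subset[OF cp[OF that] S1])
  define d where "d = (\<lambda>\<epsilon>. Linf_norm ?S (\<lambda>t. p \<epsilon> t - p0 t))"
  have Linf: "AE t in lebesgue_on ?S. \<bar>p \<epsilon> t - p0 t\<bar> \<le> d \<epsilon>" "0 \<le> d \<epsilon>"
    "(\<And>t. t \<in> ?S \<Longrightarrow> \<bar>p \<epsilon> t - p0 t\<bar> \<le> c) \<Longrightarrow> d \<epsilon> \<le> c" if "\<epsilon> \<in> {0<..\<epsilon>0}" for \<epsilon> c
    unfolding d_def
    by (rule Linf_norm_bounds(1)[OF x cdiff[OF that]], rule Linf_norm_bounds(2)[OF x cdiff[OF that]],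
        rule Linf_norm_bounds(3)[OF x cdiff[OF that]])
  have d0: "(d \<longlongrightarrow> 0) (at_right 0)"
  proof (rule tendstoI)
    fix e :: real assume e: "0 < e"
    then have "0 < e / 2" by simp
    then have "\<forall>\<^sub>F \<epsilon> in at_right 0. \<forall>t\<in>?S. dist (p \<epsilon> t) (p0 t) < e / 2"
      using ul unfolding uniform_limit_iff by blast
    with ev0 show "\<forall>\<^sub>F \<epsilon> in at_right 0. dist (d \<epsilon>) 0 < e"
    proof eventually_elim
      case (elim \<epsilon>)
      have "d \<epsilon> \<le> e / 2" by (rule Linf(3)[OF elim(1)]) (use elim(2) in \<open>force simp: dist_real_def\<close>)
      then show ?case using Linf(2)[OF elim(1)] e by (simp add: dist_real_def)
    qed
  qed
  have cf: "continuous_on UNIV f" using C2f by (rule C2_on_imp_C1)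
  obtain R h h' L K where R: "0 < R" "0 \<le> L" "0 \<le> K"
    and hf: "\<And>s. \<bar>s\<bar> \<le> R \<Longrightarrow> h s = lam * s - f s" and h'f: "\<And>s. \<bar>s\<bar> \<le> R \<Longrightarrow> h' s = lam - deriv f s"
    and lip: "\<And>s t. \<bar>h s - h t\<bar> \<le> L * \<bar>s - t\<bar>" and h'L: "\<And>s. \<bar>h' s\<bar> \<le> L" and ch': "continuous_on UNIV h'"
    and taylor: "\<And>r s t. \<bar>h s - h t - h' r * (s - t)\<bar> \<le> K * max \<bar>s - r\<bar> \<bar>t - r\<bar> * \<bar>s - t\<bar>"
    and sh: "\<And>s. R < s \<Longrightarrow> 0 < h s" "\<And>s. s < - R \<Longrightarrow> h s < 0"
    and sf: "\<And>s. R < s \<Longrightarrow> 0 < lam * s - f s" "\<And>s. s < - R \<Longrightarrow> lam * s - f s < 0"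
    by (rule truncated_nonlinearity[OF C2f lim]) (rule that)
  have ch: "continuous_on UNIV h" by (rule lipschitz_imp_continuous[OF lip R(2)])
  define B where "B = 1 / m0"
  have B: "0 \<le> B" using m0 by (simp add: B_def)
  define G where "G = exp (B + L)"
  have G: "0 < G" by (simp add: G_def)
  \<comment> \<open>Including the limit as the member \<open>\<epsilon> = 0\<close> lets all estimates be stated once.\<close>
  define Q where "Q = (\<lambda>\<epsilon>. if \<epsilon> = 0 then limit_coefficient x1 x2 p0 else (\<lambda>t. 1 / p \<epsilon> t))"
  have Q0: "Q 0 = limit_coefficient x1 x2 p0" and Q1: "\<epsilon> \<in> {0<..\<epsilon>0} \<Longrightarrow> Q \<epsilon> = (\<lambda>t. 1 / p \<epsilon> t)" for \<epsilon> by (auto simp: Q_def)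
  have q: "coefficient B (Q \<epsilon>)" if "\<epsilon> \<in> {0..\<epsilon>0}" for \<epsilon>
  proof (cases "\<epsilon> = 0")
    case True then show ?thesis unfolding B_def using limit_coefficient[OF x cp0 p0m m0] Q0 by simp
  next
    case False
    then have \<epsilon>: "\<epsilon> \<in> {0<..\<epsilon>0}" using that by auto
    show ?thesis unfolding B_def Q1[OF \<epsilon>] by (rule coefficient_inverse[OF cp[OF \<epsilon>] pm[OF \<epsilon>] m0])
  qed
  have zero_in: "0 \<in> {0..\<epsilon>0}" using e0 by simp
  have pos_in: "\<epsilon> \<in> {0<..\<epsilon>0} \<Longrightarrow> \<epsilon> \<in> {0..\<epsilon>0}" for \<epsilon> by simp
  define U where "U = (\<lambda>\<epsilon> a. SOME u. \<exists>w. flux_system (Q \<epsilon>) (\<lambda>_. h) a u w)"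
  define W where "W = (\<lambda>\<epsilon> a. SOME w. flux_system (Q \<epsilon>) (\<lambda>_. h) a (U \<epsilon> a) w)"
  have UW: "flux_system (Q \<epsilon>) (\<lambda>_. h) a (U \<epsilon> a) (W \<epsilon> a)" if \<epsilon>: "\<epsilon> \<in> {0..\<epsilon>0}" for \<epsilon> a
  proof -
    have "continuous_on ({0..1} \<times> UNIV) (\<lambda>y. h (snd y))"
      by (rule continuous_on_compose2[OF ch continuous_on_snd[OF continuous_on_id]]) auto
    then have "\<exists>u w. flux_system (Q \<epsilon>) (\<lambda>_. h) a u w"
      by (intro flux_system_exists[OF q[OF \<epsilon>] B R(2)] lip) (simp add: case_prod_unfold)
    then have "\<exists>w. flux_system (Q \<epsilon>) (\<lambda>_. h) a (U \<epsilon> a) w" unfolding U_def by (rule someI_ex)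
    then show ?thesis unfolding W_def by (rule someI_ex)
  qed
  have Ucont: "continuous_on {0..1} (U \<epsilon> a)" and U0: "U \<epsilon> a 0 = a" if "\<epsilon> \<in> {0..\<epsilon>0}" for \<epsilon> a
    using UW[OF that, of a] by (auto simp: flux_system_def)
  define M where "M = (R + 1 + \<bar>h 0\<bar>) * G"
  have M0: "0 \<le> M" using R G by (simp add: M_def)
  have UM: "\<bar>U \<epsilon> a t\<bar> \<le> M \<and> \<bar>W \<epsilon> a t\<bar> \<le> M" if \<epsilon>: "\<epsilon> \<in> {0..\<epsilon>0}" and a: "\<bar>a\<bar> \<le> R + 1" and t: "t \<in> {0..1}" for \<epsilon> a t
  proof -
    have "\<bar>U \<epsilon> a t\<bar> + \<bar>W \<epsilon> a t\<bar> \<le> (\<bar>a\<bar> + \<bar>h 0\<bar>) * exp (B + L)"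
    proof (rule flux_bound[OF UW[OF \<epsilon>] q[OF \<epsilon>] B R(2) _ _ _ t])
      show "continuous_on {0..1} (\<lambda>x. h (U \<epsilon> a x))" by (rule continuous_on_compose2[OF ch Ucont[OF \<epsilon>]]) auto
      show "\<bar>h s\<bar> \<le> \<bar>h 0\<bar> + L * \<bar>s\<bar>" for s using lip[of s 0] by simp
    qed simp
    also have "\<dots> \<le> M" unfolding M_def G_def using a by (intro mult_right_mono) auto
    finally show ?thesis by (intro conjI; linarith)
  qed
  define \<delta> where "\<delta> = (\<lambda>\<epsilon>. integral {0..1} (\<lambda>t. \<bar>Q \<epsilon> t - Q 0 t\<bar>))"
  have \<delta>0: "\<delta> 0 = 0" by (simp add: \<delta>_def)
  have \<delta>pos: "0 \<le> \<delta> \<epsilon>" for \<epsilon>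
    unfolding \<delta>_def by (cases "(\<lambda>t. \<bar>Q \<epsilon> t - Q 0 t\<bar>) integrable_on {0..1}")
      (auto intro: integral_nonneg simp: not_integrable_integral)
  have diff0: "\<bar>U \<epsilon> a t - U 0 b t\<bar> + \<bar>W \<epsilon> a t - W 0 b t\<bar> \<le> (\<bar>a - b\<bar> + M * \<delta> \<epsilon>) * G"
    if "\<epsilon> \<in> {0..\<epsilon>0}" "\<bar>b\<bar> \<le> R + 1" "t \<in> {0..1}" for \<epsilon> a b t
    unfolding G_def \<delta>_def
    by (rule flux_difference[OF UW[OF that(1)] UW[OF zero_in] q[OF that(1)] q[OF zero_in] B R(2) M0 lip _ that(3)])
      (use UM[OF zero_in that(2)] in blast)
  have diff1: "\<bar>W \<epsilon> a 1 - W \<epsilon> b 1\<bar> \<le> \<bar>a - b\<bar> * G" if "\<epsilon> \<in> {0..\<epsilon>0}" "\<bar>b\<bar> \<le> R + 1" for \<epsilon> a b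
  proof -
    have "\<bar>U \<epsilon> a 1 - U \<epsilon> b 1\<bar> + \<bar>W \<epsilon> a 1 - W \<epsilon> b 1\<bar> \<le> (\<bar>a - b\<bar> + M * integral {0..1} (\<lambda>t. \<bar>Q \<epsilon> t - Q \<epsilon> t\<bar>)) * G"
      unfolding G_def
      by (rule flux_difference[OF UW[OF that(1)] UW[OF that(1)] q[OF that(1)] q[OF that(1)] B R(2) M0 lip])
        (use UM[OF that] in auto)
    then show ?thesis by simp
  qed
  define c1 where "c1 = 1 / m0\<^sup>2 + 1 + 2 / m0"
  have c1: "0 < c1" using m0 by (auto simp: c1_def intro!: add_nonneg_pos add_pos_pos)
  \<comment> \<open>The quantity whose square root is the claimed rate.\<close>
  define \<tau> where "\<tau> = (\<lambda>\<epsilon>. d \<epsilon> + \<epsilon>)"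
  have \<delta>\<tau>: "\<delta> \<epsilon> \<le> c1 * \<tau> \<epsilon>" if \<epsilon>: "\<epsilon> \<in> {0<..\<epsilon>0}" for \<epsilon>
    unfolding \<delta>_def c1_def \<tau>_def Q0 Q1[OF \<epsilon>]
    using \<epsilon> by (intro coefficient_L1_distance[OF x m0 cp[OF \<epsilon>] pm[OF \<epsilon>] cp0 p0m _ large[OF \<epsilon>] Linf(1,2)[OF \<epsilon>]]) auto
  have \<tau>0: "(\<tau> \<longlongrightarrow> 0) (at_right 0)"
    unfolding \<tau>_def using tendsto_add[OF d0 tendsto_ident_at[of 0 "{0<..}"]] by simp
  have \<delta>lim: "(\<delta> \<longlongrightarrow> 0) (at_right 0)"
  proof (rule tendsto_sandwich)
    show "\<forall>\<^sub>F \<epsilon> in at_right 0. 0 \<le> \<delta> \<epsilon>" using \<delta>pos by (intro always_eventually) auto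
    show "\<forall>\<^sub>F \<epsilon> in at_right 0. \<delta> \<epsilon> \<le> c1 * \<tau> \<epsilon>" using ev0 by (rule eventually_mono) (rule \<delta>\<tau>)
    show "((\<lambda>\<epsilon>. c1 * \<tau> \<epsilon>) \<longlongrightarrow> 0) (at_right 0)" using tendsto_mult_left[OF \<tau>0, of c1] by simp
  qed simp
  have Eeps: "E \<epsilon> = (\<lambda>a. restrict (U \<epsilon> a) {0..1}) ` {a. W \<epsilon> a 1 = 0}" if \<epsilon>: "\<epsilon> \<in> {0<..\<epsilon>0}" for \<epsilon>
  proof -
    obtain p' where p': "\<And>t. t \<in> {0..1} \<Longrightarrow> (p \<epsilon> has_real_derivative p' t) (at t within {0..1})" "continuous_on {0..1} p'"
      using C2_on_imp_C1[OF C2p[OF \<epsilon>]] by blast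
    show ?thesis unfolding E_def
    proof (rule equilibria_eq_shooting_zeros[OF q[OF pos_in[OF \<epsilon>]] B R(2) lip cf _ _ hf sh sf UW[OF pos_in[OF \<epsilon>]]])
      fix u assume A: "A_eps (p \<epsilon>) lam u (\<lambda>t. f (u t))"
      then have "u \<in> extensional {0..1}" by (auto simp: A_eps_def dom_A_eps_def H2_def H1_def)
      then show "u \<in> extensional {0..1} \<and> (\<exists>w. flux_system (Q \<epsilon>) (\<lambda>_ s. lam * s - f s) (u 0) u w \<and> w 1 = 0)"
        unfolding Q1[OF \<epsilon>] using A_eps_imp_flux_system[OF A cf p' pm[OF \<epsilon>] m0] by blast
    next
      fix a u w assume "flux_system (Q \<epsilon>) (\<lambda>_ s. lam * s - f s) a u w" "w 1 = 0"
      then show "A_eps (p \<epsilon>) lam (restrict u {0..1}) (\<lambda>t. f (restrict u {0..1} t))"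
        unfolding Q1[OF \<epsilon>] by (rule flux_system_imp_A_eps[OF _ _ cf p' pm[OF \<epsilon>] m0])
    qed
  qed
  have EZ: "E0 = (\<lambda>a. restrict (U 0 a) {0..1}) ` {a. W 0 a 1 = 0}"
    unfolding E0_def
  proof (rule equilibria_eq_shooting_zeros[OF q[OF zero_in] B R(2) lip cf _ _ hf sh sf UW[OF zero_in]])
    fix u assume A: "A_0 x1 x2 p0 lam u (\<lambda>t. f (u t))"
    then have "u \<in> extensional {0..1}" by (auto simp: A_0_def dom_A_0_def H1_Om0_def H1_def)
    then show "u \<in> extensional {0..1} \<and> (\<exists>w. flux_system (Q 0) (\<lambda>_ s. lam * s - f s) (u 0) u w \<and> w 1 = 0)"
      unfolding Q0 using A_0_imp_flux_system[OF x cp0 p0m m0 A cf] by blast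
  next
    fix a u w assume F: "flux_system (Q 0) (\<lambda>_ s. lam * s - f s) a u w" "w 1 = 0"
    have cu: "continuous_on {0..1} u" using F(1) by (simp add: flux_system_def)
    show "A_0 x1 x2 p0 lam (restrict u {0..1}) (\<lambda>t. f (restrict u {0..1} t))"
    proof -
      have "A_0 x1 x2 p0 lam (restrict (\<lambda>t. u t *\<^sub>R 1) {0..1}) (\<lambda>t. f (restrict u {0..1} t))"
      proof (rule flux_system_imp_A_0[OF x cp0 p0m m0 F[unfolded Q0], where G="\<lambda>t. f (u t)" and \<gamma>="f (u x1)"])
        show "continuous_on {0..1} (\<lambda>t. f (u t))" by (rule continuous_on_compose2[OF cf cu]) auto
        show "f (u t) = f (u x1)" if "t \<in> Om0 x1 x2" for t
          using flux_system_limit_const[OF F(1)[unfolded Q0] q[OF zero_in, unfolded Q0] x, of t] that by simp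
      qed auto
      then show ?thesis by simp
    qed
  qed
  have Ub: "\<bar>U \<epsilon> a t\<bar> \<le> R" if "\<epsilon> \<in> {0..\<epsilon>0}" "W \<epsilon> a 1 = 0" "t \<in> {0..1}" for \<epsilon> a t
    by (rule flux_bounded_by_sign[OF UW[OF that(1)] that(2) q[OF that(1)] ch sh that(3)])
  have strict: "\<exists>D K'. D \<noteq> 0 \<and> (\<forall>\<epsilon>\<in>{0..\<epsilon>0}. \<forall>a b. \<bar>a\<bar> \<le> R + 1 \<longrightarrow> \<bar>b\<bar> \<le> R + 1 \<longrightarrow>
        \<bar>W \<epsilon> a 1 - W \<epsilon> b 1 - (a - b) * D\<bar> \<le> \<bar>a - b\<bar> * (K' * (\<delta> \<epsilon> + \<bar>a - z\<bar> + \<bar>b - z\<bar>)))"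
    if z: "W 0 z 1 = 0" for z
  proof -
    have zR: "\<bar>z\<bar> \<le> R + 1" using Ub[OF zero_in z, of 0] U0[OF zero_in, of z] by simp
    have cc: "continuous_on {0..1} (\<lambda>t. h' (U 0 z t))" by (rule continuous_on_compose2[OF ch' Ucont[OF zero_in]]) auto
    have "continuous_on ({0..1} \<times> UNIV) (\<lambda>y. h' (U 0 z (fst y)) * snd y)"
      by (intro continuous_intros continuous_on_compose2[OF cc]) auto
    then have "\<exists>u w. flux_system (Q 0) (\<lambda>t s. h' (U 0 z t) * s) 1 u w"
    proof (intro flux_system_exists[OF q[OF zero_in] B R(2)])
      show "\<bar>h' (U 0 z t) * s - h' (U 0 z t) * s'\<bar> \<le> L * \<bar>s - s'\<bar>" for t s s'
        unfolding right_diff_distrib[symmetric] abs_mult by (intro mult_right_mono h'L) simp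
    qed (simp add: case_prod_unfold)
    then obtain \<phi> \<psi> where lin: "flux_system (Q 0) (\<lambda>t s. h' (U 0 z t) * s) 1 \<phi> \<psi>" by blast
    have "\<psi> 1 \<noteq> 0"
    proof (rule hyperbolic_imp_transversal[OF x cp0 p0m m0 _ lin[unfolded Q0] cc])
      show "hyperbolic (L2_Om0 x1 x2) (A_0 x1 x2 p0 lam) f (restrict (U 0 z) {0..1})"
        using z EZ by (intro hyp) auto
      show "h' (U 0 z t) = lam - deriv f (restrict (U 0 z) {0..1} t)" if "t \<in> {0..1}" for t
        using h'f[OF Ub[OF zero_in z that]] that by simp
      show "h' (U 0 z t) = h' (U 0 z x1)" if "t \<in> Om0 x1 x2" for t
        using flux_system_limit_const[OF UW[OF zero_in, unfolded Q0] q[OF zero_in, unfolded Q0] x, of t] that by simp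
    qed
    have "continuous_on {0..1} \<psi>" using lin by (simp add: flux_system_def)
    then have "bounded (\<psi> ` {0..1})" using compact_continuous_image compact_imp_bounded by blast
    then obtain N' where "\<forall>t\<in>{0..1}. \<bar>\<psi> t\<bar> \<le> N'" by (auto simp: bounded_iff)
    then obtain N where N: "\<And>t. t \<in> {0..1} \<Longrightarrow> \<bar>\<psi> t\<bar> \<le> N" "0 \<le> N"
      using that[of "max N' 0"] by (auto simp: le_max_iff_disj)
    \<comment> \<open>The first summand accounts for the change of the coefficient, the second for the distance \<open>\<rho>\<close> of the solutions from the reference solution.\<close>
    define K' where "K' = (N + K * ((1 + M) * G) * G) * G"
    have "\<bar>W \<epsilon> a 1 - W \<epsilon> b 1 - (a - b) * \<psi> 1\<bar> \<le> \<bar>a - b\<bar> * (K' * (\<delta> \<epsilon> + \<bar>a - z\<bar> + \<bar>b - z\<bar>))"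
      if \<epsilon>: "\<epsilon> \<in> {0..\<epsilon>0}" and ab: "\<bar>a\<bar> \<le> R + 1" "\<bar>b\<bar> \<le> R + 1" for \<epsilon> a b
    proof -
      define T where "T = \<delta> \<epsilon> + \<bar>a - z\<bar> + \<bar>b - z\<bar>"
      have T: "0 \<le> T" "\<delta> \<epsilon> \<le> T" using \<delta>pos[of \<epsilon>] by (auto simp: T_def)
      define \<rho> where "\<rho> = (1 + M) * G * T"
      have \<rho>0: "0 \<le> \<rho>" using M0 G T by (simp add: \<rho>_def)
      have \<rho>: "\<bar>U \<epsilon> c t - U 0 z t\<bar> \<le> \<rho>" if c: "\<bar>c - z\<bar> + \<delta> \<epsilon> \<le> T" and t: "t \<in> {0..1}" for c t
      proof -
        have "\<bar>c - z\<bar> + M * \<delta> \<epsilon> \<le> T + M * T"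
          using c T M0 \<delta>pos[of \<epsilon>] by (intro add_mono mult_left_mono) auto
        then have "(\<bar>c - z\<bar> + M * \<delta> \<epsilon>) * G \<le> (T + M * T) * G" using G by (intro mult_right_mono) auto
        also have "\<dots> = \<rho>" by (simp add: \<rho>_def algebra_simps)
        finally show ?thesis using diff0[OF \<epsilon> zR t, of c] by linarith
      qed
      have "\<bar>W \<epsilon> a 1 - W \<epsilon> b 1 - (a - b) * \<psi> 1\<bar> \<le> \<bar>a - b\<bar> * (N * integral {0..1} (\<lambda>t. \<bar>Q \<epsilon> t - Q 0 t\<bar>) + K * \<rho> * exp (B + L)) * exp (B + L)"
        by (rule flux_linearisation[OF UW[OF \<epsilon>] UW[OF \<epsilon>] lin q[OF \<epsilon>] q[OF zero_in] B R(2) N(2) R(3) \<rho>0 lip h'L ch' taylor Ucont[OF zero_in] \<rho> \<rho> N(1)])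
          (use \<delta>pos[of \<epsilon>] in \<open>auto simp: T_def\<close>)
      also have "\<dots> = \<bar>a - b\<bar> * ((N * \<delta> \<epsilon> + K * ((1 + M) * G) * G * T) * G)"
        by (simp add: \<delta>_def G_def \<rho>_def mult_ac)
      also have "\<dots> \<le> \<bar>a - b\<bar> * ((N * T + K * ((1 + M) * G) * G * T) * G)"
        using T N(2) G by (intro mult_left_mono mult_right_mono add_right_mono) auto
      also have "\<dots> = \<bar>a - b\<bar> * (K' * T)" by (simp add: K'_def algebra_simps)
      finally show ?thesis by (simp only: T_def)
    qed
    then show ?thesis using \<open>\<psi> 1 \<noteq> 0\<close> by blast
  qed
  have cW: "continuous_on {-(R+1)..R+1} (\<lambda>a. W \<epsilon> a 1)" if "\<epsilon> \<in> {0..\<epsilon>0}" for \<epsilon>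
    by (rule lipschitz_on_continuous_on[of G], rule lipschitz_onI)
      (use diff1[OF that] G in \<open>auto simp: dist_real_def mult.commute abs_le_iff\<close>)
  have zW: "\<bar>a\<bar> \<le> R" if "\<epsilon> \<in> {0..\<epsilon>0}" "W \<epsilon> a 1 = 0" for \<epsilon> a
    using Ub[OF that, of 0] U0[OF that(1)] by simp
  have close: "\<bar>W \<epsilon> a 1 - W 0 a 1\<bar> \<le> (M * G) * \<delta> \<epsilon>" if "\<epsilon> \<in> {0..\<epsilon>0}" "\<bar>a\<bar> \<le> R + 1" for \<epsilon> a
    using diff0[OF that, of 1 a] by (simp add: mult_ac)
  have MG: "0 \<le> M * G" using M0 G by simp
  have finZ: "finite {a. W 0 a 1 = 0}"
    by (rule perturbed_simple_zeros(1)[where F="\<lambda>\<epsilon> a. W \<epsilon> a 1", OF e0 MG cW zW close \<delta>0 \<delta>pos \<delta>lim strict])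
  have "\<exists>C>0. \<exists>\<epsilon>1\<in>{0<..\<epsilon>0}. \<exists>\<zeta>. \<forall>\<epsilon>\<in>{0<..\<epsilon>1}.
      bij_betw (\<zeta> \<epsilon>) {a. W 0 a 1 = 0} {a. W \<epsilon> a 1 = 0} \<and> (\<forall>z. W 0 z 1 = 0 \<longrightarrow> \<bar>\<zeta> \<epsilon> z - z\<bar> \<le> C * \<delta> \<epsilon>)"
    by (rule perturbed_simple_zeros(2)[where F="\<lambda>\<epsilon> a. W \<epsilon> a 1", OF e0 MG cW zW close \<delta>0 \<delta>pos \<delta>lim strict])
  then obtain C2 \<epsilon>1 \<zeta> where C2: "0 < C2" and \<epsilon>1: "\<epsilon>1 \<in> {0<..\<epsilon>0}"
    and bij: "\<And>\<epsilon>. \<epsilon> \<in> {0<..\<epsilon>1} \<Longrightarrow> bij_betw (\<zeta> \<epsilon>) {a. W 0 a 1 = 0} {a. W \<epsilon> a 1 = 0}"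
    and \<zeta>: "\<And>\<epsilon> z. \<epsilon> \<in> {0<..\<epsilon>1} \<Longrightarrow> W 0 z 1 = 0 \<Longrightarrow> \<bar>\<zeta> \<epsilon> z - z\<bar> \<le> C2 * \<delta> \<epsilon>"
    by blast
  have "\<forall>\<^sub>F \<epsilon> in at_right 0. \<tau> \<epsilon> < 1" by (rule order_tendstoD(2)[OF \<tau>0]) simp
  then obtain b where b: "0 < b" "\<And>\<epsilon>. 0 < \<epsilon> \<Longrightarrow> \<epsilon> < b \<Longrightarrow> \<tau> \<epsilon> < 1"
    unfolding eventually_at_right_field by auto
  define \<epsilon>2 where "\<epsilon>2 = min \<epsilon>1 (b / 2)"
  have \<epsilon>2: "\<epsilon>2 \<in> {0<..\<epsilon>0}" using \<epsilon>1 b by (auto simp: \<epsilon>2_def)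
  have small: "\<epsilon> \<in> {0<..\<epsilon>0}" "\<epsilon> \<in> {0<..\<epsilon>1}" "\<tau> \<epsilon> \<le> 1" "0 < \<tau> \<epsilon>" if "\<epsilon> \<in> {0<..\<epsilon>2}" for \<epsilon>
  proof -
    show s: "\<epsilon> \<in> {0<..\<epsilon>0}" "\<epsilon> \<in> {0<..\<epsilon>1}" using that \<epsilon>1 by (auto simp: \<epsilon>2_def)
    show "\<tau> \<epsilon> \<le> 1" using b(2)[of \<epsilon>] that b(1) by (auto simp: \<epsilon>2_def)
    show "0 < \<tau> \<epsilon>" using Linf(2)[OF s(1)] that by (simp add: \<tau>_def)
  qed
  define c2 where "c2 = (C2 + M) * c1 * G"
  \<comment> \<open>Once \<open>\<tau> \<le> 1\<close>, the terms of order \<open>\<tau>\<^sup>2\<close> are at most of order \<open>\<tau>\<close>, and the squared norm is at most \<open>A \<tau>\<close>.\<close>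
  define A where "A = 1 / m0 * (c2 + M / m0)\<^sup>2 + M\<^sup>2 * c1 + lam * c2\<^sup>2"
  have c2: "0 \<le> c2" using C2 M0 c1 G by (simp add: c2_def)
  have A0: "0 \<le> A" unfolding A_def using m0 c1 lam by (intro add_nonneg_nonneg mult_nonneg_nonneg) auto
  define C where "C = sqrt A + 1"
  have C: "0 < C" using A0 by (simp add: C_def add_nonneg_pos)
  have rate: "X_norm (p \<epsilon>) lam (\<lambda>t. restrict (U \<epsilon> (\<zeta> \<epsilon> z)) {0..1} t - restrict (U 0 z) {0..1} t) \<le> C * \<tau> \<epsilon> powr (1/2)"
    if \<epsilon>: "\<epsilon> \<in> {0<..\<epsilon>2}" and z: "W 0 z 1 = 0" for \<epsilon> z
  proof -
    note s = small[OF \<epsilon>]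
    note sin = pos_in[OF s(1)]
    have zz: "W \<epsilon> (\<zeta> \<epsilon> z) 1 = 0" using bij_betwE[OF bij[OF s(2)]] z by blast
    have zR: "\<bar>z\<bar> \<le> R + 1" "\<bar>\<zeta> \<epsilon> z\<bar> \<le> R + 1" using zW[OF zero_in z] zW[OF sin zz] by auto
    have "(\<bar>\<zeta> \<epsilon> z - z\<bar> + M * \<delta> \<epsilon>) * G \<le> (C2 * \<delta> \<epsilon> + M * \<delta> \<epsilon>) * G"
      using \<zeta>[OF s(2) z] G by (intro mult_right_mono add_right_mono) auto
    also have "\<dots> = ((C2 + M) * G) * \<delta> \<epsilon>" by (simp add: algebra_simps)
    also have "\<dots> \<le> ((C2 + M) * G) * (c1 * \<tau> \<epsilon>)" using C2 M0 G by (intro mult_left_mono \<delta>\<tau>[OF s(1)]) auto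
    also have "\<dots> = c2 * \<tau> \<epsilon>" by (simp add: c2_def mult_ac)
    finally have le: "(\<bar>\<zeta> \<epsilon> z - z\<bar> + M * \<delta> \<epsilon>) * G \<le> c2 * \<tau> \<epsilon>" .
    have dd: "\<bar>W \<epsilon> (\<zeta> \<epsilon> z) t - W 0 z t\<bar> \<le> c2 * \<tau> \<epsilon>" "\<bar>U \<epsilon> (\<zeta> \<epsilon> z) t - U 0 z t\<bar> \<le> c2 * \<tau> \<epsilon>" if "t \<in> {0..1}" for t
      using diff0[OF sin zR(1) that, of "\<zeta> \<epsilon> z"] le by linarith+
    have "X_norm (p \<epsilon>) lam (\<lambda>t. restrict (U \<epsilon> (\<zeta> \<epsilon> z)) {0..1} t - restrict (U 0 z) {0..1} t) \<le>
      sqrt (1 / m0 * (c2 * \<tau> \<epsilon> + d \<epsilon> * M / m0)\<^sup>2 + M\<^sup>2 * integral {0..1} (\<lambda>t. \<bar>1 / p \<epsilon> t - limit_coefficient x1 x2 p0 t\<bar>) + lam * (c2 * \<tau> \<epsilon>)\<^sup>2)"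
      by (rule X_norm_flux_difference[OF x m0 less_imp_le[OF lam] cp[OF s(1)] pm[OF s(1)] cp0 p0m Linf(1,2)[OF s(1)]
            UW[OF sin, unfolded Q1[OF s(1)]] UW[OF zero_in, unfolded Q0] _ _ dd])
        (use UM[OF sin zR(2)] UM[OF zero_in zR(1)] in blast)+
    also have "\<dots> \<le> sqrt (A * \<tau> \<epsilon>)"
    proof (rule real_sqrt_le_mono)
      have sq: "(\<tau> \<epsilon>)\<^sup>2 \<le> \<tau> \<epsilon>" using s(3,4) by (simp add: power2_eq_square mult_left_le_one_le)
      have "d \<epsilon> \<le> \<tau> \<epsilon>" using \<epsilon> by (simp add: \<tau>_def)
      then have "d \<epsilon> * M / m0 \<le> \<tau> \<epsilon> * M / m0" using M0 m0 by (intro divide_right_mono mult_right_mono) auto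
      moreover have "0 \<le> c2 * \<tau> \<epsilon> + d \<epsilon> * M / m0" using c2 s(4) Linf(2)[OF s(1)] M0 m0 by simp
      ultimately have "(c2 * \<tau> \<epsilon> + d \<epsilon> * M / m0)\<^sup>2 \<le> ((c2 + M / m0) * \<tau> \<epsilon>)\<^sup>2"
        by (intro power_mono) (simp_all add: algebra_simps)
      also have "\<dots> \<le> (c2 + M / m0)\<^sup>2 * \<tau> \<epsilon>" unfolding power_mult_distrib by (intro mult_left_mono sq) simp
      finally have 1: "1 / m0 * (c2 * \<tau> \<epsilon> + d \<epsilon> * M / m0)\<^sup>2 \<le> 1 / m0 * ((c2 + M / m0)\<^sup>2 * \<tau> \<epsilon>)"
        using m0 by (intro mult_left_mono) auto
      have 2: "M\<^sup>2 * integral {0..1} (\<lambda>t. \<bar>1 / p \<epsilon> t - limit_coefficient x1 x2 p0 t\<bar>) \<le> M\<^sup>2 * (c1 * \<tau> \<epsilon>)"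
        using \<delta>\<tau>[OF s(1)] by (intro mult_left_mono) (simp_all add: \<delta>_def Q0 Q1[OF s(1)])
      have 3: "lam * (c2 * \<tau> \<epsilon>)\<^sup>2 \<le> lam * (c2\<^sup>2 * \<tau> \<epsilon>)"
        unfolding power_mult_distrib using lam by (intro mult_left_mono sq) auto
      have "A * \<tau> \<epsilon> = 1 / m0 * ((c2 + M / m0)\<^sup>2 * \<tau> \<epsilon>) + M\<^sup>2 * (c1 * \<tau> \<epsilon>) + lam * (c2\<^sup>2 * \<tau> \<epsilon>)"
        unfolding A_def by (simp only: distrib_right mult.assoc)
      then show "1 / m0 * (c2 * \<tau> \<epsilon> + d \<epsilon> * M / m0)\<^sup>2 + M\<^sup>2 * integral {0..1} (\<lambda>t. \<bar>1 / p \<epsilon> t - limit_coefficient x1 x2 p0 t\<bar>)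
          + lam * (c2 * \<tau> \<epsilon>)\<^sup>2 \<le> A * \<tau> \<epsilon>" using 1 2 3 by linarith
    qed
    also have "\<dots> = sqrt A * \<tau> \<epsilon> powr (1/2)" using s(4) by (simp add: real_sqrt_mult powr_half_sqrt)
    also have "\<dots> \<le> C * \<tau> \<epsilon> powr (1/2)" by (intro mult_right_mono) (simp_all add: C_def)
    finally show ?thesis .
  qed
  have Uinj: "inj_on (\<lambda>a. restrict (U \<epsilon> a) {0..1}) Z" if "\<epsilon> \<in> {0..\<epsilon>0}" for \<epsilon> Z
  proof (rule inj_onI)
    fix a c assume "restrict (U \<epsilon> a) {0..1} = restrict (U \<epsilon> c) {0..1}"
    then have "restrict (U \<epsilon> a) {0..1} 0 = restrict (U \<epsilon> c) {0..1} 0" by (rule fun_cong)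
    then show "a = c" using U0[OF that] by simp
  qed
  have part2: "\<exists>ue. \<forall>\<epsilon>\<in>{0<..\<epsilon>2}. inj_on (ue \<epsilon>) {1..k} \<and> E \<epsilon> = ue \<epsilon> ` {1..k} \<and>
         (\<forall>i\<in>{1..k}. X_norm (p \<epsilon>) lam (\<lambda>x. ue \<epsilon> i x - u0 i x) \<le> C * \<tau> \<epsilon> powr (1 / 2))"
    if inj: "inj_on u0 {1..k::nat}" and img: "E0 = u0 ` {1..k}" for k u0
  proof -
    have bz: "bij_betw (\<lambda>a. restrict (U 0 a) {0..1}) {a. W 0 a 1 = 0} E0"
      unfolding EZ by (rule bij_betw_imageI[OF Uinj[OF zero_in] refl])
    \<comment> \<open>The initial values of the given limit equilibria.\<close>
    define z where "z = (\<lambda>i. the_inv_into {a. W 0 a 1 = 0} (\<lambda>a. restrict (U 0 a) {0..1}) (u0 i))"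
    have z: "bij_betw z {1..k} {a. W 0 a 1 = 0}"
      using bij_betw_trans[OF bij_betw_imageI[OF inj img[symmetric]] bij_betw_the_inv_into[OF bz]] by (simp add: z_def o_def)
    have uz: "u0 i = restrict (U 0 (z i)) {0..1}" if "i \<in> {1..k}" for i
      unfolding z_def using f_the_inv_into_f_bij_betw[OF bz, of "u0 i"] that img by auto
    define ue where "ue = (\<lambda>\<epsilon> i. restrict (U \<epsilon> (\<zeta> \<epsilon> (z i))) {0..1})"
    have "inj_on (ue \<epsilon>) {1..k} \<and> E \<epsilon> = ue \<epsilon> ` {1..k} \<and>
         (\<forall>i\<in>{1..k}. X_norm (p \<epsilon>) lam (\<lambda>x. ue \<epsilon> i x - u0 i x) \<le> C * \<tau> \<epsilon> powr (1 / 2))" if \<epsilon>: "\<epsilon> \<in> {0<..\<epsilon>2}" for \<epsilon>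
    proof -
      note s = small[OF \<epsilon>]
      have be: "bij_betw (\<lambda>a. restrict (U \<epsilon> a) {0..1}) {a. W \<epsilon> a 1 = 0} (E \<epsilon>)"
        unfolding Eeps[OF s(1)] by (rule bij_betw_imageI[OF Uinj[OF pos_in[OF s(1)]] refl])
      have "bij_betw (ue \<epsilon>) {1..k} (E \<epsilon>)"
        using bij_betw_trans[OF bij_betw_trans[OF z bij[OF s(2)]] be] by (simp add: ue_def o_def)
      moreover have "X_norm (p \<epsilon>) lam (\<lambda>x. ue \<epsilon> i x - u0 i x) \<le> C * \<tau> \<epsilon> powr (1 / 2)" if i: "i \<in> {1..k}" for i
      proof -
        have "W 0 (z i) 1 = 0" using bij_betwE[OF z] i by blast
        from rate[OF \<epsilon> this] show ?thesis unfolding ue_def uz[OF i] .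
      qed
      ultimately show ?thesis by (auto simp: bij_betw_def)
    qed
    then show ?thesis by blast
  qed
  have "continuous_at_0 p lam E E0"
  proof -
    have "finite E0" unfolding EZ using finZ by blast
    then obtain u0 where "bij_betw u0 {1..card E0} E0" using ex_bij_betw_nat_finite_1 by blast
    then have u0: "inj_on u0 {1..card E0}" "E0 = u0 ` {1..card E0}" by (auto simp: bij_betw_def)
    let ?I = "{1..card E0}"
    obtain ue where ue: "\<forall>\<epsilon>\<in>{0<..\<epsilon>2}. inj_on (ue \<epsilon>) ?I \<and> E \<epsilon> = ue \<epsilon> ` ?I \<and>
         (\<forall>i\<in>?I. X_norm (p \<epsilon>) lam (\<lambda>x. ue \<epsilon> i x - u0 i x) \<le> C * \<tau> \<epsilon> powr (1 / 2))"
      using part2[OF u0] by blast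
    have wE0: "\<exists>v. has_weak_derivative I01 u v" if "u \<in> E0" for u
      using that unfolding E0_def by (auto simp: equilibria_def A_0_def dom_A_0_def H1_Om0_def H1_def)
    have wE: "\<exists>v. has_weak_derivative I01 u v" if "u \<in> E \<epsilon>" for u \<epsilon>
      using that unfolding E_def by (auto simp: equilibria_def A_eps_def dom_A_eps_def H2_def H1_def)
    have bound: "dist_H (p \<epsilon>) lam (E \<epsilon>) E0 + dist_H (p \<epsilon>) lam E0 (E \<epsilon>) \<le> ennreal (2 * (C * \<tau> \<epsilon> powr (1 / 2)))"
      if \<epsilon>: "\<epsilon> \<in> {0<..\<epsilon>2}" for \<epsilon>
    proof -
      let ?r = "C * \<tau> \<epsilon> powr (1 / 2)"
      have Ei: "E \<epsilon> = ue \<epsilon> ` ?I" using ue \<epsilon> by blast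
      have X1: "X_norm (p \<epsilon>) lam (\<lambda>x. ue \<epsilon> i x - u0 i x) \<le> ?r" if "i \<in> ?I" for i using ue \<epsilon> that by blast
      have X2: "X_norm (p \<epsilon>) lam (\<lambda>x. u0 i x - ue \<epsilon> i x) \<le> ?r" if i: "i \<in> ?I" for i
      proof -
        have "u0 i \<in> E0" "ue \<epsilon> i \<in> E \<epsilon>" using i u0(2) Ei by blast+
        then obtain v v' where "has_weak_derivative I01 (u0 i) v" "has_weak_derivative I01 (ue \<epsilon> i) v'"
          using wE0 wE by blast
        from X_norm_diff_commute[OF this] X1[OF i] show ?thesis by simp
      qed
      have 1: "dist_H (p \<epsilon>) lam (E \<epsilon>) E0 \<le> ennreal ?r"
        unfolding dist_H_def
      proof (rule SUP_least)
        fix a assume "a \<in> E \<epsilon>"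
        then obtain i where i: "i \<in> ?I" "a = ue \<epsilon> i" using Ei by blast
        have "u0 i \<in> E0" using i u0(2) by blast
        then show "(INF b\<in>E0. ennreal (X_norm (p \<epsilon>) lam (\<lambda>x. a x - b x))) \<le> ennreal ?r"
          by (rule INF_lower2) (use X1[OF i(1)] i(2) in \<open>simp add: ennreal_leI\<close>)
      qed
      have 2: "dist_H (p \<epsilon>) lam E0 (E \<epsilon>) \<le> ennreal ?r"
        unfolding dist_H_def
      proof (rule SUP_least)
        fix a assume "a \<in> E0"
        then obtain i where i: "i \<in> ?I" "a = u0 i" using u0(2) by blast
        have "ue \<epsilon> i \<in> E \<epsilon>" using i Ei by blast
        then show "(INF b\<in>E \<epsilon>. ennreal (X_norm (p \<epsilon>) lam (\<lambda>x. a x - b x))) \<le> ennreal ?r"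
          by (rule INF_lower2) (use X2[OF i(1)] i(2) in \<open>simp add: ennreal_leI\<close>)
      qed
      have "0 \<le> ?r" using C by simp
      then have "ennreal (2 * ?r) = ennreal ?r + ennreal ?r" by (simp flip: ennreal_plus)
      then show ?thesis using add_mono[OF 1 2] by simp
    qed
    have ev2: "\<forall>\<^sub>F \<epsilon> in at_right 0. \<epsilon> \<in> {0<..\<epsilon>2}"
      unfolding eventually_at_right_field using \<epsilon>2 by (intro exI[of _ \<epsilon>2]) auto
    have s1: "((\<lambda>\<epsilon>. sqrt (\<tau> \<epsilon>)) \<longlongrightarrow> sqrt 0) (at_right 0)" by (rule tendsto_real_sqrt[OF \<tau>0])
    from tendsto_ennrealI[OF tendsto_mult_left[OF tendsto_mult_left[OF s1, of C], of 2]]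
    have s0: "((\<lambda>\<epsilon>. ennreal (2 * (C * sqrt (\<tau> \<epsilon>)))) \<longlongrightarrow> 0) (at_right 0)" by simp
    show ?thesis unfolding continuous_at_0_def
    proof (rule tendsto_sandwich[OF _ _ tendsto_const s0])
      show "\<forall>\<^sub>F \<epsilon> in at_right 0. dist_H (p \<epsilon>) lam (E \<epsilon>) E0 + dist_H (p \<epsilon>) lam E0 (E \<epsilon>) \<le> ennreal (2 * (C * sqrt (\<tau> \<epsilon>)))"
        using ev2
      proof (rule eventually_mono)
        fix \<epsilon> assume \<epsilon>: "\<epsilon> \<in> {0<..\<epsilon>2}"
        show "dist_H (p \<epsilon>) lam (E \<epsilon>) E0 + dist_H (p \<epsilon>) lam E0 (E \<epsilon>) \<le> ennreal (2 * (C * sqrt (\<tau> \<epsilon>)))"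
          using bound[OF \<epsilon>] small(4)[OF \<epsilon>] by (simp add: powr_half_sqrt)
      qed
    qed auto
  qed
  moreover have "\<forall>k u0. inj_on u0 {1..k::nat} \<and> E0 = u0 ` {1..k} \<longrightarrow>
      (\<exists>C>0. \<exists>\<delta>\<in>{0<..\<epsilon>0}. \<exists>ue. \<forall>\<epsilon>\<in>{0<..\<delta>}.
         inj_on (ue \<epsilon>) {1..k} \<and> E \<epsilon> = ue \<epsilon> ` {1..k} \<and>
         (\<forall>i\<in>{1..k}. X_norm (p \<epsilon>) lam (\<lambda>x. ue \<epsilon> i x - u0 i x)
            \<le> C * (Linf_norm (Om1 x1 x2) (\<lambda>x. p \<epsilon> x - p0 x) + \<epsilon>) powr (1 / 2)))"
  proof (intro allI impI)
    fix k u0 assume "inj_on u0 {1..k::nat} \<and> E0 = u0 ` {1..k}"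
    then have "inj_on u0 {1..k}" "E0 = u0 ` {1..k}" by auto
    from part2[OF this] show "\<exists>C>0. \<exists>\<delta>\<in>{0<..\<epsilon>0}. \<exists>ue. \<forall>\<epsilon>\<in>{0<..\<delta>}.
         inj_on (ue \<epsilon>) {1..k} \<and> E \<epsilon> = ue \<epsilon> ` {1..k} \<and>
         (\<forall>i\<in>{1..k}. X_norm (p \<epsilon>) lam (\<lambda>x. ue \<epsilon> i x - u0 i x)
            \<le> C * (Linf_norm (Om1 x1 x2) (\<lambda>x. p \<epsilon> x - p0 x) + \<epsilon>) powr (1 / 2))"
      unfolding \<tau>_def d_def using C \<epsilon>2 by (intro exI[of _ C] conjI bexI[of _ \<epsilon>2])
  qed
  ultimately show ?thesis by (rule conjI)
qed

end
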